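(* Let $L$ be a lattice of signature $(2,n)$ with $n\ge3$, let $J\subset L$ be a primitive isotropic sublattice of rank $2$, and let $\lambda=(\lambda_1\ge\cdots\ge\lambda_n\ge0)$ be a partition with ${}^t\lambda_1+{}^t\lambda_2\le n$ and $\lambda\ne\det$. The $J$-filtration $F^{\bullet}\mathcal E_\lambda$ on $\mathcal E_\lambda$ satisfies $$F^{\lambda_1+1}\mathcal E_\lambda=0,\qquad F^{-\lambda_1}\mathcal E_\lambda=\mathcal E_\lambda$$ and $$F^{\lambda_1}\mathcal E_\lambda=\mathrm{Gr}^{\lambda_1}\mathcal E_\lambda\neq0,\qquad \mathrm{Gr}^{-\lambda_1}\mathcal E_\lambda\ne0.$$ Thus $F^\bullet\mathcal E_\lambda$ has length $\le2\lambda_1+1$, from level $-\lambda_1$ to $\lambda_1$. The graded quotients $\mathrm{Gr}^r\mathcal E_\lambda$ and $\mathrm{Gr}^{-r}\mathcal E_\lambda$ have the same rank. Moreover, $F^{\lambda_1}\mathcal E_\lambda$ coincides with the sub vector bundle $\mathcal E_\lambda^J$ of $\mathcal E_\lambda$.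
   Context: A lattice is a free $\mathbb Z$-module of finite rank with a nondegenerate symmetric bilinear form $(\cdot,\cdot)$ with values in $\mathbb Z$; $L_F=L\otimes_{\mathbb Z}F$. $\mathcal D$ is a fixed connected component of $\{[\omega]\in\mathbb P(L_{\mathbb C}) : (\omega,\omega)=0,\ (\omega,\bar\omega)>0\}$. Over $\mathcal D$: $\mathcal L\subset L_{\mathbb C}\otimes\mathcal O_{\mathcal D}$ is the tautological line bundle (fiber $\mathbb C\omega$) and $\mathcal E=\mathcal L^\perp/\mathcal L$ (fiber $\omega^\perp/\mathbb C\omega$) with its induced nondegenerate quadratic form. For a partition $\lambda$ as in the claim (${}^t\lambda$ the transpose), $d=|\lambda|$ and an $n$-dimensional complex quadratic space $V$, $V^{[d]}\subset V^{\otimes d}$ is the intersection of the kernels of all contractions $V^{\otimes d}\to V^{\otimes(d-2)}$ and $V_\lambda=c_\lambda\cdot V^{[d]}$ with $c_\lambda=b_\lambda a_\lambda$ the Young symmetrizer of the column canonical tableau ($a_\lambda$ the sum over the row subgroup, $b_\lambda$ the signed sum over the column subgroup); $V_\lambda$ is the irreducible representation of $\mathrm O(V)$ labelled by $\lambda$; $\det$ corresponds to $(1^n)$. Applied fiberwise to $\mathcal E$ this gives $\mathcal E_\lambda\subset\mathcal E^{\otimes d}$. $J$-filtration. Let $\mathcal E_J\subset\mathcal E$ be the isotropic sub line bundle whose fiber at $[\omega]$ is the image of $\omega^\perp\cap J_{\mathbb C}$ in $\omega^\perp/\mathbb C\omega$. Put $F^1\mathcal E=\mathcal E_J$, $F^0\mathcal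 E=\mathcal E_J^\perp$, $F^{-1}\mathcal E=\mathcal E$ and, for $-d\le r\le d$, $$F^r\mathcal E^{\otimes d}=\sum_{i_1+\cdots+i_d=r}F^{i_1}\mathcal E\otimes\cdots\otimes F^{i_d}\mathcal E\quad(i_j\in\{-1,0,1\}),\qquad F^r\mathcal E_\lambda=\mathcal E_\lambda\cap F^r\mathcal E^{\otimes d},$$ with $F^{d+1}=0$ and $\mathrm{Gr}^r=F^r/F^{r+1}$. The sub bundle $\mathcal E_\lambda^J$. Choose a rank $1$ primitive sublattice $I\subset J$ and put $V(I)=(I^\perp/I)_{\mathbb C}$. The isomorphisms $I_{\mathbb C}^\perp/I_{\mathbb C}\leftarrow I_{\mathbb C}^\perp\cap\omega^\perp\to\omega^\perp/\mathbb C\omega$ give the $I$-trivialization $V(I)\otimes\mathcal O_{\mathcal D}\simeq\mathcal E$, hence $V(I)_\lambda\otimes\mathcal O_{\mathcal D}\simeq\mathcal E_\lambda$. Let $U(J/I)_{\mathbb C}$ be the unipotent radical of the stabilizer of the isotropic line $J_{\mathbb C}/I_{\mathbb C}\subset V(I)$ in $\mathrm O(V(I))$, i.e. the subgroup of $\mathrm O(V(I))$ preserving $J_{\mathbb C}/I_{\mathbb C}$ and acting trivially on $J_{\mathbb C}/I_{\mathbb C}$ and on $(J^\perp/J)_{\mathbb C}$. Then $\mathcal E_\lambda^J\subset\mathcal E_\lambda$ is the image of $V(I)_\lambda^{U(J/I)_{\mathbb C}}\otimes\mathcal O_{\mathcal D}$ (invariant subspace) under the $I$-trivialization; it is independent of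 $I$. *)

theory Defs
  imports
    "HOL-Analysis.Analysis"
    "HOL-Combinatorics.Permutations"
    "HOL-Library.Set_Algebras"
    "HOL-Library.Function_Algebras"
begin

section \<open>Lattices\<close>

text \<open>
  A free \<open>\<int>\<close>-module of finite rank is taken with a chosen basis, as \<open>int ^ 'm\<close>; the form is given
  by its Gram matrix \<open>G\<close>.  Then \<open>L\<^sub>F = F ^ 'm\<close>, and \<open>lform G\<close> is the form over any commutative ring.
\<close>

definition lform :: "int ^ 'm ^ 'm \<Rightarrow> 'a::comm_ring_1 ^ 'm \<Rightarrow> 'a ^ 'm \<Rightarrow> 'a" where
  "lform G x y = (\<Sum>i\<in>UNIV. \<Sum>j\<in>UNIV. of_int (G $ i $ j) * x $ i * y $ j)"

definition lattice_form :: "int ^ 'm ^ 'm \<Rightarrow> bool" where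
  "lattice_form G \<longleftrightarrow> (\<forall>x y :: int ^ 'm. lform G x y = lform G y x) \<and>
     (\<forall>x :: int ^ 'm. x \<noteq> 0 \<longrightarrow> (\<exists>y. lform G x y \<noteq> 0))"

text \<open>
  Signature \<open>(p, q)\<close>: some orthogonal basis of \<open>L\<^sub>\<real>\<close> consists of \<open>p\<close> vectors of positive and
  \<open>q\<close> vectors of negative norm.
\<close>

definition has_signature :: "int ^ 'm ^ 'm \<Rightarrow> nat \<Rightarrow> nat \<Rightarrow> bool" where
  "has_signature G p q \<longleftrightarrow>
     (\<exists>b :: 'm \<Rightarrow> real ^ 'm. inj b \<and> independent (range b) \<and>
        (\<forall>i j. i \<noteq> j \<longrightarrow> lform G (b i) (b j) = 0) \<and>
        card {i. lform G (b i) (b i) > 0} = p \<and>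
        card {i. lform G (b i) (b i) < 0} = q \<and>
        p + q = CARD('m))"

definition complexification :: "(int ^ 'm) set \<Rightarrow> (complex ^ 'm) set" where
  "complexification M = vec.span ((\<lambda>x. \<chi> i. of_int (x $ i)) ` M)"

definition primitive_sublattice :: "(int ^ 'm) set \<Rightarrow> bool" where
  "primitive_sublattice M \<longleftrightarrow> 0 \<in> M \<and> (\<forall>x\<in>M. \<forall>y\<in>M. x - y \<in> M) \<and>
     (\<forall>k x. k \<noteq> 0 \<longrightarrow> k *s x \<in> M \<longrightarrow> x \<in> M)"

definition sublattice_rank :: "(int ^ 'm) set \<Rightarrow> nat" where
  "sublattice_rank M = vec.dim (complexification M)"

definition isotropic :: "int ^ 'm ^ 'm \<Rightarrow> (int ^ 'm) set \<Rightarrow> bool" where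
  "isotropic G M \<longleftrightarrow> (\<forall>x\<in>M. \<forall>y\<in>M. lform G x y = 0)"

definition perp :: "int ^ 'm ^ 'm \<Rightarrow> (complex ^ 'm) set \<Rightarrow> (complex ^ 'm) set" where
  "perp G S = {x. \<forall>y\<in>S. lform G x y = 0}"


section \<open>The period domain\<close>

text \<open>
  A point \<open>[\<omega>]\<close> of \<open>\<P>(L\<^sub>\<complex>)\<close> is the line \<open>\<complex>\<omega>\<close> itself, so it also serves as the fiber of the
  tautological bundle at that point. \<open>\<P>(L\<^sub>\<complex>)\<close> carries the quotient topology from \<open>L\<^sub>\<complex> - {0}\<close>.
\<close>

definition proj_topology :: "(complex ^ 'm) set topology" where
  "proj_topology = topology (\<lambda>U. U \<subseteq> {vec.span {w} | w. w \<noteq> 0} \<and>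
     open {w. w \<noteq> 0 \<and> vec.span {w} \<in> U})"

lemma openin_proj_topology:
  "openin proj_topology U \<longleftrightarrow> U \<subseteq> {vec.span {w} | w. w \<noteq> 0} \<and>
     open {w :: complex ^ 'm. w \<noteq> 0 \<and> vec.span {w} \<in> U}"
proof -
  let ?P = "\<lambda>U. U \<subseteq> {vec.span {w} | w. w \<noteq> 0} \<and> open {w :: complex ^ 'm. w \<noteq> 0 \<and> vec.span {w} \<in> U}"
  have "?P (S \<inter> T)" if "?P S" "?P T" for S T
  proof -
    have "{w :: complex ^ 'm. w \<noteq> 0 \<and> vec.span {w} \<in> S \<inter> T} =
        {w. w \<noteq> 0 \<and> vec.span {w} \<in> S} \<inter> {w. w \<noteq> 0 \<and> vec.span {w} \<in> T}" by blast
    then show ?thesis using that by (auto intro: open_Int)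
  qed
  moreover have "?P (\<Union> K)" if "\<forall>S\<in>K. ?P S" for K
  proof -
    have "{w :: complex ^ 'm. w \<noteq> 0 \<and> vec.span {w} \<in> \<Union> K} =
        (\<Union>S\<in>K. {w. w \<noteq> 0 \<and> vec.span {w} \<in> S})" by blast
    then show ?thesis using that by (auto intro!: open_UN)
  qed
  ultimately have "istopology ?P" unfolding istopology_def by blast
  then show ?thesis by (simp add: proj_topology_def topology_inverse')
qed

text \<open>\<open>(\<omega>, \<omega>\<^sup>*)\<close> is automatically real, and \<open>\<omega> \<noteq> 0\<close> follows from its positivity.\<close>

definition period_locus :: "int ^ 'm ^ 'm \<Rightarrow> (complex ^ 'm) set set" where
  "period_locus G = {vec.span {w} | w. lform G w w = 0 \<and>
     Re (lform G w (\<chi> i. cnj (w $ i))) > 0}"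

definition period_domain :: "int ^ 'm ^ 'm \<Rightarrow> (complex ^ 'm) set set \<Rightarrow> bool" where
  "period_domain G D \<longleftrightarrow>
     D \<in> connected_components_of (subtopology proj_topology (period_locus G))"


section \<open>Complex quadratic spaces and their tensor powers\<close>

record 'v quad_space =
  carr :: "'v set"
  vadd :: "'v \<Rightarrow> 'v \<Rightarrow> 'v"
  smul :: "complex \<Rightarrow> 'v \<Rightarrow> 'v"
  qform :: "'v \<Rightarrow> 'v \<Rightarrow> complex"

text \<open>
  The quotient \<open>W / U\<close> of subspaces \<open>U \<subseteq> W \<subseteq> L\<^sub>\<complex>\<close> with \<open>U\<close> orthogonal to \<open>W\<close>; vectors are cosets.
  Adding \<open>U\<close> in the scalar multiplication only matters for the scalar \<open>0\<close>.
\<close>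

definition quot_space ::
    "int ^ 'm ^ 'm \<Rightarrow> (complex ^ 'm) set \<Rightarrow> (complex ^ 'm) set \<Rightarrow> (complex ^ 'm) set quad_space" where
  "quot_space G W U = \<lparr>
     carr = (\<lambda>x. x +o U) ` W,
     vadd = (\<lambda>A B. A + B),
     smul = (\<lambda>c A. (*s) c ` A + U),
     qform = (\<lambda>A B. THE z. \<forall>x\<in>A. \<forall>y\<in>B. lform G x y = z) \<rparr>"

definition qperp :: "'v quad_space \<Rightarrow> 'v set \<Rightarrow> 'v set" where
  "qperp V N = {v \<in> carr V. \<forall>w\<in>N. qform V v w = 0}"

text \<open>\<open>d\<close>-linear forms on \<open>V\<close>; their values off \<open>V\<^sup>d\<close> are irrelevant and left unconstrained.\<close>

definition mlforms :: "'v quad_space \<Rightarrow> nat \<Rightarrow> ('v list \<Rightarrow> complex) set" where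
  "mlforms V d = {\<phi>. \<forall>vs\<in>lists (carr V). length vs = d \<longrightarrow>
     (\<forall>k<d. \<forall>x\<in>carr V. \<forall>y\<in>carr V. \<forall>c.
        \<phi> (vs[k := vadd V x y]) = \<phi> (vs[k := x]) + \<phi> (vs[k := y]) \<and>
        \<phi> (vs[k := smul V c x]) = c * \<phi> (vs[k := x]))}"

text \<open>
  \<open>V\<^sup>\<otimes>\<^sup>d\<close> is realized inside the dual of the space of \<open>d\<close>-linear forms on \<open>V\<close>: the pure tensor
  \<open>v\<^sub>1 \<otimes> \<dots> \<otimes> v\<^sub>d\<close> is evaluation at \<open>(v\<^sub>1, \<dots>, v\<^sub>d)\<close>, and \<open>V\<^sup>\<otimes>\<^sup>d\<close> is the span of the pure tensors.
\<close>

type_synonym 'v tensor = "('v list \<Rightarrow> complex) \<Rightarrow> complex"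

definition fscale :: "complex \<Rightarrow> ('x \<Rightarrow> complex) \<Rightarrow> 'x \<Rightarrow> complex" where
  "fscale c f = (\<lambda>x. c * f x)"

interpretation cfun: vector_space "fscale :: complex \<Rightarrow> ('x \<Rightarrow> complex) \<Rightarrow> 'x \<Rightarrow> complex"
  by standard (auto simp: fscale_def fun_eq_iff algebra_simps)

definition pure :: "'v quad_space \<Rightarrow> nat \<Rightarrow> 'v list \<Rightarrow> 'v tensor" where
  "pure V d vs = (\<lambda>\<phi>. if \<phi> \<in> mlforms V d then \<phi> vs else 0)"

definition tensor_power :: "'v quad_space \<Rightarrow> nat \<Rightarrow> 'v tensor set" where
  "tensor_power V d = cfun.span (pure V d ` {vs \<in> lists (carr V). length vs = d})"

text \<open>
  Linear maps into \<open>V\<^sup>\<otimes>\<^sup>d\<close> are transposes of pullbacks \<open>P\<close> of \<open>d\<close>-linear forms on \<open>V\<close>.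
  On pure tensors the next three maps are
  \<open>v\<^sub>1 \<otimes> \<dots> \<otimes> v\<^sub>d \<mapsto> (v\<^sub>i, v\<^sub>j) v\<^sub>1 \<otimes> \<dots> (omit v\<^sub>i, v\<^sub>j) \<dots> \<otimes> v\<^sub>d\<close>,
  the left action moving \<open>v\<^sub>k\<close> to position \<open>\<sigma> k\<close>, and \<open>v\<^sub>1 \<otimes> \<dots> \<otimes> v\<^sub>d \<mapsto> f v\<^sub>1 \<otimes> \<dots> \<otimes> f v\<^sub>d\<close>.
  Tensor positions are numbered from \<open>0\<close>.
\<close>

definition transpose_map ::
    "'v quad_space \<Rightarrow> nat \<Rightarrow> (('v list \<Rightarrow> complex) \<Rightarrow> ('u list \<Rightarrow> complex)) \<Rightarrow> 'u tensor \<Rightarrow> 'v tensor" where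
  "transpose_map V d P t = (\<lambda>\<phi>. if \<phi> \<in> mlforms V d then t (P \<phi>) else 0)"

definition contraction :: "'v quad_space \<Rightarrow> nat \<Rightarrow> nat \<Rightarrow> nat \<Rightarrow> 'v tensor \<Rightarrow> 'v tensor" where
  "contraction V d i j = transpose_map V (d - 2)
     (\<lambda>\<psi> vs. qform V (vs ! i) (vs ! j) * \<psi> (nths vs (- {i, j})))"

definition perm_tensor :: "'v quad_space \<Rightarrow> nat \<Rightarrow> (nat \<Rightarrow> nat) \<Rightarrow> 'v tensor \<Rightarrow> 'v tensor" where
  "perm_tensor V d \<sigma> = transpose_map V d (\<lambda>\<phi> vs. \<phi> (permute_list (inv \<sigma>) vs))"

definition map_tensor :: "'v quad_space \<Rightarrow> nat \<Rightarrow> ('u \<Rightarrow> 'v) \<Rightarrow> 'u tensor \<Rightarrow> 'v tensor" where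
  "map_tensor V d f = transpose_map V d (\<lambda>\<phi> us. \<phi> (map f us))"

definition traceless :: "'v quad_space \<Rightarrow> nat \<Rightarrow> 'v tensor set" where
  "traceless V d = {t \<in> tensor_power V d. \<forall>i j. i < j \<and> j < d \<longrightarrow> contraction V d i j t = 0}"


section \<open>Young symmetrizers and the representations \<open>V\<^sub>\<lambda>\<close>\<close>

text \<open>
  A partition is the list \<open>\<lambda>\<^sub>1 \<ge> \<dots> \<ge> \<lambda>\<^sub>n \<ge> 0\<close>, zero parts included; \<open>conj_part lam j\<close> is the \<open>j\<close>-th part of the
  transpose, \<open>j \<ge> 1\<close>. Rows and columns of the diagram are numbered from \<open>0\<close> below, and the column
  canonical tableau has entries \<open>0, \<dots>, d - 1\<close>, increasing down the columns, from left to right.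
\<close>

definition conj_part :: "nat list \<Rightarrow> nat \<Rightarrow> nat" where
  "conj_part lam j = card {i. i < length lam \<and> j \<le> lam ! i}"

definition tab_entry :: "nat list \<Rightarrow> nat \<Rightarrow> nat \<Rightarrow> nat" where
  "tab_entry lam i j = (\<Sum>j'<j. conj_part lam (Suc j')) + i"

definition row_subgroup :: "nat list \<Rightarrow> (nat \<Rightarrow> nat) set" where
  "row_subgroup lam = {\<sigma>. \<sigma> permutes {..<sum_list lam} \<and>
     (\<forall>i < length lam. \<sigma> ` {tab_entry lam i j | j. j < lam ! i} = {tab_entry lam i j | j. j < lam ! i})}"

definition column_subgroup :: "nat list \<Rightarrow> (nat \<Rightarrow> nat) set" where
  "column_subgroup lam = {\<sigma>. \<sigma> permutes {..<sum_list lam} \<and>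
     (\<forall>j. \<sigma> ` {tab_entry lam i j | i. i < conj_part lam (Suc j)} =
          {tab_entry lam i j | i. i < conj_part lam (Suc j)})}"

definition young_a :: "'v quad_space \<Rightarrow> nat list \<Rightarrow> 'v tensor \<Rightarrow> 'v tensor" where
  "young_a V lam t = (\<Sum>\<sigma>\<in>row_subgroup lam. perm_tensor V (sum_list lam) \<sigma> t)"

definition young_b :: "'v quad_space \<Rightarrow> nat list \<Rightarrow> 'v tensor \<Rightarrow> 'v tensor" where
  "young_b V lam t =
     (\<Sum>\<sigma>\<in>column_subgroup lam. fscale (of_int (sign \<sigma>)) (perm_tensor V (sum_list lam) \<sigma> t))"

definition schur_orth :: "'v quad_space \<Rightarrow> nat list \<Rightarrow> 'v tensor set" where
  "schur_orth V lam = (\<lambda>t. young_b V lam (young_a V lam t)) ` traceless V (sum_list lam)"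


section \<open>The filtration defined by an isotropic line\<close>

definition filt1 :: "'v quad_space \<Rightarrow> 'v set \<Rightarrow> int \<Rightarrow> 'v set" where
  "filt1 V N i = (if i = 1 then N else if i = 0 then qperp V N else carr V)"

text \<open>
  A sum of tensor products of subspaces is spanned by the pure tensors it contains. For \<open>r > d\<close>
  the generating set is empty, which gives the convention \<open>F\<^sup>d\<^sup>+\<^sup>1 = 0\<close>; \<open>r < -d\<close> is not used.
\<close>

definition filt_tensor :: "'v quad_space \<Rightarrow> 'v set \<Rightarrow> nat \<Rightarrow> int \<Rightarrow> 'v tensor set" where
  "filt_tensor V N d r = cfun.span {pure V d vs | vs is.
     length vs = d \<and> length is = d \<and> set is \<subseteq> {-1, 0, 1} \<and> sum_list is = r \<and>
     (\<forall>k<d. vs ! k \<in> filt1 V N (is ! k))}"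

definition filt_schur :: "'v quad_space \<Rightarrow> 'v set \<Rightarrow> nat list \<Rightarrow> int \<Rightarrow> 'v tensor set" where
  "filt_schur V N lam r = schur_orth V lam \<inter> filt_tensor V N (sum_list lam) r"


section \<open>The bundles over the period domain\<close>

text \<open>
  All bundles are sub bundles of tensor powers of \<open>\<E>\<close> and are given by their fibers at the
  points \<open>l = \<complex>\<omega>\<close>.
\<close>

definition E_fib :: "int ^ 'm ^ 'm \<Rightarrow> (complex ^ 'm) set \<Rightarrow> (complex ^ 'm) set quad_space" where
  "E_fib G l = quot_space G (perp G l) l"

definition E_lam :: "int ^ 'm ^ 'm \<Rightarrow> nat list \<Rightarrow> (complex ^ 'm) set \<Rightarrow> (complex ^ 'm) set tensor set" where
  "E_lam G lam l = schur_orth (E_fib G l) lam"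

definition E_J :: "int ^ 'm ^ 'm \<Rightarrow> (int ^ 'm) set \<Rightarrow> (complex ^ 'm) set \<Rightarrow> (complex ^ 'm) set set" where
  "E_J G J l = (\<lambda>x. x +o l) ` (perp G l \<inter> complexification J)"

definition F_lam ::
    "int ^ 'm ^ 'm \<Rightarrow> (int ^ 'm) set \<Rightarrow> nat list \<Rightarrow> int \<Rightarrow> (complex ^ 'm) set \<Rightarrow> (complex ^ 'm) set tensor set" where
  "F_lam G J lam r l = filt_schur (E_fib G l) (E_J G J l) lam r"

text \<open>The zero vector of the quotient \<open>Gr\<^sup>r = F\<^sup>r / F\<^sup>r\<^sup>+\<^sup>1\<close> is the coset \<open>F\<^sup>r\<^sup>+\<^sup>1\<close>.\<close>

definition Gr_lam ::
    "int ^ 'm ^ 'm \<Rightarrow> (int ^ 'm) set \<Rightarrow> nat list \<Rightarrow> int \<Rightarrow> (complex ^ 'm) set \<Rightarrow> (complex ^ 'm) set tensor set set" where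
  "Gr_lam G J lam r l = (\<lambda>t. t +o F_lam G J lam (r + 1) l) ` F_lam G J lam r l"

definition Gr_nonzero ::
    "int ^ 'm ^ 'm \<Rightarrow> (int ^ 'm) set \<Rightarrow> nat list \<Rightarrow> int \<Rightarrow> (complex ^ 'm) set \<Rightarrow> bool" where
  "Gr_nonzero G J lam r l \<longleftrightarrow> Gr_lam G J lam r l \<noteq> {F_lam G J lam (r + 1) l}"

text \<open>The fiber dimension of \<open>Gr\<^sup>r\<close>, as \<open>F\<^sup>r\<^sup>+\<^sup>1 \<subseteq> F\<^sup>r\<close> are finite-dimensional.\<close>

definition Gr_dim ::
    "int ^ 'm ^ 'm \<Rightarrow> (int ^ 'm) set \<Rightarrow> nat list \<Rightarrow> int \<Rightarrow> (complex ^ 'm) set \<Rightarrow> int" where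
  "Gr_dim G J lam r l =
     int (cfun.dim (F_lam G J lam r l)) - int (cfun.dim (F_lam G J lam (r + 1) l))"


section \<open>The sub bundle \<open>\<E>\<^sub>\<lambda>\<^sup>J\<close>\<close>

definition V_cusp :: "int ^ 'm ^ 'm \<Rightarrow> (int ^ 'm) set \<Rightarrow> (complex ^ 'm) set quad_space" where
  "V_cusp G I = quot_space G (perp G (complexification I)) (complexification I)"

text \<open>
  The fiber at \<open>l\<close> of the \<open>I\<close>-trivialization: a coset of \<open>I\<^sub>\<complex>\<close> in \<open>I\<^sub>\<complex>\<^sup>\<bottom>\<close> is sent to the class of its
  unique representative in \<open>I\<^sub>\<complex>\<^sup>\<bottom> \<inter> \<omega>\<^sup>\<bottom>\<close>.
\<close>

definition I_triv :: "int ^ 'm ^ 'm \<Rightarrow> (complex ^ 'm) set \<Rightarrow> (complex ^ 'm) set \<Rightarrow> (complex ^ 'm) set" where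
  "I_triv G l A = (THE B. \<exists>x \<in> A \<inter> perp G l. B = x +o l)"

definition orth_group :: "'v quad_space \<Rightarrow> ('v \<Rightarrow> 'v) set" where
  "orth_group V = {g. bij_betw g (carr V) (carr V) \<and>
     (\<forall>x\<in>carr V. \<forall>y\<in>carr V. g (vadd V x y) = vadd V (g x) (g y)) \<and>
     (\<forall>c. \<forall>x\<in>carr V. g (smul V c x) = smul V c (g x)) \<and>
     (\<forall>x\<in>carr V. \<forall>y\<in>carr V. qform V (g x) (g y) = qform V x y)}"

text \<open>
  For \<open>V = V(I)\<close> and \<open>N = J\<^sub>\<complex>/I\<^sub>\<complex>\<close>, the last condition is triviality of the action on
  \<open>N\<^sup>\<bottom>/N = (J\<^sup>\<bottom>/J)\<^sub>\<complex>\<close>.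
\<close>

definition unip_radical :: "'v quad_space \<Rightarrow> 'v set \<Rightarrow> ('v \<Rightarrow> 'v) set" where
  "unip_radical V N = {g \<in> orth_group V. g ` N = N \<and> (\<forall>v\<in>N. g v = v) \<and>
     (\<forall>v\<in>qperp V N. \<exists>w\<in>N. g v = vadd V v w)}"

definition U_cusp ::
    "int ^ 'm ^ 'm \<Rightarrow> (int ^ 'm) set \<Rightarrow> (int ^ 'm) set \<Rightarrow> ((complex ^ 'm) set \<Rightarrow> (complex ^ 'm) set) set" where
  "U_cusp G I J = unip_radical (V_cusp G I) ((\<lambda>x. x +o complexification I) ` complexification J)"

definition V_lam_inv ::
    "int ^ 'm ^ 'm \<Rightarrow> (int ^ 'm) set \<Rightarrow> (int ^ 'm) set \<Rightarrow> nat list \<Rightarrow> (complex ^ 'm) set tensor set" where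
  "V_lam_inv G I J lam = {t \<in> schur_orth (V_cusp G I) lam.
     \<forall>g\<in>U_cusp G I J. map_tensor (V_cusp G I) (sum_list lam) g t = t}"

definition E_lam_J ::
    "int ^ 'm ^ 'm \<Rightarrow> (int ^ 'm) set \<Rightarrow> (int ^ 'm) set \<Rightarrow> nat list \<Rightarrow> (complex ^ 'm) set \<Rightarrow>
     (complex ^ 'm) set tensor set" where
  "E_lam_J G I J lam l = map_tensor (E_fib G l) (sum_list lam) (I_triv G l) ` V_lam_inv G I J lam"

end

theory Submission
  imports Defs
begin

text \<open>
  Everything happens in one fibre.  Over a point \<open>\<complex>\<omega>\<close> of \<open>\<D>\<close> the fibre \<open>V\<close> of \<open>\<E>\<close> is a quadratic space of
  dimension \<open>n\<close> and the fibre \<open>N\<close> of \<open>\<E>\<^sub>J\<close> is an isotropic line.  Choose a basis \<open>v\<^sub>0, \<dots>, v\<^sub>n\<^sub>-\<^sub>1\<close> of \<open>V\<close>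
  with \<open>v\<^sub>0 \<in> N\<close> and \<open>(v\<^sub>a, v\<^sub>b) = 1\<close> or \<open>0\<close> according as \<open>a + b = n - 1\<close> or not.  In coordinates a tensor of
  degree \<open>d\<close> is a function on the words of length \<open>d\<close> in the letters \<open>0, \<dots>, n - 1\<close>; the \<open>J\<close>-filtration is the
  filtration by \<open>weight\<close>, the number of letters \<open>0\<close> minus the number of letters \<open>n - 1\<close>
  (\<open>filt_tensor_rep\<close>), and \<open>V\<^sub>\<lambda>\<close> becomes a space \<open>schur_words\<close> which depends on \<open>\<lambda>\<close> and \<open>n\<close> only
  (\<open>schur_orth_rep\<close>).  So all ranks are the same at all points.  Reversing the alphabet, \<open>a \<mapsto> n - 1 - a\<close>,
  preserves the form and negates the weight, which is the symmetry between \<open>Gr\<^sup>r\<close> and \<open>Gr\<^sup>-\<^sup>r\<close>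
  (\<open>dim_weight_space_neg\<close>).

  Elements of \<open>V\<^sub>\<lambda>\<close> are antisymmetric along the columns of the tableau, so in a word of their support the
  letters of a column are distinct and each of the \<open>\<lambda>\<^sub>1\<close> columns contributes \<open>-1\<close>, \<open>0\<close> or \<open>1\<close> to the weight
  (\<open>weight_bounds\<close>).  The weight \<open>\<lambda>\<^sub>1\<close> occurs (\<open>schur_words_top\<close>): put into every cell of row \<open>i\<close> the
  \<open>i\<close>-th of a family of pairwise orthogonal independent vectors whose first member is \<open>v\<^sub>0\<close> and whose members
  used in rows with more than one cell are isotropic.  Such a family exists because the first two columns have
  total height at most \<open>n\<close> and the first one is shorter than \<open>n\<close>; this product tensor is traceless, and the
  Young symmetrizer does not kill it.

  The unipotent radical \<open>U\<close> raises weights, so it fixes the part of top weight.  Conversely let \<open>t \<in> V\<^sub>\<lambda>\<close> be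
  \<open>U\<close>-invariant, and let \<open>r\<close> be the weight of a word in its support.  Instead of the irreducibility of \<open>V\<^sub>\<lambda>\<close>
  the argument uses the Casimir element of \<open>so(V)\<close>, in the form of its part acting on two different tensor
  positions.  On traceless tensors that part is the sum of the transpositions of all ordered pairs of positions,
  and on \<open>V\<^sub>\<lambda>\<close> it is the scalar \<open>content\<close> (\<open>swap_sum_young\<close>).  The derivative of the invariance says that
  the root operators of the Lie algebra of \<open>U\<close> kill \<open>t\<close>.  The space of such \<open>t\<close> is stable under the Lie algebra of the Levi part, so
  one can take \<open>t\<close> and a word \<open>w\<close> of weight \<open>r\<close> in its support with the least possible sum of letters; then
  all raising operators vanish where they matter and the Casimir scalar can be read off from \<open>w\<close>
  (\<open>casimir_at_word\<close>).  Comparing the two values column by column (\<open>column_letters\<close>, \<open>extremal_weight\<close>) shows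
  that every column of \<open>w\<close> contains \<open>0\<close> but not \<open>n - 1\<close>, that is \<open>r = \<lambda>\<^sub>1\<close> (\<open>raising_kernel_top\<close>).

  The basis comes from the lattice.  A nonzero \<open>z \<in> J\<close> is real and isotropic, so the signature \<open>(2, n)\<close> forbids
  \<open>(z, \<omega>) = 0\<close> (\<open>period_not_perp\<close>), and \<open>S = \<langle>z, \<omega>\<rangle>\<^sup>\<bottom>\<close> is nondegenerate of dimension \<open>n\<close>.  The same space
  \<open>S\<close> maps isomorphically to \<open>\<omega>\<^sup>\<bottom>/\<complex>\<omega>\<close> and, for \<open>z \<in> I\<close>, to \<open>V(I)\<close>, and it contains the line
  \<open>J\<^sub>\<complex> \<inter> \<omega>\<^sup>\<bottom>\<close>.  One basis of \<open>S\<close> beginning in that line therefore serves both spaces, and in its coordinates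
  the \<open>I\<close>-trivialization is the identity (\<open>fibre_frame\<close>, \<open>map_tensor_I_triv\<close>).
\<close>

section \<open>Words and permutations of their positions\<close>

definition words :: "nat \<Rightarrow> nat \<Rightarrow> nat list set" where
  "words n d = {w. length w = d \<and> set w \<subseteq> {..<n}}"

text \<open>
  The left action of permutations of positions: the coordinates of the permuted tensor.
\<close>

definition act :: "(nat \<Rightarrow> nat) \<Rightarrow> (nat list \<Rightarrow> complex) \<Rightarrow> nat list \<Rightarrow> complex" where
  "act \<sigma> c = (\<lambda>w. c (permute_list \<sigma> w))"

lemma finite_words: "finite (words n d)"
  using finite_lists_length_eq[of "{..<n}" d] by (simp add: words_def conj_commute)

lemma words_length: "w \<in> words n d \<Longrightarrow> length w = d"
  by (simp add: words_def)

lemma words_nth: "w \<in> words n d \<Longrightarrow> p < d \<Longrightarrow> w ! p < n"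
  using nth_mem by (fastforce simp: words_def)

lemma words_iff: "w \<in> words n d \<longleftrightarrow> length w = d \<and> (\<forall>p<d. w ! p < n)"
  by (auto simp: words_def set_conv_nth)

lemma words_update: "w \<in> words n d \<Longrightarrow> x < n \<Longrightarrow> w[i := x] \<in> words n d"
  using set_update_subset_insert by (fastforce simp: words_def)

lemma words_0: "words n 0 = {[]}"
  by (auto simp: words_def)

lemma words_Suc: "words n (Suc d) = (\<lambda>(x, w). x # w) ` ({..<n} \<times> words n d)"
  by (auto simp: words_def length_Suc_conv image_iff)

lemma sum_words_Suc: "(\<Sum>w\<in>words n (Suc d). f w) = (\<Sum>x<n. \<Sum>w\<in>words n d. f (x # w))"
  unfolding words_Suc
  by (subst sum.reindex) (auto simp: inj_on_def sum.cartesian_product intro!: sum.cong)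

text \<open>
  Pairings of product tensors factor over the positions; this is how the Young symmetrizer of a product
  tensor is shown to be nonzero.
\<close>

lemma sum_words_prod:
  fixes B :: "nat \<Rightarrow> nat \<Rightarrow> 'a::comm_semiring_1"
  shows "(\<Sum>w\<in>words n d. \<Prod>p<d. B p (w ! p)) = (\<Prod>p<d. \<Sum>x<n. B p x)"
proof (induction d arbitrary: B)
  case 0
  then show ?case by (simp add: words_0)
next
  case (Suc d)
  have "(\<Sum>w\<in>words n (Suc d). \<Prod>p<Suc d. B p (w ! p)) =
      (\<Sum>x<n. \<Sum>w\<in>words n d. B 0 x * (\<Prod>p<d. B (Suc p) (w ! p)))"
    by (simp add: sum_words_Suc prod.lessThan_Suc_shift del: prod.lessThan_Suc)
  also have "\<dots> = (\<Sum>x<n. B 0 x) * (\<Sum>w\<in>words n d. \<Prod>p<d. B (Suc p) (w ! p))"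
    by (simp only: sum_product)
  finally show ?case
    by (simp add: Suc[of "\<lambda>p. B (Suc p)"] prod.lessThan_Suc_shift del: prod.lessThan_Suc)
qed

lemma sum_words_line:
  fixes t :: "nat list \<Rightarrow> 'a::comm_monoid_add"
  assumes "w \<in> words n d" "i < d"
  shows "(\<Sum>u\<in>words n d. if \<forall>p<d. p \<noteq> i \<longrightarrow> u ! p = w ! p then t u else 0) = (\<Sum>b<n. t (w[i := b]))"
proof -
  have "{u \<in> words n d. \<forall>p<d. p \<noteq> i \<longrightarrow> u ! p = w ! p} = (\<lambda>b. w[i := b]) ` {..<n}"
  proof (intro equalityI subsetI)
    fix u assume u: "u \<in> {u \<in> words n d. \<forall>p<d. p \<noteq> i \<longrightarrow> u ! p = w ! p}"
    then have "u = w[i := u ! i]"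
      using assms by (intro nth_equalityI) (auto simp: words_iff nth_list_update)
    moreover have "u ! i < n" using u assms(2) by (auto intro: words_nth)
    ultimately show "u \<in> (\<lambda>b. w[i := b]) ` {..<n}" by blast
  next
    fix u assume "u \<in> (\<lambda>b. w[i := b]) ` {..<n}"
    then show "u \<in> {u \<in> words n d. \<forall>p<d. p \<noteq> i \<longrightarrow> u ! p = w ! p}"
      using assms by (auto simp: words_update)
  qed
  moreover have "inj_on (\<lambda>b. w[i := b]) {..<n}"
    using assms by (intro inj_onI) (metis nth_list_update_eq words_length)
  ultimately show ?thesis
    by (simp add: sum.If_cases finite_words Int_def sum.reindex flip: Collect_conj_eq)
qed

lemma permute_list_words: "\<sigma> permutes {..<d} \<Longrightarrow> permute_list \<sigma> w \<in> words n d \<longleftrightarrow> w \<in> words n d"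
  by (auto simp: words_def)

lemma permute_list_inv:
  assumes "\<sigma> permutes {..<length w}"
  shows "permute_list \<sigma> (permute_list (inv \<sigma>) w) = w" "permute_list (inv \<sigma>) (permute_list \<sigma> w) = w"
proof -
  show "permute_list \<sigma> (permute_list (inv \<sigma>) w) = w"
    using permute_list_compose[of \<sigma> w "inv \<sigma>"] assms
    by (metis permutes_inv permutes_inv_o(2) permute_list_id permute_list_compose)
  show "permute_list (inv \<sigma>) (permute_list \<sigma> w) = w"
    by (metis assms permutes_inv permutes_inv_o(1) permute_list_id permute_list_compose)
qed

lemma sum_words_permute:
  assumes "\<sigma> permutes {..<d}"
  shows "(\<Sum>w\<in>words n d. f (permute_list \<sigma> w)) = (\<Sum>w\<in>words n d. f w)"
  by (rule sum.reindex_bij_witness[of _ "permute_list (inv \<sigma>)" "permute_list \<sigma>"])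
    (use assms in \<open>auto simp: permute_list_inv words_length permute_list_words permutes_inv\<close>)

lemma permute_list_update:
  assumes "\<sigma> permutes {..<length w}" "i < length w"
  shows "(permute_list \<sigma> w)[i := y] = permute_list \<sigma> (w[\<sigma> i := y])"
proof (rule nth_equalityI)
  fix k assume "k < length ((permute_list \<sigma> w)[i := y])"
  then have k: "k < length w" by simp
  have "\<sigma> k < length w" "\<sigma> i < length w"
    using assms k permutes_in_image[OF assms(1)] by auto
  moreover have "\<sigma> i = \<sigma> k \<longleftrightarrow> i = k"
    using assms(1) permutes_inj by (metis injD)
  ultimately show "(permute_list \<sigma> w)[i := y] ! k = permute_list \<sigma> (w[\<sigma> i := y]) ! k"
    using assms k by (simp add: nth_list_update permute_list_nth)
qed simp

lemma permute_list_transpose: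
  assumes "i < length w" "j < length w"
  shows "permute_list (Transposition.transpose i j) w = w[i := w ! j, j := w ! i]"
  by (rule nth_equalityI) (use assms in \<open>auto simp: permute_list_def nth_list_update Transposition.transpose_def\<close>)

lemma act_compose:
  assumes "\<sigma> permutes {..<length w}" "\<tau> permutes {..<length w}"
  shows "act (\<sigma> \<circ> \<tau>) c w = act \<sigma> (act \<tau> c) w"
  using assms by (simp add: act_def permute_list_compose)

section \<open>Derivations on functions of words\<close>

text \<open>
  The matrix \<open>A\<close> acting on the tensor position \<open>i\<close>; the full derivation action of \<open>A\<close> on a tensor power is the
  sum over all positions.
\<close>

definition site ::
    "nat \<Rightarrow> (nat \<Rightarrow> nat \<Rightarrow> complex) \<Rightarrow> nat \<Rightarrow> (nat list \<Rightarrow> complex) \<Rightarrow> nat list \<Rightarrow> complex" where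
  "site n A i t = (\<lambda>w. \<Sum>y<n. A (w ! i) y * t (w[i := y]))"

definition derivation ::
    "nat \<Rightarrow> (nat \<Rightarrow> nat \<Rightarrow> complex) \<Rightarrow> (nat list \<Rightarrow> complex) \<Rightarrow> nat list \<Rightarrow> complex" where
  "derivation n A t = (\<lambda>w. \<Sum>i<length w. site n A i t w)"

lemma site_commute:
  assumes "i \<noteq> j"
  shows "site n A i (site n B j t) w = site n B j (site n A i t) w"
  using assms unfolding site_def
  by (simp add: sum_distrib_left list_update_swap mult.left_commute)
    (subst sum.swap, simp)

lemma site_site_same:
  assumes "i < length w"
  shows "site n A i (site n B i t) w = site n (\<lambda>a b. \<Sum>x<n. A a x * B x b) i t w"
  using assms unfolding site_def
  by (simp add: sum_distrib_left sum_distrib_right mult.assoc) (subst sum.swap, simp)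

lemma derivation_derivation:
  "derivation n A (derivation n B t) w = (\<Sum>i<length w. \<Sum>j<length w. site n A i (site n B j t) w)"
  unfolding derivation_def
  by (intro sum.cong refl) (simp add: site_def sum_distrib_left, subst sum.swap, simp)

text \<open>
  Operators at different positions commute, so only the equal positions contribute.
\<close>

lemma derivation_commutator:
  "derivation n A (derivation n B t) w - derivation n B (derivation n A t) w =
   derivation n (\<lambda>a b. (\<Sum>x<n. A a x * B x b) - (\<Sum>x<n. B a x * A x b)) t w"
proof -
  let ?L = "length w"
  have "derivation n A (derivation n B t) w - derivation n B (derivation n A t) w =
      (\<Sum>i<?L. \<Sum>j<?L. site n A i (site n B j t) w) - (\<Sum>i<?L. \<Sum>j<?L. site n B j (site n A i t) w)"
    unfolding derivation_derivation by (subst (2) sum.swap) simp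
  also have "\<dots> = (\<Sum>i<?L. \<Sum>j<?L. if i = j then
      site n A i (site n B i t) w - site n B i (site n A i t) w else 0)"
    unfolding sum_subtractf[symmetric] by (intro sum.cong refl) (simp add: site_commute)
  also have "\<dots> = (\<Sum>i<?L. site n A i (site n B i t) w - site n B i (site n A i t) w)"
    by simp
  also have "\<dots> = (\<Sum>i<?L. site n (\<lambda>a b. (\<Sum>x<n. A a x * B x b) - (\<Sum>x<n. B a x * A x b)) i t w)"
    by (intro sum.cong refl)
      (simp add: site_site_same, simp add: site_def sum_subtractf left_diff_distrib)
  finally show ?thesis by (simp add: derivation_def)
qed

lemma derivation_permute:
  assumes "\<sigma> permutes {..<length w}"
  shows "derivation n A t (permute_list \<sigma> w) = derivation n A (act \<sigma> t) w"
proof -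
  have "derivation n A t (permute_list \<sigma> w) =
      (\<Sum>i<length w. \<Sum>y<n. A (w ! \<sigma> i) y * t (permute_list \<sigma> (w[\<sigma> i := y])))"
    unfolding derivation_def site_def using assms
    by (simp add: permute_list_nth permute_list_update)
  also have "\<dots> = (\<Sum>i<length w. \<Sum>y<n. A (w ! i) y * t (permute_list \<sigma> (w[i := y])))"
    using sum.permute[OF assms, of "\<lambda>i. \<Sum>y<n. A (w ! i) y * t (permute_list \<sigma> (w[i := y]))"]
    by (simp add: comp_def)
  finally show ?thesis by (simp add: derivation_def site_def act_def)
qed

text \<open>
  The elements \<open>E\<^sub>x\<^sub>y - E\<^sub>y\<^sub>'\<^sub>x\<^sub>'\<close>, with \<open>a' = n - 1 - a\<close>, spanning \<open>so(V)\<close> for the form that pairs \<open>v\<^sub>a\<close> with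
  \<open>v\<^sub>a\<^sub>'\<close>.  Those with \<open>x < y\<close> span the nilpotent radical of a Borel subalgebra and lower the letters of the
  vectors they act on; \<open>skew n x x\<close> is diagonal.
\<close>

definition skew :: "nat \<Rightarrow> nat \<Rightarrow> nat \<Rightarrow> nat \<Rightarrow> nat \<Rightarrow> complex" where
  "skew n x y a b = of_bool (a = x \<and> b = y) - of_bool (a = n - 1 - y \<and> b = n - 1 - x)"

lemma site_skew:
  assumes "x < n" "y < n"
  shows "site n (skew n x y) i t w =
    of_bool (w ! i = x) * t (w[i := y]) - of_bool (w ! i = n - 1 - y) * t (w[i := n - 1 - x])"
proof -
  have "site n (skew n x y) i t w = (\<Sum>b<n. of_bool (w ! i = x) * (if b = y then t (w[i := b]) else 0)) -
     (\<Sum>b<n. of_bool (w ! i = n - 1 - y) * (if b = n - 1 - x then t (w[i := b]) else 0))"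
    unfolding site_def skew_def sum_subtractf[symmetric] by (intro sum.cong refl) (auto simp: algebra_simps)
  also have "\<dots> = of_bool (w ! i = x) * (\<Sum>b<n. if b = y then t (w[i := b]) else 0) -
     of_bool (w ! i = n - 1 - y) * (\<Sum>b<n. if b = n - 1 - x then t (w[i := b]) else 0)"
    by (simp only: sum_distrib_left)
  finally show ?thesis using assms by (simp add: sum.delta)
qed

section \<open>The Casimir element at an extremal word\<close>

lemma skew_skew_same:
  assumes "x < n" "y < n" "x \<noteq> y" "i < length w"
  shows "site n (skew n y x) i (site n (skew n x y) i t) w =
    (if x + y = n - 1 then 0 else of_bool (w ! i = y) + of_bool (w ! i = n - 1 - x)) * t w"
proof -
  have [simp]: "y = n - 1 - x \<longleftrightarrow> x + y = n - 1" "x = n - 1 - y \<longleftrightarrow> x + y = n - 1"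
      "n - 1 - x = y \<longleftrightarrow> x + y = n - 1" "n - 1 - y = x \<longleftrightarrow> x + y = n - 1"
    using assms by auto
  have u: "w[i := y] = w" if "w ! i = y" for y using that by auto
  show ?thesis
  proof (cases "x + y = n - 1")
    case True
    then have "n - 1 - x = y" "n - 1 - y = x" by auto
    then show ?thesis using assms u by (auto simp: site_skew)
  next
    case False
    then show ?thesis using assms
      by (auto simp: site_skew) (metis list_update_id)+
  qed
qed

lemma skew_diag:
  assumes "x < n" "i < length w"
  shows "site n (skew n x x) i t w = (of_bool (w ! i = x) - of_bool (w ! i = n - 1 - x)) * t w"
proof -
  have u: "w[i := y] = w" if "w ! i = y" for y using that by auto
  show ?thesis using assms by (auto simp: site_skew u left_diff_distrib)
qed

text \<open>
  The invariant tensor \<open>\<Sum> skew n y x \<otimes> skew n x y\<close> of \<open>so(V)\<close> acts on two positions as twice the transposition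
  minus twice the contraction followed by the insertion of the dual of the form.  The latter is gone here, as the
  contraction vanishes.
\<close>

lemma sum_skew_pair:
  assumes w: "w \<in> words n d" and ij: "i < d" "j < d" "i \<noteq> j"
    and tr: "(\<Sum>x<n. t (w[i := x, j := n - 1 - x])) = 0"
  shows "(\<Sum>x<n. \<Sum>y<n. site n (skew n y x) i (site n (skew n x y) j t) w) =
    2 * t (permute_list (Transposition.transpose i j) w)"
proof -
  define a b where "a = w ! i" and "b = w ! j"
  have ab: "a < n" "b < n" using w ij by (auto simp: a_def b_def words_nth)
  have len: "length w = d" using w by (rule words_length)
  have sw: "permute_list (Transposition.transpose i j) w = w[i := b, j := a]"
    using ij len by (simp add: permute_list_transpose a_def b_def)
  have eq: "site n (skew n y x) i (site n (skew n x y) j t) w =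
     (if y = a then if x = b then t (w[i := b, j := a]) else 0 else 0)
     - (if y = a then of_bool (a + b = n - 1) * t (w[i := x, j := n - 1 - x]) else 0)
     - (if x = b then of_bool (a + b = n - 1) * t (w[i := n - 1 - y, j := y]) else 0)
     + (if x = n - 1 - a then if y = n - 1 - b then t (w[i := b, j := a]) else 0 else 0)"
    if "x < n" "y < n" for x y
  proof -
    have s: "site n (skew n x y) j t (w[i := z]) =
        of_bool (b = x) * t (w[i := z, j := y]) - of_bool (b = n - 1 - y) * t (w[i := z, j := n - 1 - x])" for z
      using that ij len by (simp add: site_skew b_def)
    have T1: "of_bool (a = y) * (of_bool (b = x) * t (w[i := x, j := y])) =
        (if y = a then if x = b then t (w[i := b, j := a]) else 0 else 0)"
      by simp
    have T2: "of_bool (a = y) * (of_bool (b = n - 1 - y) * t (w[i := x, j := n - 1 - x])) =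
        (if y = a then of_bool (a + b = n - 1) * t (w[i := x, j := n - 1 - x]) else 0)"
    proof (cases "a = y")
      case True
      then have e: "(b = n - 1 - y) = (a + b = n - 1)" using ab by auto
      show ?thesis unfolding e using True by simp
    qed simp
    have T3: "of_bool (a = n - 1 - x) * (of_bool (b = x) * t (w[i := n - 1 - y, j := y])) =
        (if x = b then of_bool (a + b = n - 1) * t (w[i := n - 1 - y, j := y]) else 0)"
    proof (cases "b = x")
      case True
      then have e: "(a = n - 1 - x) = (a + b = n - 1)" using ab by auto
      show ?thesis unfolding e using True by simp
    qed simp
    have "(a = n - 1 - x) = (x = n - 1 - a)" "(b = n - 1 - y) = (y = n - 1 - b)"
      using that ab by auto
    then have T4: "of_bool (a = n - 1 - x) * (of_bool (b = n - 1 - y) * t (w[i := n - 1 - y, j := n - 1 - x])) =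
        (if x = n - 1 - a then if y = n - 1 - b then t (w[i := b, j := a]) else 0 else 0)"
      using ab by simp
    show ?thesis
      unfolding site_skew[OF that(2,1)] s a_def[symmetric]
      unfolding right_diff_distrib T1 T2 T3 T4 by simp
  qed
  have r: "(\<Sum>y<n. t (w[i := n - 1 - y, j := y])) = (\<Sum>x<n. t (w[i := x, j := n - 1 - x]))"
    by (rule sum.reindex_bij_witness[of _ "\<lambda>x. n - 1 - x" "\<lambda>x. n - 1 - x"]) auto
  have d: "(\<Sum>y<n. if y = a then f y else (0::complex)) = f a" "(\<Sum>y<n. if y = b then f y else (0::complex)) = f b"
      "(\<Sum>y<n. if y = n - 1 - a then f y else (0::complex)) = f (n - 1 - a)"
      "(\<Sum>y<n. if y = n - 1 - b then f y else (0::complex)) = f (n - 1 - b)" for f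
    using ab by (auto simp: sum.delta')
  have s0: "(\<Sum>y<n. if c then g y else (0::complex)) = (if c then (\<Sum>y<n. g y) else 0)" for c g by simp
  have "(\<Sum>x<n. \<Sum>y<n. site n (skew n y x) i (site n (skew n x y) j t) w) =
     (\<Sum>x<n. \<Sum>y<n. (if y = a then if x = b then t (w[i := b, j := a]) else 0 else 0)
     - (if y = a then of_bool (a + b = n - 1) * t (w[i := x, j := n - 1 - x]) else 0)
     - (if x = b then of_bool (a + b = n - 1) * t (w[i := n - 1 - y, j := y]) else 0)
     + (if x = n - 1 - a then if y = n - 1 - b then t (w[i := b, j := a]) else 0 else 0))"
    by (intro sum.cong refl eq) auto
  also have "\<dots> = 2 * t (w[i := b, j := a])"
    unfolding sum.distrib sum_subtractf s0 d sum_distrib_left[symmetric] r tr by simp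
  finally show ?thesis by (simp add: sw)
qed

lemma sum_diag_weights:
  fixes a b n :: nat
  assumes "a < n" "b < n"
  shows "(\<Sum>x<n. (of_bool (a = x) - of_bool (a = n - 1 - x)) * (of_bool (b = x) - of_bool (b = n - 1 - x))) =
    (2 * (of_bool (a = b) - of_bool (a + b = n - 1)) :: complex)"
proof -
  have "(\<Sum>x<n. (of_bool (a = x) - of_bool (a = n - 1 - x)) * (of_bool (b = x) - of_bool (b = n - 1 - x))) =
     (\<Sum>x<n. (if x = a then of_bool (a = b) - of_bool (a + b = n - 1) else (0::complex))
        + (if x = n - 1 - a then of_bool (a = b) - of_bool (a + b = n - 1) else 0))"
    using assms by (intro sum.cong refl) auto
  also have "\<dots> = 2 * (of_bool (a = b) - of_bool (a + b = n - 1))"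
    unfolding sum.distrib using assms by (auto simp: sum.delta')
  finally show ?thesis .
qed

text \<open>
  The diagonal entry at \<open>v\<^sub>a\<close> of \<open>\<Sum>\<^sub>x\<^sub><\<^sub>y skew n y x \<cdot> skew n x y\<close>.
\<close>

lemma sum_positive_roots:
  fixes a n :: nat
  assumes a: "a < n"
  shows "(\<Sum>x<n. \<Sum>y<n. if x < y then if x + y = n - 1 then 0 else of_bool (a = y) + of_bool (a = n - 1 - x) else 0) =
    (of_int (2 * (int a - of_bool (n - 1 - a < a))) :: complex)"
proof -
  let ?r = "of_int (int a - of_bool (n - 1 - a < a)) :: complex"
  have c1: "(\<Sum>x<n. if x < a then if x + a = n - 1 then 0 else 1 else 0) = ?r"
  proof -
    have "(\<Sum>x<n. if x < a then if x + a = n - 1 then 0 else 1 else 0) =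
        (\<Sum>x<n. (if x < a then 1 else 0) - (if x = n - 1 - a then of_bool (n - 1 - a < a) else (0::complex)))"
      using a by (intro sum.cong) auto
    also have "\<dots> = ?r"
    proof -
      have "{..<n} \<inter> {x. x < a} = {..<a}" using a by auto
      then show ?thesis using a by (auto simp: sum_subtractf sum.delta' sum.If_cases)
    qed
    finally show ?thesis .
  qed
  have c2: "(\<Sum>y<n. if n - 1 - a < y then if n - 1 - a + y = n - 1 then 0 else 1 else 0) = ?r"
    unfolding c1[symmetric]
    by (rule sum.reindex_bij_witness[of _ "\<lambda>x. n - 1 - x" "\<lambda>x. n - 1 - x"]) (use a in auto)
  have "(\<Sum>x<n. \<Sum>y<n. if x < y then if x + y = n - 1 then 0 else of_bool (a = y) + of_bool (a = n - 1 - x) else 0) =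
    (\<Sum>x<n. \<Sum>y<n. (if y = a then if x < a then if x + a = n - 1 then 0 else 1 else 0 else 0)
      + (if x = n - 1 - a then if n - 1 - a < y then if n - 1 - a + y = n - 1 then 0 else 1 else 0 else (0::complex)))"
    using a by (intro sum.cong refl) auto
  also have "\<dots> = (\<Sum>x<n. if x < a then if x + a = n - 1 then 0 else 1 else 0) +
     (\<Sum>y<n. if n - 1 - a < y then if n - 1 - a + y = n - 1 then 0 else 1 else 0)"
  proof -
    have s0: "(\<Sum>y<n. if c then g y else (0::complex)) = (if c then (\<Sum>y<n. g y) else 0)" for c g by simp
    have d: "(\<Sum>y<n. if y = a then f y else (0::complex)) = f a"
      "(\<Sum>y<n. if y = n - 1 - a then f y else (0::complex)) = f (n - 1 - a)" for f
      using a by (auto simp: sum.delta')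
    show ?thesis unfolding sum.distrib s0 d ..
  qed
  finally show ?thesis unfolding c1 c2 by simp
qed

text \<open>
  The scalar by which the two-position part of the Casimir element acts on a highest weight vector whose support
  contains \<open>w\<close>: the first sum comes from the Cartan subalgebra, the second one from the positive roots.
\<close>

definition casimir_value :: "nat \<Rightarrow> nat list \<Rightarrow> int" where
  "casimir_value n w =
     (\<Sum>i<length w. \<Sum>j<length w. if i = j then 0 else of_bool (w ! i = w ! j) - of_bool (w ! i + w ! j = n - 1))
     - (\<Sum>i<length w. 2 * (int (w ! i) - of_bool (n - 1 - w ! i < w ! i)))"

text \<open>
  Write the sum of transpositions as the two-position part of the Casimir element and move each raising operator
  to the right.  Summed over all positions it is a derivation applied to \<open>t\<close>, and vanishes by assumption; what is
  left are the terms with both factors at one position, which are diagonal.  Only the values of the derivations at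
  words next to \<open>w\<close> enter, so they need to vanish only there.
\<close>

lemma casimir_at_word:
  assumes w: "w \<in> words n d"
    and tr: "\<And>i j. i < d \<Longrightarrow> j < d \<Longrightarrow> i \<noteq> j \<Longrightarrow> (\<Sum>x<n. t (w[i := x, j := n - 1 - x])) = 0"
    and up: "\<And>x y i. x < y \<Longrightarrow> y < n \<Longrightarrow> i < d \<Longrightarrow> w ! i = y \<Longrightarrow> derivation n (skew n x y) t (w[i := x]) = 0"
    and up': "\<And>x y i. x < y \<Longrightarrow> y < n \<Longrightarrow> i < d \<Longrightarrow> w ! i = n - 1 - x \<Longrightarrow>
        derivation n (skew n x y) t (w[i := n - 1 - y]) = 0"
  shows "(\<Sum>i<d. \<Sum>j<d. if i = j then 0 else t (permute_list (Transposition.transpose i j) w)) =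
    of_int (casimir_value n w) * t w"
proof -
  have len: "length w = d" using w by (rule words_length)
  define S where "S i j x y = site n (skew n y x) i (site n (skew n x y) j t) w" for i j x y
  define Q where "Q x y = (\<Sum>i<d. \<Sum>j<d. if i = j then 0 else S i j x y)" for x y
  define pos where "pos x y a = (if x + y = n - 1 then 0 else of_bool (a = y) + of_bool (a = n - 1 - x) :: complex)" for x y a
  \<comment> \<open>A raising operator summed over all positions vanishes, so only its diagonal part survives.\<close>
  have Qup: "Q x y = - (\<Sum>i<d. pos x y (w ! i)) * t w" if "x < y" "y < n" for x y
  proof -
    have "(\<Sum>j<d. S i j x y) = 0" if "i < d" for i
    proof -
      have "(\<Sum>j<d. S i j x y) = site n (skew n y x) i (derivation n (skew n x y) t) w"
        unfolding S_def derivation_def site_def using len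
        by (simp add: sum_distrib_left, subst sum.swap, simp)
      also have "\<dots> = 0"
        using that \<open>x < y\<close> \<open>y < n\<close> up[of x y i] up'[of x y i] by (auto simp: site_skew)
      finally show ?thesis .
    qed
    moreover have "(\<Sum>j<d. if i = j then 0 else S i j x y) = (\<Sum>j<d. S i j x y) - S i i x y" if "i < d" for i
    proof -
      have "(\<Sum>j<d. if i = j then 0 else S i j x y) = (\<Sum>j<d. S i j x y - (if i = j then S i j x y else 0))"
        by (intro sum.cong) auto
      also have "\<dots> = (\<Sum>j<d. S i j x y) - S i i x y"
        using that unfolding sum_subtractf by (simp add: sum.delta)
      finally show ?thesis .
    qed
    ultimately have "Q x y = (\<Sum>i<d. - S i i x y)"
      unfolding Q_def by (intro sum.cong) auto
    also have "\<dots> = (\<Sum>i<d. - (pos x y (w ! i) * t w))"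
      using that len by (intro sum.cong) (auto simp: S_def skew_skew_same pos_def)
    finally show ?thesis by (simp add: sum_negf sum_distrib_right)
  qed
  \<comment> \<open>Operators at different positions commute.\<close>
  have Qsym: "Q y x = Q x y" for x y
  proof -
    have "Q y x = (\<Sum>i<d. \<Sum>j<d. if i = j then 0 else S j i x y)"
      unfolding Q_def S_def by (intro sum.cong refl) (simp add: site_commute)
    also have "\<dots> = Q x y" unfolding Q_def by (subst sum.swap) (simp add: eq_commute)
    finally show ?thesis .
  qed
  define ep where "ep x a = (of_bool (a = x) - of_bool (a = n - 1 - x) :: complex)" for x a
  \<comment> \<open>The Cartan part acts by the weights of the letters.\<close>
  have Qd: "Q x x = (\<Sum>i<d. \<Sum>j<d. if i = j then 0 else ep x (w ! i) * ep x (w ! j)) * t w" if "x < n" for x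
    unfolding Q_def S_def sum_distrib_right ep_def using that len
    by (intro sum.cong refl) (simp add: skew_diag)
  have swap3: "(\<Sum>x<n. \<Sum>i<d. \<Sum>j<d. f x i j) = (\<Sum>i<d. \<Sum>j<d. \<Sum>x<n. f x i j)" for f :: "nat \<Rightarrow> nat \<Rightarrow> nat \<Rightarrow> complex"
    by (subst sum.swap) (intro sum.cong refl sum.swap)
  have "2 * (\<Sum>i<d. \<Sum>j<d. if i = j then 0 else t (permute_list (Transposition.transpose i j) w)) =
      (\<Sum>i<d. \<Sum>j<d. if i = j then 0 else \<Sum>x<n. \<Sum>y<n. S i j x y)"
    unfolding sum_distrib_left S_def by (intro sum.cong refl) (auto simp: sum_skew_pair[OF w _ _ _ tr])
  also have "\<dots> = (\<Sum>i<d. \<Sum>j<d. \<Sum>x<n. \<Sum>y<n. if i = j then 0 else S i j x y)"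
    by (intro sum.cong refl) auto
  also have "\<dots> = (\<Sum>x<n. \<Sum>y<n. Q x y)"
    unfolding swap3[symmetric] Q_def ..
  also have "\<dots> = (\<Sum>x<n. \<Sum>y<n. (if x < y then Q x y else 0) + (if y < x then Q x y else 0) + (if x = y then Q x y else 0))"
    by (intro sum.cong refl) auto
  also have "\<dots> = 2 * (\<Sum>x<n. \<Sum>y<n. if x < y then Q x y else 0) + (\<Sum>x<n. Q x x)"
  proof -
    have "(\<Sum>x<n. \<Sum>y<n. if y < x then Q x y else 0) = (\<Sum>x<n. \<Sum>y<n. if x < y then Q x y else 0)"
    proof -
      have "(\<Sum>x<n. \<Sum>y<n. if y < x then Q x y else 0) = (\<Sum>x<n. \<Sum>y<n. if y < x then Q y x else 0)"
        by (intro sum.cong refl) (simp add: Qsym)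
      also have "\<dots> = (\<Sum>x<n. \<Sum>y<n. if x < y then Q x y else 0)"
        by (rule sum.swap)
      finally show ?thesis .
    qed
    then show ?thesis by (simp add: sum.distrib)
  qed
  also have "(\<Sum>x<n. \<Sum>y<n. if x < y then Q x y else 0) =
     (\<Sum>x<n. \<Sum>y<n. if x < y then - (\<Sum>i<d. pos x y (w ! i)) * t w else 0)"
    by (intro sum.cong refl) (auto simp: Qup)
  also have "\<dots> = - (\<Sum>x<n. \<Sum>y<n. \<Sum>i<d. if x < y then pos x y (w ! i) else 0) * t w"
    unfolding sum_distrib_right sum_negf[symmetric] by (intro sum.cong refl) (auto simp: sum_distrib_right sum_negf)
  also have "(\<Sum>x<n. \<Sum>y<n. \<Sum>i<d. if x < y then pos x y (w ! i) else 0) =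
      (\<Sum>i<d. \<Sum>x<n. \<Sum>y<n. if x < y then pos x y (w ! i) else 0)"
  proof -
    have "(\<Sum>x<n. \<Sum>y<n. \<Sum>i<d. if x < y then pos x y (w ! i) else 0) =
      (\<Sum>x<n. \<Sum>i<d. \<Sum>y<n. if x < y then pos x y (w ! i) else 0)"
      by (rule sum.cong[OF refl]) (rule sum.swap)
    also have "\<dots> = (\<Sum>i<d. \<Sum>x<n. \<Sum>y<n. if x < y then pos x y (w ! i) else 0)"
      by (rule sum.swap)
    finally show ?thesis .
  qed
  also have "\<dots> = (\<Sum>i<d. of_int (2 * (int (w ! i) - of_bool (n - 1 - w ! i < w ! i))))"
    unfolding pos_def by (intro sum.cong refl sum_positive_roots) (use w in \<open>auto simp: words_nth\<close>)
  also have "(\<Sum>x<n. Q x x) = (\<Sum>x<n. \<Sum>i<d. \<Sum>j<d. if i = j then 0 else ep x (w ! i) * ep x (w ! j)) * t w"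
    unfolding sum_distrib_right by (intro sum.cong refl) (simp add: Qd sum_distrib_right)
  also have "(\<Sum>x<n. \<Sum>i<d. \<Sum>j<d. if i = j then 0 else ep x (w ! i) * ep x (w ! j)) =
      (\<Sum>i<d. \<Sum>j<d. if i = j then 0 else \<Sum>x<n. ep x (w ! i) * ep x (w ! j))"
    unfolding swap3 by (intro sum.cong refl) auto
  also have "\<dots> = (\<Sum>i<d. \<Sum>j<d. if i = j then 0 else 2 * (of_bool (w ! i = w ! j) - of_bool (w ! i + w ! j = n - 1)))"
    unfolding ep_def by (intro sum.cong refl) (simp only: sum_diag_weights words_nth[OF w] lessThan_iff)
  also have "\<dots> = 2 * (\<Sum>i<d. \<Sum>j<d. if i = j then 0 else of_bool (w ! i = w ! j) - of_bool (w ! i + w ! j = n - 1))"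
    unfolding sum_distrib_left by (intro sum.cong refl) auto
  finally have fin: "2 * (\<Sum>i<d. \<Sum>j<d. if i = j then 0 else t (permute_list (Transposition.transpose i j) w)) =
      2 * (- (\<Sum>i<d. of_int (2 * (int (w ! i) - of_bool (n - 1 - w ! i < w ! i)))) * t w) +
      2 * (\<Sum>i<d. \<Sum>j<d. if i = j then 0 else of_bool (w ! i = w ! j) - of_bool (w ! i + w ! j = n - 1)) * t w" .
  have cv: "of_int (casimir_value n w) =
      (\<Sum>i<d. \<Sum>j<d. if i = j then 0 else of_bool (w ! i = w ! j) - of_bool (w ! i + w ! j = n - 1))
      - (\<Sum>i<d. of_int (2 * (int (w ! i) - of_bool (n - 1 - w ! i < w ! i))) :: complex)"
    unfolding casimir_value_def len by (simp add: of_int_sum if_distrib[of of_int] cong: if_cong)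
  show ?thesis using fin unfolding cv by algebra
qed

section \<open>The letters of one column\<close>

definition triangular :: "nat \<Rightarrow> nat" where
  "triangular k = (\<Sum>i<k. i)"

lemma sum_distinct_ge:
  fixes S :: "nat set"
  assumes "finite S"
  shows "triangular (card S) \<le> \<Sum> S"
  unfolding triangular_def
  using assms
proof (induction "card S" arbitrary: S)
  case 0
  then show ?case by simp
next
  case (Suc k)
  then have ne: "S \<noteq> {}" by auto
  let ?m = "Max S"
  have m: "?m \<in> S" using Suc ne by auto
  have "card (S - {?m}) = k" using Suc m by simp
  then have IH: "(\<Sum>i<k. i) \<le> \<Sum> (S - {?m})" using Suc by (metis finite_Diff)
  have "S \<subseteq> {..?m}" using Suc by auto
  then have "card S \<le> Suc ?m" using card_mono[of "{..?m}" S] by simp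
  then have "k \<le> ?m" using Suc by simp
  moreover have "\<Sum> S = ?m + \<Sum> (S - {?m})" using m Suc by (simp add: sum.remove)
  ultimately show ?case using IH Suc(2)[symmetric] by simp
qed

lemma triangular_int: "2 * int (triangular k) = int k * (int k - 1)"
  unfolding triangular_def by (induction k) (auto simp: algebra_simps)

text \<open>
  Replace every letter \<open>z > n - 1 - z\<close> of \<open>S\<close> whose opposite \<open>n - 1 - z\<close> is missing by that opposite.  This keeps
  the letters distinct, and the sum of \<open>card S\<close> distinct natural numbers is at least the triangular number.
  Equality forces the replaced set to be \<open>{0, \<dots>, card S - 1}\<close>; a replaced letter drops by one at most, so for
  \<open>n \<ge> 3\<close> the letter \<open>0\<close> was there from the start.
\<close>

lemma column_letters:
  assumes S: "S \<subseteq> {..<n}" and n: "n \<ge> 3" and k: "1 \<le> card S" "card S < n"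
  defines "X \<equiv> (\<Sum>z\<in>S. 2 * (int z - of_bool (n - 1 - z < z))) + (\<Sum>z\<in>S. \<Sum>y\<in>S. of_bool (z \<noteq> y \<and> z + y = n - 1))"
  shows "int (card S) * (int (card S) - 1) \<le> X"
    and "X = int (card S) * (int (card S) - 1) \<Longrightarrow> 0 \<in> S \<and> n - 1 \<notin> S"
proof -
  have fin: "finite S" using S finite_subset by blast
  \<comment> \<open>The replacement of letters by their missing opposites.\<close>
  define q where "q z = (if n - 1 - z < z \<and> n - 1 - z \<notin> S then n - 1 - z else z)" for z
  define e where "e z = (of_bool (n - 1 - z < z \<and> n - 1 - z \<notin> S) :: int)" for z
  have cnt: "(\<Sum>z\<in>S. \<Sum>y\<in>S. of_bool (z \<noteq> y \<and> z + y = n - 1)) =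
      (\<Sum>z\<in>S. 2 * of_bool (n - 1 - z < z \<and> n - 1 - z \<in> S) :: int)"
  proof -
    have "(\<Sum>z\<in>S. \<Sum>y\<in>S. of_bool (z \<noteq> y \<and> z + y = n - 1)) =
        (\<Sum>z\<in>S. \<Sum>y\<in>S. of_bool (y < z \<and> z + y = n - 1) :: int) + (\<Sum>z\<in>S. \<Sum>y\<in>S. of_bool (z < y \<and> z + y = n - 1))"
      unfolding sum.distrib[symmetric] by (intro sum.cong refl) auto
    also have "(\<Sum>z\<in>S. \<Sum>y\<in>S. of_bool (z < y \<and> z + y = n - 1)) = (\<Sum>z\<in>S. \<Sum>y\<in>S. of_bool (y < z \<and> z + y = n - 1) :: int)"
      by (subst sum.swap) (simp add: add.commute)
    also have "(\<Sum>z\<in>S. \<Sum>y\<in>S. of_bool (y < z \<and> z + y = n - 1)) = (\<Sum>z\<in>S. of_bool (n - 1 - z < z \<and> n - 1 - z \<in> S) :: int)"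
    proof (intro sum.cong refl)
      fix z assume z: "z \<in> S"
      have "(\<Sum>y\<in>S. of_bool (y < z \<and> z + y = n - 1)) = (\<Sum>y\<in>S. if y = n - 1 - z then of_bool (n - 1 - z < z) else (0::int))"
        using z S by (intro sum.cong) auto
      also have "\<dots> = of_bool (n - 1 - z < z \<and> n - 1 - z \<in> S)"
        using fin by (simp add: sum.delta)
      finally show "(\<Sum>y\<in>S. of_bool (y < z \<and> z + y = n - 1)) = (of_bool (n - 1 - z < z \<and> n - 1 - z \<in> S) :: int)" .
    qed
    finally show ?thesis by (simp add: sum_distrib_left)
  qed
  have X: "X = 2 * (\<Sum>z\<in>S. int z - e z)"
    unfolding X_def cnt sum_distrib_left sum.distrib[symmetric] e_def
    by (intro sum.cong refl) auto
  have inj: "inj_on q S"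
  proof (rule inj_onI)
    fix x y assume "x \<in> S" "y \<in> S" "q x = q y"
    moreover from this have "x < n" "y < n" using S by auto
    ultimately show "x = y" by (auto simp: q_def split: if_splits)
  qed
  then have cq: "card (q ` S) = card S" by (simp add: card_image)
  have le: "int (q z) \<le> int z - e z" if "z \<in> S" for z
    by (auto simp: q_def e_def)
  have sq: "(\<Sum>z\<in>S. int (q z)) = int (\<Sum> (q ` S))"
    using inj by (simp add: sum.reindex)
  have qle: "(\<Sum>z\<in>S. int (q z)) \<le> (\<Sum>z\<in>S. int z - e z)"
    by (rule sum_mono) (rule le)
  have base: "int (card S) * (int (card S) - 1) \<le> 2 * int (\<Sum> (q ` S))"
  proof -
    have "triangular (card S) \<le> \<Sum> (q ` S)"
      using sum_distinct_ge[of "q ` S"] fin cq by simp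
    then have "int (triangular (card S)) \<le> int (\<Sum> (q ` S))" by (simp only: of_nat_le_iff)
    then show ?thesis using triangular_int[of "card S"] by linarith
  qed
  show "int (card S) * (int (card S) - 1) \<le> X"
    using base qle sq X by linarith
  assume eq: "X = int (card S) * (int (card S) - 1)"
  then have eq1: "(\<Sum>z\<in>S. int (q z)) = (\<Sum>z\<in>S. int z - e z)"
    and eq2: "2 * int (\<Sum> (q ` S)) = int (card S) * (int (card S) - 1)"
    using base qle sq X by linarith+
  have pt: "int (q z) = int z - e z" if "z \<in> S" for z
  proof (rule ccontr)
    assume "int (q z) \<noteq> int z - e z"
    then have "int (q z) < int z - e z" using le[OF that] by simp
    then have "(\<Sum>z\<in>S. int (q z)) < (\<Sum>z\<in>S. int z - e z)"
      using that fin le by (intro sum_strict_mono_ex1) auto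
    then show False using eq1 by simp
  qed
  have "0 \<in> q ` S"
  proof (rule ccontr)
    assume no: "0 \<notin> q ` S"
    let ?T = "(\<lambda>x. x - 1) ` (q ` S)"
    have i: "inj_on (\<lambda>x. x - 1) (q ` S)"
    proof (rule inj_onI)
      fix x y :: nat assume "x \<in> q ` S" "y \<in> q ` S" "x - 1 = y - 1"
      moreover from this no have "x \<noteq> 0" "y \<noteq> 0" by metis+
      ultimately show "x = y" by simp
    qed
    have "triangular (card ?T) \<le> \<Sum> ?T" by (rule sum_distinct_ge) (use fin in auto)
    moreover have "\<Sum> ?T + card S = \<Sum> (q ` S)"
    proof -
      have "\<Sum> ?T = (\<Sum>x\<in>q ` S. x - 1)" using i by (simp add: sum.reindex)
      moreover have "(\<Sum>x\<in>q ` S. x - 1) + (\<Sum>x\<in>q ` S. 1) = (\<Sum>x\<in>q ` S. x)"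
        unfolding sum.distrib[symmetric]
      proof (intro sum.cong refl)
        fix x assume "x \<in> q ` S"
        then have "x \<noteq> 0" using no by metis
        then show "x - 1 + 1 = x" by simp
      qed
      ultimately show ?thesis using cq by simp
    qed
    moreover have "card ?T = card S" using i cq by (simp add: card_image)
    ultimately have "triangular (card S) + card S \<le> \<Sum> (q ` S)" by simp
    moreover have "triangular (card S) = \<Sum> (q ` S)"
      using eq2 triangular_int[of "card S"] by linarith
    ultimately show False using k by linarith
  qed
  then obtain z where z: "z \<in> S" "q z = 0" by auto
  have "z = 0"
  proof (rule ccontr)
    assume "z \<noteq> 0"
    with z have "n - 1 - z < z" "n - 1 - z \<notin> S" "n - 1 - z = 0" by (auto simp: q_def split: if_splits)
    then have "e z = 1" "z \<ge> n - 1" by (auto simp: e_def)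
    then show False using pt[OF z(1)] z(2) n by simp
  qed
  with z have 0: "0 \<in> S" by simp
  have "n - 1 \<notin> S"
  proof
    assume mem: "n - 1 \<in> S"
    have "q (n - 1) = n - 1" using 0 by (simp add: q_def)
    then have m: "n - 1 \<in> q ` S" using mem by (metis imageI)
    have "card (q ` S - {n - 1}) = card S - 1" using m cq fin by simp
    then have "triangular (card S - 1) \<le> \<Sum> (q ` S - {n - 1})"
      using sum_distinct_ge[of "q ` S - {n - 1}"] fin by simp
    moreover have "\<Sum> (q ` S) = (n - 1) + \<Sum> (q ` S - {n - 1})"
      using m fin by (simp add: sum.remove)
    moreover have "triangular (card S) = triangular (card S - 1) + (card S - 1)"
      using k by (cases "card S") (auto simp: triangular_def)
    moreover have "\<Sum> (q ` S) = triangular (card S)"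
      using eq2 triangular_int[of "card S"] by linarith
    ultimately show False using k by linarith
  qed
  with 0 show "0 \<in> S \<and> n - 1 \<notin> S" by simp
qed

section \<open>Young symmetrizers of a tableau\<close>

lemma transpose_conj:
  assumes "inj \<sigma>"
  shows "Transposition.transpose (\<sigma> p) (\<sigma> q) \<circ> \<sigma> = \<sigma> \<circ> Transposition.transpose p q"
  using assms by (auto simp: fun_eq_iff Transposition.transpose_def dest: injD)

lemma transpose_permutes: "p < d \<Longrightarrow> q < d \<Longrightarrow> Transposition.transpose p q permutes {..<d}"
  by (rule permutes_swap_id) auto

text \<open>
  The weight of \<open>v\<^sub>x\<close> for the torus that scales \<open>v\<^sub>0\<close> and \<open>v\<^sub>n\<^sub>-\<^sub>1\<close> inversely and fixes the other basis vectors.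
\<close>

definition letter_weight :: "nat \<Rightarrow> nat \<Rightarrow> int" where
  "letter_weight n x = of_bool (x = 0) - of_bool (x = n - 1)"

definition weight :: "nat \<Rightarrow> nat list \<Rightarrow> int" where
  "weight n w = (\<Sum>p<length w. letter_weight n (w ! p))"

text \<open>
  Ordered pairs are summed, so every transposition counts twice.
\<close>

definition swap_sum :: "nat \<Rightarrow> (nat list \<Rightarrow> complex) \<Rightarrow> nat list \<Rightarrow> complex" where
  "swap_sum d c = (\<lambda>w. \<Sum>p<d. \<Sum>q<d. if p = q then 0 else c (permute_list (Transposition.transpose p q) w))"

lemma sum_bool_eq_inj:
  assumes "finite B" "inj_on g B"
  shows "(\<Sum>q\<in>B. of_bool (a = g q)) = (of_bool (a \<in> g ` B) :: int)"
proof (cases "a \<in> g ` B")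
  case True
  then obtain b where b: "b \<in> B" "a = g b" by auto
  then have "(\<Sum>q\<in>B. of_bool (a = g q)) = (\<Sum>q\<in>B. if q = b then 1 else (0::int))"
    using assms(2) by (intro sum.cong) (auto dest: inj_onD)
  with b assms(1) True show ?thesis by simp
next
  case False
  then show ?thesis by (auto intro!: sum.neutral)
qed

text \<open>
  A tableau is given by the row and the column of each position.  The locale keeps only the shape: columns
  \<open>0, \<dots>, lam1 - 1\<close> of weakly decreasing positive heights \<open>h\<close>.  The bounds on the first two heights are the
  condition \<open>\<^sup>t\<lambda>\<^sub>1 + \<^sup>t\<lambda>\<^sub>2 \<le> n\<close> without the determinant.
\<close>

locale tableau =
  fixes d lam1 n :: nat and row col h :: "nat \<Rightarrow> nat"
  assumes cells: "bij_betw (\<lambda>p. (row p, col p)) {..<d} {(i, j). j < lam1 \<and> i < h j}"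
    and h_anti: "i \<le> j \<Longrightarrow> h j \<le> h i"
    and h_pos: "j < lam1 \<Longrightarrow> 1 \<le> h j"
    and h_less: "h 0 < n"
    and h_two: "h 0 + h 1 \<le> n"
    and n3: "n \<ge> 3"
begin

definition rows where "rows = {\<sigma>. \<sigma> permutes {..<d} \<and> (\<forall>p<d. row (\<sigma> p) = row p)}"
definition cols where "cols = {\<sigma>. \<sigma> permutes {..<d} \<and> (\<forall>p<d. col (\<sigma> p) = col p)}"

definition rsym :: "(nat list \<Rightarrow> complex) \<Rightarrow> nat list \<Rightarrow> complex" where
  "rsym c = (\<lambda>w. \<Sum>\<sigma>\<in>rows. c (permute_list \<sigma> w))"
definition csym :: "(nat list \<Rightarrow> complex) \<Rightarrow> nat list \<Rightarrow> complex" where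
  "csym c = (\<lambda>w. \<Sum>\<sigma>\<in>cols. of_int (sign \<sigma>) * c (permute_list \<sigma> w))"

text \<open>
  Twice the sum of the contents of the cells.
\<close>

definition content :: int where
  "content = (\<Sum>p<d. \<Sum>q<d. if p = q then 0 else of_bool (row p = row q) - of_bool (col p = col q))"

lemma rc_inj: "p < d \<Longrightarrow> q < d \<Longrightarrow> row p = row q \<Longrightarrow> col p = col q \<Longrightarrow> p = q"
  using cells by (auto simp: bij_betw_def inj_on_def)

lemma rc_range: "p < d \<Longrightarrow> col p < lam1 \<and> row p < h (col p)"
  using bij_betwE[OF cells] by auto

lemma rc_ex: "j < lam1 \<Longrightarrow> i < h j \<Longrightarrow> \<exists>p<d. row p = i \<and> col p = j"
proof -
  assume "j < lam1" "i < h j"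
  then have "(i, j) \<in> (\<lambda>p. (row p, col p)) ` {..<d}" using cells by (simp add: bij_betw_def)
  then show ?thesis by auto
qed

lemma finite_rows: "finite rows"
  unfolding rows_def using finite_permutations[of "{..<d}"] by (rule rev_finite_subset) auto

lemma finite_cols: "finite cols"
  unfolding cols_def using finite_permutations[of "{..<d}"] by (rule rev_finite_subset) auto

lemma rows_permutes: "\<sigma> \<in> rows \<Longrightarrow> \<sigma> permutes {..<d}" by (simp add: rows_def)
lemma cols_permutes: "\<sigma> \<in> cols \<Longrightarrow> \<sigma> permutes {..<d}" by (simp add: cols_def)

lemma rows_comp: "\<sigma> \<in> rows \<Longrightarrow> \<tau> \<in> rows \<Longrightarrow> \<sigma> \<circ> \<tau> \<in> rows"
  using permutes_in_image[of \<tau> "{..<d}"] by (auto simp: rows_def permutes_compose)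
lemma cols_comp: "\<sigma> \<in> cols \<Longrightarrow> \<tau> \<in> cols \<Longrightarrow> \<sigma> \<circ> \<tau> \<in> cols"
  using permutes_in_image[of \<tau> "{..<d}"] by (auto simp: cols_def permutes_compose)

lemma transpose_rows: "p < d \<Longrightarrow> q < d \<Longrightarrow> row p = row q \<Longrightarrow> Transposition.transpose p q \<in> rows"
  by (auto simp: rows_def transpose_permutes) (simp add: Transposition.transpose_def)
lemma transpose_cols: "p < d \<Longrightarrow> q < d \<Longrightarrow> col p = col q \<Longrightarrow> Transposition.transpose p q \<in> cols"
  by (auto simp: cols_def transpose_permutes) (simp add: Transposition.transpose_def)

lemma rsym_swap:
  assumes "p < d" "q < d" "row p = row q" "length w = d"
  shows "rsym c (permute_list (Transposition.transpose p q) w) = rsym c w"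
proof -
  let ?t = "Transposition.transpose p q"
  have t: "?t \<in> rows" using assms by (simp add: transpose_rows)
  have "rsym c (permute_list ?t w) = (\<Sum>\<sigma>\<in>rows. c (permute_list (?t \<circ> \<sigma>) w))"
    unfolding rsym_def using assms(4) by (intro sum.cong refl) (simp add: permute_list_compose rows_permutes)
  also have "\<dots> = rsym c w"
    unfolding rsym_def
    by (rule sum.reindex_bij_witness[of _ "\<lambda>\<sigma>. ?t \<circ> \<sigma>" "\<lambda>\<sigma>. ?t \<circ> \<sigma>"])
      (use t in \<open>auto simp: rows_comp fun_eq_iff\<close>)
  finally show ?thesis .
qed

lemma sign_swap_comp:
  assumes "\<sigma> \<in> cols" "p < d" "q < d" "p \<noteq> q"
  shows "sign (Transposition.transpose p q \<circ> \<sigma>) = - sign \<sigma>" "sign (\<sigma> \<circ> Transposition.transpose p q) = - sign \<sigma>"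
proof -
  have "permutation \<sigma>" "permutation (Transposition.transpose p q)"
    using assms cols_permutes transpose_permutes by (blast intro: permutation_permutes[THEN iffD2] finite_lessThan)+
  then show "sign (Transposition.transpose p q \<circ> \<sigma>) = - sign \<sigma>" "sign (\<sigma> \<circ> Transposition.transpose p q) = - sign \<sigma>"
    using assms(4) by (simp_all add: sign_compose sign_swap_id)
qed

lemma csym_swap:
  assumes "p < d" "q < d" "p \<noteq> q" "col p = col q" "length w = d"
  shows "csym c (permute_list (Transposition.transpose p q) w) = - csym c w"
proof -
  let ?t = "Transposition.transpose p q"
  have t: "?t \<in> cols" using assms by (simp add: transpose_cols)
  have "csym c (permute_list ?t w) = (\<Sum>\<sigma>\<in>cols. of_int (sign \<sigma>) * c (permute_list (?t \<circ> \<sigma>) w))"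
    unfolding csym_def using assms(5) by (intro sum.cong refl) (simp add: permute_list_compose cols_permutes)
  also have "\<dots> = (\<Sum>\<sigma>\<in>cols. of_int (- sign \<sigma>) * c (permute_list \<sigma> w))"
    by (rule sum.reindex_bij_witness[of _ "\<lambda>\<sigma>. ?t \<circ> \<sigma>" "\<lambda>\<sigma>. ?t \<circ> \<sigma>"])
      (use t assms in \<open>auto simp: cols_comp fun_eq_iff sign_swap_comp\<close>)
  finally show ?thesis by (simp add: csym_def sum_negf)
qed

lemma csym_act_swap:
  assumes "p < d" "q < d" "p \<noteq> q" "col p = col q" "length w = d"
  shows "csym (act (Transposition.transpose p q) c) w = - csym c w"
proof -
  let ?t = "Transposition.transpose p q"
  have t: "?t \<in> cols" using assms by (simp add: transpose_cols)
  have "csym (act ?t c) w = (\<Sum>\<sigma>\<in>cols. of_int (sign \<sigma>) * c (permute_list (\<sigma> \<circ> ?t) w))"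
    unfolding csym_def act_def using assms
    by (intro sum.cong refl) (simp add: permute_list_compose transpose_permutes)
  also have "\<dots> = (\<Sum>\<sigma>\<in>cols. of_int (- sign \<sigma>) * c (permute_list \<sigma> w))"
    by (rule sum.reindex_bij_witness[of _ "\<lambda>\<sigma>. \<sigma> \<circ> ?t" "\<lambda>\<sigma>. \<sigma> \<circ> ?t"])
      (use t assms in \<open>auto simp: cols_comp fun_eq_iff sign_swap_comp\<close>)
  finally show ?thesis by (simp add: csym_def sum_negf)
qed

lemma csym_cong:
  assumes "\<And>u. length u = d \<Longrightarrow> c u = c' u" "length w = d"
  shows "csym c w = csym c' w"
  unfolding csym_def using assms by (intro sum.cong refl) simp

lemma swap_sum_csym:
  assumes w: "length w = d"
  shows "swap_sum d (csym c) w = csym (swap_sum d c) w"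
proof -
  let ?t = Transposition.transpose
  have "swap_sum d (csym c) w = (\<Sum>p<d. \<Sum>q<d. \<Sum>\<sigma>\<in>cols. if p = q then 0 else of_int (sign \<sigma>) * c (permute_list (?t p q \<circ> \<sigma>) w))"
    unfolding swap_sum_def csym_def using w
    by (intro sum.cong refl) (simp add: permute_list_compose cols_permutes)
  also have "\<dots> = (\<Sum>\<sigma>\<in>cols. \<Sum>p<d. \<Sum>q<d. if p = q then 0 else of_int (sign \<sigma>) * c (permute_list (?t p q \<circ> \<sigma>) w))"
    by (subst (2) sum.swap, subst sum.swap, rule refl)
  also have "\<dots> = (\<Sum>\<sigma>\<in>cols. \<Sum>p<d. \<Sum>q<d. if p = q then 0 else of_int (sign \<sigma>) * c (permute_list (\<sigma> \<circ> ?t p q) w))"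
  proof (rule sum.cong[OF refl])
    fix \<sigma> assume "\<sigma> \<in> cols"
    then have s: "\<sigma> permutes {..<d}" by (rule cols_permutes)
    define f where "f = (\<lambda>p q. if p = q then 0 else of_int (sign \<sigma>) * c (permute_list (?t p q \<circ> \<sigma>) w))"
    have "(\<Sum>p<d. \<Sum>q<d. f p q) = (\<Sum>p<d. \<Sum>q<d. f p (\<sigma> q))"
      using sum.permute[OF s, of "f p" for p] by (simp add: comp_def)
    also have "\<dots> = (\<Sum>p<d. \<Sum>q<d. f (\<sigma> p) (\<sigma> q))"
      using sum.permute[OF s, of "\<lambda>p. \<Sum>q<d. f p (\<sigma> q)"] by (simp add: comp_def)
    also have "\<dots> = (\<Sum>p<d. \<Sum>q<d. if p = q then 0 else of_int (sign \<sigma>) * c (permute_list (\<sigma> \<circ> ?t p q) w))"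
      unfolding f_def transpose_conj[OF permutes_inj[OF s]]
      using permutes_inj[OF s] by (simp add: inj_eq)
    finally show "(\<Sum>p<d. \<Sum>q<d. if p = q then 0 else of_int (sign \<sigma>) * c (permute_list (?t p q \<circ> \<sigma>) w)) =
       (\<Sum>p<d. \<Sum>q<d. if p = q then 0 else of_int (sign \<sigma>) * c (permute_list (\<sigma> \<circ> ?t p q) w))"
      unfolding f_def .
  qed
  also have "\<dots> = csym (swap_sum d c) w"
    unfolding csym_def swap_sum_def sum_distrib_left using w
    by (intro sum.cong refl) (simp add: permute_list_compose transpose_permutes)
  finally show ?thesis .
qed

text \<open>
  The third corner \<open>x\<close> of the rectangle on \<open>p\<close> and \<open>q\<close> can be moved through the transposition at the price of a
  sign: \<open>(p x)(p q) = (p q)(q x)\<close>, where \<open>(p x)\<close> is absorbed with sign \<open>-1\<close> by the columns and \<open>(q x)\<close> with sign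
  \<open>1\<close> by the rows.
\<close>

lemma csym_rsym_hook:
  assumes x: "x < d" "row x = row q" "col x = col p" and pq: "p < d" "q < d" "x \<noteq> p" "x \<noteq> q" and w: "length w = d"
  shows "csym (act (Transposition.transpose p q) (rsym c)) w = 0"
proof -
  let ?t = Transposition.transpose
  have "csym (act (?t p x) (act (?t p q) (rsym c))) w = csym (act (?t p q) (rsym c)) w"
  proof (rule csym_cong[OF _ w])
    fix u :: "nat list" assume u: "length u = d"
    have e: "?t p x \<circ> ?t p q = ?t p q \<circ> ?t q x"
      using pq by (auto simp: fun_eq_iff Transposition.transpose_def)
    have "act (?t p x) (act (?t p q) (rsym c)) u = act (?t p q \<circ> ?t q x) (rsym c) u"
      using act_compose[of "?t p x" u "?t p q" "rsym c"] e x pq u by (simp add: transpose_permutes)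
    also have "\<dots> = act (?t p q) (act (?t q x) (rsym c)) u"
      using x pq u by (intro act_compose) (auto simp: transpose_permutes)
    also have "\<dots> = act (?t p q) (rsym c) u"
      unfolding act_def using x pq u by (simp add: rsym_swap)
    finally show "act (?t p x) (act (?t p q) (rsym c)) u = act (?t p q) (rsym c) u" .
  qed
  moreover have "csym (act (?t p x) (act (?t p q) (rsym c))) w = - csym (act (?t p q) (rsym c)) w"
    using x pq w by (intro csym_act_swap) auto
  ultimately show ?thesis by simp
qed

text \<open>
  If \<open>p\<close> and \<open>q\<close> share neither row nor column, the other corner of their rectangle in its left column is a cell of
  the diagram.  It is the position \<open>x\<close> needed for \<open>csym_rsym_hook\<close>, possibly with \<open>p\<close> and \<open>q\<close> exchanged.
\<close>

lemma csym_swap_rsym: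
  assumes pq: "p < d" "q < d" "p \<noteq> q" and w: "length w = d"
  shows "csym (act (Transposition.transpose p q) (rsym c)) w =
    of_int (of_bool (row p = row q) - of_bool (col p = col q)) * csym (rsym c) w"
proof (cases "row p = row q \<or> col p = col q")
  case True
  moreover have "\<not> (row p = row q \<and> col p = col q)" using pq rc_inj by blast
  moreover have "csym (act (Transposition.transpose p q) (rsym c)) w = csym (rsym c) w" if "row p = row q"
    using that pq by (intro csym_cong[OF _ w]) (simp add: act_def rsym_swap)
  ultimately show ?thesis using pq w csym_act_swap by auto
next
  case False
  have key: "csym (act (Transposition.transpose p q) (rsym c)) w = 0"
    if pq: "p < d" "q < d" and "row p < row q" "col p \<noteq> col q" for p q
  proof (cases "col p < col q")
    case True
    have "row q < h (col p)" using rc_range[OF \<open>q < d\<close>] h_anti[of "col p" "col q"] True by simp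
    then obtain x where "x < d" "row x = row q" "col x = col p"
      using rc_ex rc_range[OF \<open>p < d\<close>] by blast
    then show ?thesis using that w by (intro csym_rsym_hook[of x]) auto
  next
    case False
    have "row p < h (col q)" using rc_range[OF \<open>q < d\<close>] that by simp
    then obtain x where "x < d" "row x = row p" "col x = col q"
      using rc_ex rc_range[OF \<open>q < d\<close>] by blast
    then have "csym (act (Transposition.transpose q p) (rsym c)) w = 0"
      using that w by (intro csym_rsym_hook[of x]) auto
    then show ?thesis by (simp add: transpose_commute)
  qed
  show ?thesis
    using False key[of p q] key[of q p] pq by (cases "row p < row q") (auto simp: transpose_commute)
qed

text \<open>
  The sum of all transpositions is central, so it can be placed between the two symmetrizers.
\<close>

lemma swap_sum_young:
  assumes w: "length w = d"
  shows "swap_sum d (csym (rsym c)) w = of_int content * csym (rsym c) w"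
proof -
  have "swap_sum d (csym (rsym c)) w = csym (swap_sum d (rsym c)) w"
    by (rule swap_sum_csym[OF w])
  also have "\<dots> = (\<Sum>\<sigma>\<in>cols. \<Sum>p<d. \<Sum>q<d. if p = q then 0 else of_int (sign \<sigma>) * act (Transposition.transpose p q) (rsym c) (permute_list \<sigma> w))"
    unfolding csym_def swap_sum_def act_def sum_distrib_left by (intro sum.cong refl) simp
  also have "\<dots> = (\<Sum>p<d. \<Sum>q<d. \<Sum>\<sigma>\<in>cols. if p = q then 0 else of_int (sign \<sigma>) * act (Transposition.transpose p q) (rsym c) (permute_list \<sigma> w))"
    by (subst sum.swap, subst (2) sum.swap, rule refl)
  also have "\<dots> = (\<Sum>p<d. \<Sum>q<d. if p = q then 0 else csym (act (Transposition.transpose p q) (rsym c)) w)"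
    unfolding csym_def by (intro sum.cong refl) simp
  also have "\<dots> = (\<Sum>p<d. \<Sum>q<d. if p = q then 0 else of_int (of_bool (row p = row q) - of_bool (col p = col q)) * csym (rsym c) w)"
    by (intro sum.cong refl) (simp add: csym_swap_rsym[OF _ _ _ w])
  finally show ?thesis
    unfolding content_def of_int_sum sum_distrib_right
    by (simp add: if_distrib[of of_int] if_distrib[of "\<lambda>x. x * _"] cong: if_cong)
qed

end

section \<open>Derivations and contractions\<close>

lemma weight_update:
  assumes "i < length w"
  shows "weight n (w[i := x]) = weight n w - letter_weight n (w ! i) + letter_weight n x"
proof -
  have "weight n (w[i := x]) = letter_weight n x + (\<Sum>p\<in>{..<length w} - {i}. letter_weight n (w ! p))"
    unfolding weight_def using assms by (simp add: sum.remove[of "{..<length w}" i])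
  moreover have "weight n w = letter_weight n (w ! i) + (\<Sum>p\<in>{..<length w} - {i}. letter_weight n (w ! p))"
    unfolding weight_def using assms by (simp add: sum.remove[of "{..<length w}" i])
  ultimately show ?thesis by simp
qed

lemma derivation_cong:
  assumes "\<And>u. u \<in> words n d \<Longrightarrow> t u = t' u" "w \<in> words n d"
  shows "derivation n A t w = derivation n A t' w"
  unfolding derivation_def site_def using assms by (intro sum.cong refl) (simp add: words_update)

lemma derivation_cong_matrix:
  assumes "\<And>a b. a < n \<Longrightarrow> b < n \<Longrightarrow> A a b = B a b" "w \<in> words n d"
  shows "derivation n A t w = derivation n B t w"
  unfolding derivation_def site_def using assms
  by (intro sum.cong refl) (simp add: words_nth words_length)

lemma derivation_scale: "derivation n A (\<lambda>u. k * t u) w = k * derivation n A t w"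
  by (simp add: derivation_def site_def sum_distrib_left mult.left_commute)

lemma derivation_sum: "derivation n A (\<lambda>u. \<Sum>i\<in>I. t i u) w = (\<Sum>i\<in>I. derivation n A (t i) w)"
proof -
  have "derivation n A (\<lambda>u. \<Sum>i\<in>I. t i u) w = (\<Sum>p<length w. \<Sum>i\<in>I. \<Sum>y<n. A (w ! p) y * t i (w[p := y]))"
    unfolding derivation_def site_def
    by (rule sum.cong[OF refl]) (simp add: sum_distrib_left, rule sum.swap)
  also have "\<dots> = (\<Sum>i\<in>I. derivation n A (t i) w)"
    unfolding derivation_def site_def by (rule sum.swap)
  finally show ?thesis .
qed

lemma derivation_matrix_scale: "derivation n (\<lambda>a b. k * A a b) t w = k * derivation n A t w"
  by (simp add: derivation_def site_def sum_distrib_left mult.assoc)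

lemma derivation_matrix_diff:
  "derivation n (\<lambda>a b. A a b - B a b) t w = derivation n A t w - derivation n B t w"
  by (simp add: derivation_def site_def sum_subtractf left_diff_distrib)

text \<open>
  Elements of \<open>so(V)\<close> preserve the form, so the terms from the two contracted positions cancel.
\<close>

lemma derivation_traceless:
  assumes A: "\<And>a b. a < n \<Longrightarrow> b < n \<Longrightarrow> A a b = - A (n - 1 - b) (n - 1 - a)"
    and tr: "\<And>w. w \<in> words n d \<Longrightarrow> (\<Sum>x<n. t (w[i := x, j := n - 1 - x])) = 0"
    and w: "w \<in> words n d" and ij: "i < d" "j < d" "i \<noteq> j"
  shows "(\<Sum>x<n. derivation n A t (w[i := x, j := n - 1 - x])) = 0"
proof -
  have len: "length w = d" using w by (rule words_length)
  define g where "g k = (\<Sum>z<n. site n A k t (w[i := z, j := n - 1 - z]))" for k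
  have gk: "g k = 0" if k: "k < d" "k \<noteq> i" "k \<noteq> j" for k
  proof -
    have "g k = (\<Sum>z<n. \<Sum>y<n. A (w ! k) y * t (w[k := y, i := z, j := n - 1 - z]))"
    proof -
      have "w[i := z, j := n - 1 - z, k := y] = w[k := y, i := z, j := n - 1 - z]" for z y
        by (rule nth_equalityI) (use k ij len in \<open>auto simp: nth_list_update\<close>)
      then show ?thesis unfolding g_def site_def using k by simp
    qed
    also have "\<dots> = (\<Sum>y<n. A (w ! k) y * (\<Sum>z<n. t (w[k := y, i := z, j := n - 1 - z])))"
      by (subst sum.swap) (simp add: sum_distrib_left)
    also have "\<dots> = 0" using w tr by (intro sum.neutral) (simp add: words_update)
    finally show ?thesis .
  qed
  have gi: "g i = (\<Sum>z<n. \<Sum>y<n. A z y * t (w[i := y, j := n - 1 - z]))"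
  proof -
    have "w[i := z, j := n - 1 - z, i := y] = w[i := y, j := n - 1 - z]" for z y
      by (rule nth_equalityI) (use ij len in \<open>auto simp: nth_list_update\<close>)
    then show ?thesis unfolding g_def site_def using ij len by simp
  qed
  also have "\<dots> = (\<Sum>b<n. \<Sum>y<n. A (n - 1 - b) y * t (w[i := y, j := b]))"
    by (rule sum.reindex_bij_witness[of _ "\<lambda>x. n - 1 - x" "\<lambda>x. n - 1 - x"]) auto
  also have "\<dots> = (\<Sum>y<n. \<Sum>b<n. A (n - 1 - b) y * t (w[i := y, j := b]))" by (rule sum.swap)
  finally have "g i = (\<Sum>y<n. \<Sum>b<n. A (n - 1 - b) y * t (w[i := y, j := b]))" .
  also have "\<dots> = (\<Sum>y<n. \<Sum>b<n. - (A (n - 1 - y) b * t (w[i := y, j := b])))"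
  proof (intro sum.cong refl)
    fix y b assume "y \<in> {..<n}" "b \<in> {..<n}"
    then have "A (n - 1 - b) y = - A (n - 1 - y) b"
      using A[of "n - 1 - b" y] by simp
    then show "A (n - 1 - b) y * t (w[i := y, j := b]) = - (A (n - 1 - y) b * t (w[i := y, j := b]))"
      by (simp only: mult_minus_left)
  qed
  finally have gi': "g i = - (\<Sum>z<n. \<Sum>y<n. A (n - 1 - z) y * t (w[i := z, j := y]))"
    by (simp only: sum_negf)
  have gj: "g j = (\<Sum>z<n. \<Sum>y<n. A (n - 1 - z) y * t (w[i := z, j := y]))"
    unfolding g_def site_def using ij len by (intro sum.cong refl) simp
  have gij: "g i + g j = 0" unfolding gi' gj by simp
  have "(\<Sum>x<n. derivation n A t (w[i := x, j := n - 1 - x])) = (\<Sum>k<d. g k)"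
    unfolding derivation_def g_def using len by (simp add: sum.swap[of _ "{..<d}"])
  also have "\<dots> = (\<Sum>k\<in>{i, j}. g k)"
    using ij gk by (intro sum.mono_neutral_right) auto
  also have "\<dots> = 0" using ij gij by simp
  finally show ?thesis .
qed

lemma skew_antisym:
  assumes "x < n" "y < n"
  shows "skew n (n - 1 - y) (n - 1 - x) a b = - skew n x y a b"
  using assms by (simp add: skew_def)

lemma skew_antisym':
  assumes "x < n" "y < n" "a < n" "b < n"
  shows "skew n x y a b = - skew n x y (n - 1 - b) (n - 1 - a)"
proof -
  have "(a = x \<and> b = y) = (n - 1 - b = n - 1 - y \<and> n - 1 - a = n - 1 - x)"
    "(a = n - 1 - y \<and> b = n - 1 - x) = (n - 1 - b = x \<and> n - 1 - a = y)"
    using assms by auto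
  then show ?thesis unfolding skew_def by simp
qed

lemma sum_skew_mult:
  assumes "u < n" "v < n"
  shows "(\<Sum>x<n. skew n u v a x * B x) = of_bool (a = u) * B v - of_bool (a = n - 1 - v) * B (n - 1 - u)"
proof -
  have "(\<Sum>x<n. skew n u v a x * B x) = (\<Sum>x<n. (if x = v then of_bool (a = u) * B x else 0)
      - (if x = n - 1 - u then of_bool (a = n - 1 - v) * B x else 0))"
    by (intro sum.cong refl) (auto simp: skew_def)
  then show ?thesis using assms by (simp add: sum_subtractf)
qed

lemma skew_commutator:
  assumes n: "n \<ge> 3" and y: "1 \<le> y" "y < n - 1" and u: "1 \<le> u" "u < n - 1" and v: "1 \<le> v" "v < n - 1"
    and ab: "a < n" "b < n"
  shows "(\<Sum>x<n. skew n 0 y a x * skew n u v x b) - (\<Sum>x<n. skew n u v a x * skew n 0 y x b) =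
    of_bool (y = u) * skew n 0 v a b - of_bool (y = n - 1 - v) * skew n 0 (n - 1 - u) a b"
proof -
  have lt: "0 < n" "y < n" "u < n" "v < n" using assms by auto
  have e: "(v = 0) = False" "(n - 1 = u) = False" "(n - 1 = n - 1 - v) = False" "(n - 1 - u = 0) = False"
    "n - 1 - (n - 1 - u) = u" "(n - 1 - u = n - 1 - y) = (y = u)" "(v = n - 1 - y) = (y = n - 1 - v)" "n - 1 - 0 = n - 1"
    using assms by auto
  show ?thesis
    unfolding sum_skew_mult[OF lt(1,2)] sum_skew_mult[OF lt(3,4)]
    unfolding skew_def e of_bool_conj by (simp only: of_bool_eq simp_thms mult_zero_left mult_zero_right) algebra
qed

context tableau
begin

abbreviation column :: "nat \<Rightarrow> nat set" where "column c \<equiv> {p. p < d \<and> col p = c}"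

section \<open>Weights of column-antisymmetric tensors\<close>

lemma sum_columns: "(\<Sum>p<d. f p) = (\<Sum>c<lam1. \<Sum>p\<in>column c. f p)"
proof -
  have "(\<Sum>c<lam1. \<Sum>p\<in>{x \<in> {..<d}. col x = c}. f p) = (\<Sum>p<d. f p)"
    by (rule sum.group) (auto simp: rc_range)
  then show ?thesis by simp
qed

lemma row_column: "c < lam1 \<Longrightarrow> row ` column c = {..<h c}"
proof -
  assume c: "c < lam1"
  have "r \<in> row ` column c" if "r < h c" for r
    using rc_ex[OF c that] by auto
  then show ?thesis using rc_range by auto
qed

lemma inj_row: "inj_on row (column c)"
  using rc_inj by (auto intro: inj_onI)

lemma card_column: "c < lam1 \<Longrightarrow> card (column c) = h c"
  using card_image[OF inj_row[of c]] by (simp add: row_column)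

lemma column_weight:
  assumes "inj_on ((!) w) (column c)"
  shows "(\<Sum>p\<in>column c. letter_weight n (w ! p)) = of_bool (0 \<in> (!) w ` column c) - of_bool (n - 1 \<in> (!) w ` column c)"
proof -
  have "(\<Sum>p\<in>column c. of_bool (k = w ! p)) = (of_bool (k \<in> (!) w ` column c) :: int)" for k
    using sum_bool_eq_inj[OF _ assms, of k] by simp
  moreover have "letter_weight n x = of_bool (0 = x) - of_bool (n - 1 = x)" for x
    by (auto simp: letter_weight_def)
  ultimately show ?thesis by (simp only: sum_subtractf)
qed

definition column_distinct :: "nat list \<Rightarrow> bool" where
  "column_distinct w \<longleftrightarrow> (\<forall>c. inj_on ((!) w) (column c))"

lemma weight_bounds:
  assumes "column_distinct w" "length w = d"
  shows "- int lam1 \<le> weight n w" "weight n w \<le> int lam1"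
proof -
  have "weight n w = (\<Sum>c<lam1. \<Sum>p\<in>column c. letter_weight n (w ! p))"
    unfolding weight_def assms(2) by (rule sum_columns)
  also have "\<dots> = (\<Sum>c<lam1. of_bool (0 \<in> (!) w ` column c) - of_bool (n - 1 \<in> (!) w ` column c))"
    using assms by (intro sum.cong refl column_weight) (auto simp: column_distinct_def)
  finally have e: "weight n w = \<dots>" .
  have "\<dots> \<le> (\<Sum>c<lam1. 1)" by (rule sum_mono) auto
  then show "weight n w \<le> int lam1" using e by simp
  have "(\<Sum>c<lam1. - 1) \<le> (\<Sum>c<lam1. of_bool (0 \<in> (!) w ` column c) - of_bool (n - 1 \<in> (!) w ` column c) :: int)"
    by (rule sum_mono) auto
  then show "- int lam1 \<le> weight n w" using e by simp
qed

text \<open>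
  Two columns share at most as many letters as the shorter one has cells, and they share exactly that many rows.
\<close>

lemma column_pairs:
  assumes "column_distinct w" and c: "c < lam1" "c' < lam1"
  shows "(\<Sum>p\<in>column c. \<Sum>q\<in>column c'. of_bool (w ! p = w ! q)) \<le> (\<Sum>p\<in>column c. \<Sum>q\<in>column c'. of_bool (row p = row q) :: int)"
proof -
  have key: "(\<Sum>p\<in>column c. \<Sum>q\<in>column c'. of_bool (w ! p = w ! q)) \<le> (\<Sum>p\<in>column c. \<Sum>q\<in>column c'. of_bool (row p = row q) :: int)"
    if c: "c < lam1" "c' < lam1" and le: "h c \<le> h c'" for c c'
  proof -
    have "(\<Sum>p\<in>column c. \<Sum>q\<in>column c'. of_bool (w ! p = w ! q)) = (\<Sum>p\<in>column c. of_bool (w ! p \<in> (!) w ` column c') :: int)"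
      using assms(1) by (intro sum.cong refl sum_bool_eq_inj) (auto simp: column_distinct_def)
    also have "\<dots> \<le> (\<Sum>p\<in>column c. 1)" by (rule sum_mono) auto
    also have "\<dots> = (\<Sum>p\<in>column c. of_bool (row p \<in> row ` column c'))"
    proof (intro sum.cong refl)
      fix p assume "p \<in> column c"
      then have "row p < h c'" using rc_range le by fastforce
      then show "1 = (of_bool (row p \<in> row ` column c') :: int)" by (simp add: row_column c)
    qed
    also have "\<dots> = (\<Sum>p\<in>column c. \<Sum>q\<in>column c'. of_bool (row p = row q))"
      by (intro sum.cong refl sum_bool_eq_inj[symmetric] inj_row) auto
    finally show ?thesis .
  qed
  show ?thesis
  proof (cases "h c \<le> h c'")
    case True
    then show ?thesis using key c by blast
  next
    case False
    then have "(\<Sum>p\<in>column c'. \<Sum>q\<in>column c. of_bool (w ! p = w ! q)) \<le> (\<Sum>p\<in>column c'. \<Sum>q\<in>column c. of_bool (row p = row q) :: int)"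
      using key c by simp
    then show ?thesis
      by (subst (1 2) sum.swap) (simp add: eq_commute)
  qed
qed

lemma sum_column_pairs:
  "(\<Sum>p<d. \<Sum>q<d. f p q) = (\<Sum>c<lam1. \<Sum>c'<lam1. \<Sum>p\<in>column c. \<Sum>q\<in>column c'. f p q)"
  unfolding sum_columns by (rule sum.cong[OF refl]) (rule sum.swap)

text \<open>
  Both sides of the assumed equality are sums over pairs of columns, and no pair contributes more to the right
  hand side than to the left.  Hence all contributions agree, and those of a column with itself determine the
  presence of the letters \<open>0\<close> and \<open>n - 1\<close>.
\<close>

lemma extremal_weight:
  assumes w: "w \<in> words n d" and dist: "column_distinct w" and eq: "content = casimir_value n w"
  shows "weight n w = int lam1"
proof -
  have len: "length w = d" using w by (rule words_length)
  define A where "A c c' = (\<Sum>p\<in>column c. \<Sum>q\<in>column c'. if p = q then 0 else of_bool (w ! p = w ! q) - of_bool (w ! p + w ! q = n - 1) :: int)" for c c'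
  define D where "D c = (\<Sum>p\<in>column c. 2 * (int (w ! p) - of_bool (n - 1 - w ! p < w ! p)))" for c
  define B where "B c c' = (\<Sum>p\<in>column c. \<Sum>q\<in>column c'. if p = q then 0 else of_bool (row p = row q) - of_bool (col p = col q) :: int)" for c c'
  have "casimir_value n w = (\<Sum>c<lam1. \<Sum>c'<lam1. A c c') - (\<Sum>c<lam1. D c)"
    unfolding casimir_value_def len A_def D_def sum_column_pairs by (simp only: sum_columns)
  also have "\<dots> = (\<Sum>c<lam1. (\<Sum>c'<lam1. if c' = c then A c c - D c else A c c'))"
    unfolding sum_subtractf[symmetric]
  proof (intro sum.cong refl)
    fix c assume "c \<in> {..<lam1}"
    then show "(\<Sum>c'<lam1. A c c') - D c = (\<Sum>c'<lam1. if c' = c then A c c - D c else A c c')"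
      by (simp add: sum.remove[of "{..<lam1}" c])
  qed
  finally have cas: "casimir_value n w = (\<Sum>c<lam1. (\<Sum>c'<lam1. if c' = c then A c c - D c else A c c'))" .
  have con: "content = (\<Sum>c<lam1. \<Sum>c'<lam1. B c c')"
    unfolding content_def B_def sum_column_pairs ..
  have inj: "inj_on ((!) w) (column c)" for c using dist by (simp add: column_distinct_def)
  define S where "S c = (!) w ` column c" for c
  have cardS: "card (S c) = h c" if "c < lam1" for c
    unfolding S_def using card_image[OF inj[of c]] card_column[OF that] by simp
  have Sn: "S c \<subseteq> {..<n}" for c using w by (auto simp: S_def words_nth)
  have hn: "h c < n" for c using h_anti[of 0 c] h_less by simp
  have diag: "A c c - D c = - ((\<Sum>z\<in>S c. 2 * (int z - of_bool (n - 1 - z < z))) + (\<Sum>z\<in>S c. \<Sum>y\<in>S c. of_bool (z \<noteq> y \<and> z + y = n - 1)))" for c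
  proof -
    have "A c c = - (\<Sum>p\<in>column c. \<Sum>q\<in>column c. of_bool (w ! p \<noteq> w ! q \<and> w ! p + w ! q = n - 1))"
      unfolding A_def sum_negf[symmetric] using inj[of c]
      by (intro sum.cong refl) (auto dest: inj_onD)
    then show ?thesis unfolding S_def D_def by (simp add: sum.reindex[OF inj])
  qed
  have Bd: "B c c = - (int (h c) * (int (h c) - 1))" if "c < lam1" for c
  proof -
    have "B c c = (\<Sum>p\<in>column c. \<Sum>q\<in>column c. (if p = q then 1 else 0) - 1)"
      unfolding B_def using inj_row[of c] by (intro sum.cong refl) (auto dest: inj_onD)
    also have "\<dots> = (\<Sum>p\<in>column c. 1 - int (h c))"
      using card_column[OF that] by (intro sum.cong refl) (simp add: sum_subtractf)
    finally show ?thesis using card_column[OF that] by (simp add: algebra_simps)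
  qed
  have col: "A c c - D c \<le> B c c" "A c c - D c = B c c \<Longrightarrow> 0 \<in> S c \<and> n - 1 \<notin> S c" if c: "c < lam1" for c
    using column_letters[OF Sn[of c] n3] cardS[OF c] h_pos[OF c] hn[of c]
    unfolding diag Bd[OF c] by simp_all
  have off: "A c c' \<le> B c c'" if c: "c < lam1" "c' < lam1" "c \<noteq> c'" for c c'
  proof -
    have "A c c' \<le> (\<Sum>p\<in>column c. \<Sum>q\<in>column c'. of_bool (w ! p = w ! q))"
      unfolding A_def using c by (intro sum_mono) auto
    also have "\<dots> \<le> (\<Sum>p\<in>column c. \<Sum>q\<in>column c'. of_bool (row p = row q))"
      by (rule column_pairs[OF dist c(1,2)])
    also have "\<dots> = B c c'"
      unfolding B_def using c by (intro sum.cong refl) auto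
    finally show ?thesis .
  qed
  have le: "(if c' = c then A c c - D c else A c c') \<le> B c c'" if "c < lam1" "c' < lam1" for c c'
    using that col off by auto
  have tot: "(\<Sum>c'<lam1. if c' = c then A c c - D c else A c c') = (\<Sum>c'<lam1. B c c')" if "c < lam1" for c
    using eq[unfolded cas con, symmetric] by (rule sum_mono_inv) (use that le in \<open>auto intro: sum_mono\<close>)
  have "A c c - D c = B c c" if c: "c < lam1" for c
  proof -
    have "(if c = c then A c c - D c else A c c) = B c c"
      using tot[OF c] by (rule sum_mono_inv) (use c le in auto)
    then show ?thesis by simp
  qed
  then have top: "0 \<in> S c" "n - 1 \<notin> S c" if "c < lam1" for c using col that by blast+
  have "weight n w = (\<Sum>c<lam1. \<Sum>p\<in>column c. letter_weight n (w ! p))"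
    unfolding weight_def len by (rule sum_columns)
  also have "\<dots> = (\<Sum>c<lam1. 1)"
    using top by (intro sum.cong refl) (simp add: column_weight[OF inj] S_def)
  finally show ?thesis by simp
qed

end

section \<open>The representation on words\<close>

lemma weight_permute: "\<sigma> permutes {..<length w} \<Longrightarrow> weight n (permute_list \<sigma> w) = weight n w"
  unfolding weight_def using sum.permute[of \<sigma> "{..<length w}" "\<lambda>p. letter_weight n (w ! p)"]
  by (simp add: permute_list_nth comp_def)

lemma permute_list_update_inv:
  assumes "\<sigma> permutes {..<length w}" "i < length w"
  shows "permute_list \<sigma> (w[i := x]) = (permute_list \<sigma> w)[inv \<sigma> i := x]" "inv \<sigma> i < length w"
proof -
  show i: "inv \<sigma> i < length w"
    using permutes_in_image[OF permutes_inv[OF assms(1)], of i] assms(2) by simp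
  show "permute_list \<sigma> (w[i := x]) = (permute_list \<sigma> w)[inv \<sigma> i := x]"
    using permute_list_update[OF assms(1) i, of x] permutes_inverses(1)[OF assms(1), of i] by simp
qed

definition traceless_words :: "nat \<Rightarrow> nat \<Rightarrow> (nat list \<Rightarrow> complex) set" where
  "traceless_words n d = {c. (\<forall>w. w \<notin> words n d \<longrightarrow> c w = 0) \<and>
     (\<forall>w\<in>words n d. \<forall>i<d. \<forall>j<d. i \<noteq> j \<longrightarrow> (\<Sum>x<n. c (w[i := x, j := n - 1 - x])) = 0)}"

lemma traceless_words_act:
  assumes c: "c \<in> traceless_words n d" and s: "\<sigma> permutes {..<d}"
  shows "act \<sigma> c \<in> traceless_words n d"
  unfolding traceless_words_def
proof (intro CollectI conjI allI ballI impI)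
  fix w assume "w \<notin> words n d"
  then show "act \<sigma> c w = 0" using c s by (simp add: act_def traceless_words_def permute_list_words)
next
  fix w i j assume w: "w \<in> words n d" and ij: "i < d" "j < d" "i \<noteq> j"
  have len: "length w = d" using w by (rule words_length)
  have "(\<Sum>x<n. act \<sigma> c (w[i := x, j := n - 1 - x])) =
     (\<Sum>x<n. c ((permute_list \<sigma> w)[inv \<sigma> i := x, inv \<sigma> j := n - 1 - x]))"
    unfolding act_def using s ij len by (intro sum.cong refl) (simp add: permute_list_update_inv)
  also have "\<dots> = 0"
  proof -
    have "inv \<sigma> i < d" "inv \<sigma> j < d" using permute_list_update_inv(2)[of \<sigma> w] s ij len by auto
    moreover have "inv \<sigma> i \<noteq> inv \<sigma> j" using ij permutes_inverses(1)[OF s] by metis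
    moreover have "permute_list \<sigma> w \<in> words n d" using w s by (simp add: permute_list_words)
    ultimately show ?thesis using c by (simp add: traceless_words_def)
  qed
  finally show "(\<Sum>x<n. act \<sigma> c (w[i := x, j := n - 1 - x])) = 0" .
qed

lemma traceless_words_sum:
  assumes "\<And>i. i \<in> I \<Longrightarrow> c i \<in> traceless_words n d"
  shows "(\<lambda>w. \<Sum>i\<in>I. k i * c i w) \<in> traceless_words n d"
  unfolding traceless_words_def
proof (intro CollectI conjI allI ballI impI)
  fix w assume "w \<notin> words n d"
  then show "(\<Sum>i\<in>I. k i * c i w) = 0" using assms by (intro sum.neutral) (auto simp: traceless_words_def)
next
  fix w i j assume w: "w \<in> words n d" and ij: "i < d" "j < d" "i \<noteq> j"
  have "(\<Sum>x<n. \<Sum>a\<in>I. k a * c a (w[i := x, j := n - 1 - x])) = (\<Sum>a\<in>I. k a * (\<Sum>x<n. c a (w[i := x, j := n - 1 - x])))"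
    by (subst sum.swap) (simp add: sum_distrib_left)
  also have "\<dots> = 0" using assms w ij by (intro sum.neutral) (simp add: traceless_words_def)
  finally show "(\<Sum>x<n. \<Sum>a\<in>I. k a * c a (w[i := x, j := n - 1 - x])) = 0" .
qed

definition weight_part :: "nat \<Rightarrow> int \<Rightarrow> (nat list \<Rightarrow> complex) \<Rightarrow> nat list \<Rightarrow> complex" where
  "weight_part n r c = (\<lambda>w. of_bool (weight n w = r) * c w)"

text \<open>
  The isometry \<open>v\<^sub>a \<mapsto> v\<^sub>n\<^sub>-\<^sub>1\<^sub>-\<^sub>a\<close>.
\<close>

definition flip :: "nat \<Rightarrow> nat \<Rightarrow> (nat list \<Rightarrow> complex) \<Rightarrow> nat list \<Rightarrow> complex" where
  "flip n d c = (\<lambda>w. if w \<in> words n d then c (map (\<lambda>x. n - 1 - x) w) else 0)"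

lemma traceless_words_weight_part:
  assumes n: "n \<ge> 2" and c: "c \<in> traceless_words n d"
  shows "weight_part n r c \<in> traceless_words n d"
  unfolding traceless_words_def
proof (intro CollectI conjI allI ballI impI)
  fix w assume "w \<notin> words n d"
  then show "weight_part n r c w = 0" using c by (simp add: weight_part_def traceless_words_def)
next
  fix w i j assume w: "w \<in> words n d" and ij: "i < d" "j < d" "i \<noteq> j"
  have len: "length w = d" using w by (rule words_length)
  have "weight n (w[i := x, j := n - 1 - x]) = weight n w - letter_weight n (w ! i) - letter_weight n (w ! j)" if "x < n" for x
    using ij len that n by (simp add: weight_update) (auto simp: letter_weight_def)
  then have "(\<Sum>x<n. weight_part n r c (w[i := x, j := n - 1 - x])) =
      of_bool (weight n w - letter_weight n (w ! i) - letter_weight n (w ! j) = r) * (\<Sum>x<n. c (w[i := x, j := n - 1 - x]))"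
    unfolding weight_part_def by (simp add: sum_distrib_left)
  then show "(\<Sum>x<n. weight_part n r c (w[i := x, j := n - 1 - x])) = 0"
    using c w ij by (simp add: traceless_words_def)
qed

lemma flip_word: "w \<in> words n d \<Longrightarrow> map (\<lambda>x. n - 1 - x) w \<in> words n d"
  by (auto simp: words_iff)

lemma traceless_words_flip:
  assumes c: "c \<in> traceless_words n d"
  shows "flip n d c \<in> traceless_words n d"
  unfolding traceless_words_def
proof (intro CollectI conjI allI ballI impI)
  fix w assume "w \<notin> words n d"
  then show "flip n d c w = 0" by (simp add: flip_def)
next
  fix w i j assume w: "w \<in> words n d" and ij: "i < d" "j < d" "i \<noteq> j"
  let ?m = "map (\<lambda>x. n - 1 - x) w"
  have "(\<Sum>x<n. flip n d c (w[i := x, j := n - 1 - x])) = (\<Sum>x<n. c (?m[i := n - 1 - x, j := n - 1 - (n - 1 - x)]))"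
  proof (intro sum.cong refl)
    fix x assume "x \<in> {..<n}"
    then have "w[i := x, j := n - 1 - x] \<in> words n d" using w by (auto intro!: words_update)
    then show "flip n d c (w[i := x, j := n - 1 - x]) = c (?m[i := n - 1 - x, j := n - 1 - (n - 1 - x)])"
      unfolding flip_def map_update by (rule if_P)
  qed
  also have "\<dots> = (\<Sum>x<n. c (?m[i := x, j := n - 1 - x]))"
    by (rule sum.reindex_bij_witness[of _ "\<lambda>x. n - 1 - x" "\<lambda>x. n - 1 - x"]) auto
  also have "\<dots> = 0" using c flip_word[OF w] ij by (simp add: traceless_words_def)
  finally show "(\<Sum>x<n. flip n d c (w[i := x, j := n - 1 - x])) = 0" .
qed

lemma weight_flip:
  assumes n: "n \<ge> 2" and w: "w \<in> words n d"
  shows "weight n (map (\<lambda>x. n - 1 - x) w) = - weight n w"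
proof -
  have "letter_weight n (n - 1 - x) = - letter_weight n x" if "x < n" for x
    using that n by (auto simp: letter_weight_def)
  then show ?thesis unfolding weight_def sum_negf[symmetric] using w
    by (intro sum.cong) (auto simp: words_nth words_length)
qed

context tableau
begin

definition schur_words :: "(nat list \<Rightarrow> complex) set" where
  "schur_words = (\<lambda>c. csym (rsym c)) ` traceless_words n d"

lemma csym_rsym_expand: "csym (rsym c) w = (\<Sum>(\<sigma>, \<tau>)\<in>cols \<times> rows. of_int (sign \<sigma>) * act \<sigma> (act \<tau> c) w)"
  by (simp add: csym_def rsym_def act_def sum_distrib_left sum.cartesian_product)

lemma schur_words_traceless:
  assumes "t \<in> schur_words" shows "t \<in> traceless_words n d"
proof -
  obtain c where c: "c \<in> traceless_words n d" "t = csym (rsym c)" using assms by (auto simp: schur_words_def)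
  have "t = (\<lambda>w. \<Sum>x\<in>cols \<times> rows. of_int (sign (fst x)) * act (fst x) (act (snd x) c) w)"
    unfolding c(2) by (rule ext) (simp add: csym_rsym_expand case_prod_unfold)
  also have "\<dots> \<in> traceless_words n d"
    by (rule traceless_words_sum) (auto intro!: traceless_words_act c(1) simp: rows_permutes cols_permutes)
  finally show ?thesis .
qed

lemma schur_words_support: "t \<in> schur_words \<Longrightarrow> w \<notin> words n d \<Longrightarrow> t w = 0"
  using schur_words_traceless by (auto simp: traceless_words_def)

lemma schur_words_column_distinct:
  assumes "t \<in> schur_words" "t w \<noteq> 0"
  shows "column_distinct w"
  unfolding column_distinct_def
proof (intro allI inj_onI)
  fix c p q assume pq: "p \<in> column c" "q \<in> column c" "w ! p = w ! q"
  have len: "length w = d" using assms schur_words_support words_length by blast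
  obtain c' where c': "t = csym (rsym c')" using assms by (auto simp: schur_words_def)
  show "p = q"
  proof (rule ccontr)
    assume "p \<noteq> q"
    then have "t (permute_list (Transposition.transpose p q) w) = - t w"
      unfolding c' using pq len by (intro csym_swap) auto
    moreover have "permute_list (Transposition.transpose p q) w = w"
      using pq len by (simp add: permute_list_transpose) (metis list_update_id)
    ultimately show False using assms(2) by simp
  qed
qed

lemma schur_words_weight_bounds:
  assumes "t \<in> schur_words" "t w \<noteq> 0"
  shows "- int lam1 \<le> weight n w" "weight n w \<le> int lam1"
  using weight_bounds schur_words_column_distinct[OF assms] words_length schur_words_support assms by blast+

lemma schur_words_subspace: "cfun.subspace schur_words"
proof -
  have sym: "csym (rsym (c + c')) = csym (rsym c) + csym (rsym c')"
      "csym (rsym (fscale k c)) = fscale k (csym (rsym c))" for c c' k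
    by (simp_all add: fun_eq_iff csym_def rsym_def fscale_def sum.distrib sum_distrib_left distrib_left mult.left_commute)
  have tr1: "c + c' \<in> traceless_words n d"
    if "c \<in> traceless_words n d" "c' \<in> traceless_words n d" for c c'
  proof -
    have "(\<lambda>w. \<Sum>b\<in>(UNIV :: bool set). 1 * (if b then c else c') w) \<in> traceless_words n d"
      by (rule traceless_words_sum) (use that in simp)
    moreover have "(\<lambda>w. \<Sum>b\<in>(UNIV :: bool set). 1 * (if b then c else c') w) = c + c'"
      by (simp add: fun_eq_iff UNIV_bool)
    ultimately show ?thesis by simp
  qed
  have tr2: "fscale k c \<in> traceless_words n d" if "c \<in> traceless_words n d" for c k
    using traceless_words_sum[of "{()}" "\<lambda>_. c" n d "\<lambda>_. k"] that by (simp add: fscale_def)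
  have z: "csym (rsym 0) = 0" "0 \<in> traceless_words n d"
    by (simp_all add: csym_def rsym_def traceless_words_def fun_eq_iff)
  define Y where "Y = (\<lambda>c. csym (rsym c))"
  have "cfun.subspace (Y ` traceless_words n d)"
    unfolding cfun.subspace_def
  proof (intro conjI ballI allI)
    have "Y 0 \<in> Y ` traceless_words n d" using z(2) by (rule imageI)
    then show "0 \<in> Y ` traceless_words n d" by (simp add: Y_def z(1))
  next
    fix x y assume "x \<in> Y ` traceless_words n d" "y \<in> Y ` traceless_words n d"
    then obtain a b where ab: "a \<in> traceless_words n d" "x = Y a" "b \<in> traceless_words n d" "y = Y b"
      by blast
    have "Y (a + b) \<in> Y ` traceless_words n d" by (rule imageI, rule tr1) (fact ab)+
    then show "x + y \<in> Y ` traceless_words n d" unfolding ab Y_def sym .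
  next
    fix k x assume "x \<in> Y ` traceless_words n d"
    then obtain a where a: "a \<in> traceless_words n d" "x = Y a" by blast
    have "Y (fscale k a) \<in> Y ` traceless_words n d" by (rule imageI, rule tr2) (fact a)
    then show "fscale k x \<in> Y ` traceless_words n d" unfolding a Y_def sym .
  qed
  then show ?thesis by (simp add: schur_words_def Y_def)
qed

text \<open>
  Operators that commute with the permutations of the positions act on the image of the Young symmetrizer.
\<close>

lemma csym_rsym_commute:
  assumes "\<And>\<sigma> w. \<sigma> permutes {..<d} \<Longrightarrow> w \<in> words n d \<Longrightarrow> P c (permute_list \<sigma> w) = P (act \<sigma> c) w"
    and lin: "\<And>(I :: ((nat \<Rightarrow> nat) \<times> (nat \<Rightarrow> nat)) set) k c w. finite I \<Longrightarrow> w \<in> words n d \<Longrightarrow> P (\<lambda>u. \<Sum>i\<in>I. k i * c i u) w = (\<Sum>i\<in>I. k i * P (c i) w)"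
    and supp: "\<And>c w. (\<forall>u. u \<notin> words n d \<longrightarrow> c u = 0) \<Longrightarrow> w \<notin> words n d \<Longrightarrow> P c w = 0"
    and c: "c \<in> traceless_words n d" "P c \<in> traceless_words n d"
  shows "P (csym (rsym c)) = csym (rsym (P c))"
proof (rule ext)
  fix w
  show "P (csym (rsym c)) w = csym (rsym (P c)) w"
  proof (cases "w \<in> words n d")
    case True
    have "csym (rsym c) = (\<lambda>w. \<Sum>x\<in>cols \<times> rows. of_int (sign (fst x)) * act (fst x) (act (snd x) c) w)"
      by (rule ext) (simp add: csym_rsym_expand case_prod_unfold)
    then have "P (csym (rsym c)) w = (\<Sum>x\<in>cols \<times> rows. of_int (sign (fst x)) * P (act (fst x) (act (snd x) c)) w)"
      using lin[OF _ True, of "cols \<times> rows" "\<lambda>x. of_int (sign (fst x))" "\<lambda>x. act (fst x) (act (snd x) c)"]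
        finite_cols finite_rows by simp
    also have "\<dots> = (\<Sum>x\<in>cols \<times> rows. of_int (sign (fst x)) * act (fst x) (act (snd x) (P c)) w)"
    proof (intro sum.cong refl)
      fix x assume x: "x \<in> cols \<times> rows"
      then have p: "fst x permutes {..<d}" "snd x permutes {..<d}"
        using rows_permutes cols_permutes by auto
      from permutes_compose[OF p(2,1)] have p3: "fst x \<circ> snd x permutes {..<d}" .
      have e: "act (fst x \<circ> snd x) f u = act (fst x) (act (snd x) f) u" if "length u = d" for f u
        using act_compose[of "fst x" u "snd x" f] p that by simp
      have "act (fst x) (act (snd x) c) u = act (fst x \<circ> snd x) c u" for u
      proof (cases "length u = d")
        case False
        then show ?thesis using schur_words_traceless c p
          by (simp add: act_def traceless_words_def words_def)
      qed (simp add: e)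
      then have "act (fst x) (act (snd x) c) = act (fst x \<circ> snd x) c" by auto
      then have "P (act (fst x) (act (snd x) c)) w = P c (permute_list (fst x \<circ> snd x) w)"
        using assms(1)[OF p3 True] by simp
      also have "\<dots> = act (fst x) (act (snd x) (P c)) w"
        using e[of w "P c"] words_length[OF True] by (simp add: act_def)
      finally show "of_int (sign (fst x)) * P (act (fst x) (act (snd x) c)) w =
          of_int (sign (fst x)) * act (fst x) (act (snd x) (P c)) w" by simp
    qed
    also have "\<dots> = csym (rsym (P c)) w" by (simp add: csym_rsym_expand case_prod_unfold)
    finally show ?thesis .
  next
    case False
    then show ?thesis
      using supp[of "csym (rsym c)" w] schur_words_support[of _ w] c schur_words_support
      by (simp add: schur_words_def)
  qed
qed

lemma schur_words_weight_part:
  assumes "t \<in> schur_words" shows "weight_part n r t \<in> schur_words"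
proof -
  obtain c where c: "c \<in> traceless_words n d" "t = csym (rsym c)" using assms by (auto simp: schur_words_def)
  have pc: "weight_part n r c \<in> traceless_words n d" using n3 c by (intro traceless_words_weight_part) auto
  have "weight_part n r t = csym (rsym (weight_part n r c))"
    unfolding c(2)
  proof (rule csym_rsym_commute)
    show "weight_part n r c (permute_list \<sigma> w) = weight_part n r (act \<sigma> c) w"
      if "\<sigma> permutes {..<d}" "w \<in> words n d" for \<sigma> w
      using that words_length by (auto simp: weight_part_def act_def weight_permute)
  qed (use c pc in \<open>auto simp: weight_part_def sum_distrib_left mult.left_commute\<close>)
  then show ?thesis using pc by (auto simp: schur_words_def)
qed

lemma schur_words_flip:
  assumes "t \<in> schur_words" shows "flip n d t \<in> schur_words"
proof -
  obtain c where c: "c \<in> traceless_words n d" "t = csym (rsym c)" using assms by (auto simp: schur_words_def)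
  have pc: "flip n d c \<in> traceless_words n d" using c by (intro traceless_words_flip) auto
  have "flip n d t = csym (rsym (flip n d c))"
    unfolding c(2)
  proof (rule csym_rsym_commute)
    show "flip n d c (permute_list \<sigma> w) = flip n d (act \<sigma> c) w"
      if "\<sigma> permutes {..<d}" "w \<in> words n d" for \<sigma> w
      using that words_length[OF that(2)] by (simp add: flip_def act_def permute_list_words permute_list_map)
  qed (use c pc in \<open>auto simp: flip_def\<close>)
  then show ?thesis using pc by (auto simp: schur_words_def)
qed

end

section \<open>A vector of top weight\<close>

text \<open>
  The vectors \<open>v\<^sub>i\<close> for \<open>i < m\<close>, followed for \<open>m \<le> i < n - m\<close> by an orthogonal basis of the span of
  \<open>v\<^sub>m, \<dots>, v\<^sub>n\<^sub>-\<^sub>m\<^sub>-\<^sub>1\<close>: each pair \<open>v\<^sub>i, v\<^sub>i\<^sub>'\<close> with \<open>i < i' = n - 1 - i\<close> is replaced by \<open>v\<^sub>i + v\<^sub>i\<^sub>'\<close> and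
  \<open>v\<^sub>i - v\<^sub>i\<^sub>'\<close>.  The coefficients are at \<open>v\<^sub>i\<close> and \<open>v\<^sub>n\<^sub>-\<^sub>1\<^sub>-\<^sub>i\<close>.
\<close>

definition frame_a :: "nat \<Rightarrow> nat \<Rightarrow> nat \<Rightarrow> complex" where
  "frame_a n m i = (if m \<le> i \<and> n - 1 - i < i then - 1 else 1)"
definition frame_b :: "nat \<Rightarrow> nat \<Rightarrow> nat \<Rightarrow> complex" where
  "frame_b n m i = (if m \<le> i \<and> i \<noteq> n - 1 - i then 1 else 0)"
definition frame :: "nat \<Rightarrow> nat \<Rightarrow> nat \<Rightarrow> nat \<Rightarrow> complex" where
  "frame n m i x = frame_a n m i * of_bool (x = i) + frame_b n m i * of_bool (x = n - 1 - i)"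

lemma sum_frame:
  assumes "i < n"
  shows "(\<Sum>x<n. frame n m i x * f x) = frame_a n m i * f i + frame_b n m i * f (n - 1 - i)"
proof -
  have "(\<Sum>x<n. frame n m i x * f x) = (\<Sum>x<n. (if x = i then frame_a n m i * f x else 0) +
      (if x = n - 1 - i then frame_b n m i * f x else 0))"
    by (intro sum.cong refl) (auto simp: frame_def algebra_simps)
  then show ?thesis using assms by (simp add: sum.distrib)
qed

text \<open>
  Orthogonality holds for the given form, which makes product tensors traceless, and also for the bilinear form in
  which the \<open>v\<^sub>a\<close> are orthonormal, which serves to detect them.
\<close>

lemma frame_orthogonal:
  assumes "i < n - m" "j < n - m" "i \<noteq> j"
  shows "(\<Sum>x<n. frame n m i x * frame n m j x) = 0" "(\<Sum>x<n. frame n m i x * frame n m j (n - 1 - x)) = 0"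
proof -
  have i: "i < n" "j < n" using assms by auto
  have e: "(n - 1 - i = j) = (i + j = n - 1)" "(i = n - 1 - j) = (i + j = n - 1)" "(j = n - 1 - i) = (i + j = n - 1)"
    "(n - 1 - i = n - 1 - j) = False" "n - 1 - (n - 1 - i) = i" "(i = j) = False"
    using assms by auto
  have "i + j = n - 1 \<Longrightarrow> m \<le> i \<and> m \<le> j \<and> (n - 1 - i < i \<longleftrightarrow> \<not> n - 1 - j < j) \<and> i \<noteq> n - 1 - i \<and> j \<noteq> n - 1 - j"
    using assms by auto
  then have "i + j = n - 1 \<Longrightarrow> frame_a n m i * frame_b n m j + frame_b n m i * frame_a n m j = 0"
    "i + j = n - 1 \<Longrightarrow> frame_a n m i * frame_a n m j + frame_b n m i * frame_b n m j = 0"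
    by (auto simp: frame_a_def frame_b_def)
  then show "(\<Sum>x<n. frame n m i x * frame n m j x) = 0" "(\<Sum>x<n. frame n m i x * frame n m j (n - 1 - x)) = 0"
    unfolding sum_frame[OF i(1)] unfolding frame_def[of n m j] e
    by (cases "i + j = n - 1"; simp)+
qed

lemma frame_nonzero:
  assumes "i < n"
  shows "(\<Sum>x<n. frame n m i x * frame n m i x) \<noteq> 0"
  unfolding sum_frame[OF assms] unfolding frame_def using assms
  by (auto simp: frame_a_def frame_b_def)

lemma frame_isotropic:
  assumes "i < m" "i < n - m"
  shows "(\<Sum>x<n. frame n m i x * frame n m i (n - 1 - x)) = 0"
proof -
  have i: "i < n" "n - 1 - i \<noteq> i" "i \<noteq> n - 1 - i" "n - 1 - (n - 1 - i) = i" using assms by auto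
  show ?thesis unfolding sum_frame[OF i(1)] unfolding frame_def i(4)
    using i assms by (simp add: frame_b_def)
qed

context tableau
begin

text \<open>
  The product of \<open>frame\<close> vectors with the \<open>i\<close>-th vector in every cell of row \<open>i\<close>.  The choice \<open>m = n - h 0\<close> makes
  room for \<open>h 0\<close> vectors and is at least \<open>h 1\<close>, so that the vectors used more than once are isotropic.
\<close>

definition witness :: "nat list \<Rightarrow> complex" where
  "witness w = (if w \<in> words n d then \<Prod>p<d. frame n (n - h 0) (row p) (w ! p) else 0)"

lemma row_less: "p < d \<Longrightarrow> row p < h 0"
  using rc_range[of p] h_anti[of 0 "col p"] by simp

lemma witness_traceless: "witness \<in> traceless_words n d"
  unfolding traceless_words_def
proof (intro CollectI conjI allI ballI impI)
  fix w assume "w \<notin> words n d" then show "witness w = 0" by (simp add: witness_def)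
next
  fix w i j assume w: "w \<in> words n d" and ij: "i < d" "j < d" "i \<noteq> j"
  let ?F = "frame n (n - h 0)"
  have len: "length w = d" using w by (rule words_length)
  have "witness (w[i := x, j := n - 1 - x]) =
     (?F (row i) x * ?F (row j) (n - 1 - x)) * (\<Prod>p\<in>{..<d} - {i} - {j}. ?F (row p) (w ! p))" if x: "x < n" for x
  proof -
    let ?u = "w[i := x, j := n - 1 - x]"
    have "?u \<in> words n d" using w x by (simp add: words_update)
    then have "witness ?u = (\<Prod>p<d. ?F (row p) (?u ! p))" by (simp add: witness_def)
    also have "\<dots> = ?F (row i) (?u ! i) * (?F (row j) (?u ! j) * (\<Prod>p\<in>{..<d} - {i} - {j}. ?F (row p) (?u ! p)))"
      using ij by (simp add: prod.remove[of "{..<d}" i] prod.remove[of "{..<d} - {i}" j])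
    also have "(\<Prod>p\<in>{..<d} - {i} - {j}. ?F (row p) (?u ! p)) = (\<Prod>p\<in>{..<d} - {i} - {j}. ?F (row p) (w ! p))"
      by (intro prod.cong) auto
    finally show ?thesis using ij len by simp
  qed
  then have "(\<Sum>x<n. witness (w[i := x, j := n - 1 - x])) =
      (\<Sum>x<n. ?F (row i) x * ?F (row j) (n - 1 - x)) * (\<Prod>p\<in>{..<d} - {i} - {j}. ?F (row p) (w ! p))"
    by (simp add: sum_distrib_right)
  also have "(\<Sum>x<n. ?F (row i) x * ?F (row j) (n - 1 - x)) = 0"
  proof (cases "row i = row j")
    case False
    then show ?thesis using row_less ij h_less by (intro frame_orthogonal) auto
  next
    case True
    then have "col i \<noteq> col j" using rc_inj ij by blast
    then have "1 \<le> col i \<or> 1 \<le> col j" by auto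
    then have "row i < h 1" using rc_range[of i] rc_range[of j] True ij h_anti[of 1 "col i"] h_anti[of 1 "col j"] by auto
    then have "row i < n - h 0" "row i < n - (n - h 0)" using h_two row_less[OF ij(1)] h_less by auto
    then show ?thesis unfolding True[symmetric] by (rule frame_isotropic)
  qed
  finally show "(\<Sum>x<n. witness (w[i := x, j := n - 1 - x])) = 0" by simp
qed

lemma witness_permute:
  assumes s: "\<sigma> permutes {..<d}" and w: "w \<in> words n d"
  shows "witness (permute_list \<sigma> w) = (\<Prod>p<d. frame n (n - h 0) (row (inv \<sigma> p)) (w ! p))"
proof -
  have len: "length w = d" using w by (rule words_length)
  have "witness (permute_list \<sigma> w) = (\<Prod>p<d. frame n (n - h 0) (row p) (w ! \<sigma> p))"
    using assms len by (simp add: witness_def permute_list_words permute_list_nth)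
  also have "\<dots> = (\<Prod>p<d. frame n (n - h 0) (row (inv \<sigma> (\<sigma> p))) (w ! \<sigma> p))"
    using permutes_inverses(2)[OF s] by simp
  also have "\<dots> = (\<Prod>p<d. frame n (n - h 0) (row (inv \<sigma> p)) (w ! p))"
    using prod.permute[OF s, of "\<lambda>p. frame n (n - h 0) (row (inv \<sigma> p)) (w ! p)"] by (simp add: comp_def)
  finally show ?thesis .
qed

lemma rsym_witness:
  assumes "w \<in> words n d"
  shows "rsym witness w = of_nat (card rows) * witness w"
proof -
  have "witness (permute_list \<sigma> w) = witness w" if s: "\<sigma> \<in> rows" for \<sigma>
  proof -
    have "row (inv \<sigma> p) = row p" if "p < d" for p
    proof -
      have "inv \<sigma> p < d"
        using permutes_in_image[OF permutes_inv[OF rows_permutes[OF s]], of p] that by simp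
      then have "row (\<sigma> (inv \<sigma> p)) = row (inv \<sigma> p)" using s by (simp add: rows_def)
      then show ?thesis using permutes_inverses(1)[OF rows_permutes[OF s]] by simp
    qed
    then show ?thesis using witness_permute[OF rows_permutes[OF s] assms] assms by (simp add: witness_def)
  qed
  then show ?thesis by (simp add: rsym_def)
qed

lemma csym_rsym_witness:
  assumes "w \<in> words n d"
  shows "csym (rsym witness) w = of_nat (card rows) * csym witness w"
  unfolding csym_def sum_distrib_left using assms
  by (intro sum.cong refl) (simp add: rsym_witness permute_list_words cols_permutes)

text \<open>
  The row symmetrizer only multiplies \<open>witness\<close> by a positive number.  Pairing the column antisymmetrization with
  \<open>witness\<close> itself leaves the term of the identity, since any other column permutation moves some position to
  another row and thus meets two orthogonal vectors.
\<close>

lemma csym_rsym_witness_nonzero: "\<exists>w\<in>words n d. csym (rsym witness) w \<noteq> 0"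
proof -
  let ?F = "frame n (n - h 0)"
  have id_rows: "id \<in> rows" and id_cols: "id \<in> cols"
    by (simp_all add: rows_def cols_def permutes_id)
  have fr: "row p < n - (n - h 0)" "row p < n" if "p < d" for p
    using row_less[OF that] h_less by auto
  have "(\<Sum>w\<in>words n d. witness w * csym witness w) =
      (\<Sum>w\<in>words n d. \<Sum>\<sigma>\<in>cols. of_int (sign \<sigma>) * (witness w * witness (permute_list \<sigma> w)))"
    unfolding csym_def sum_distrib_left by (intro sum.cong refl mult.left_commute)
  also have "\<dots> = (\<Sum>\<sigma>\<in>cols. of_int (sign \<sigma>) * (\<Sum>w\<in>words n d. witness w * witness (permute_list \<sigma> w)))"
    by (subst sum.swap) (simp add: sum_distrib_left)
  also have "\<dots> = (\<Sum>\<sigma>\<in>cols. of_int (sign \<sigma>) * (\<Prod>p<d. \<Sum>x<n. ?F (row p) x * ?F (row (inv \<sigma> p)) x))"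
  proof (intro sum.cong refl arg_cong2[where f = "(*)"])
    fix \<sigma> assume s: "\<sigma> \<in> cols"
    have "(\<Sum>w\<in>words n d. witness w * witness (permute_list \<sigma> w)) =
       (\<Sum>w\<in>words n d. \<Prod>p<d. ?F (row p) (w ! p) * ?F (row (inv \<sigma> p)) (w ! p))"
      by (intro sum.cong refl) (simp add: witness_permute[OF cols_permutes[OF s]], simp add: witness_def prod.distrib)
    also have "\<dots> = (\<Prod>p<d. \<Sum>x<n. ?F (row p) x * ?F (row (inv \<sigma> p)) x)"
      using sum_words_prod[of "\<lambda>p x. ?F (row p) x * ?F (row (inv \<sigma> p)) x" d n] by simp
    finally show "(\<Sum>w\<in>words n d. witness w * witness (permute_list \<sigma> w)) =
       (\<Prod>p<d. \<Sum>x<n. ?F (row p) x * ?F (row (inv \<sigma> p)) x)" .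
  qed
  also have "\<dots> = (\<Sum>\<sigma>\<in>cols. if \<sigma> = id then \<Prod>p<d. \<Sum>x<n. ?F (row p) x * ?F (row p) x else 0)"
  proof (intro sum.cong refl)
    fix \<sigma> assume s: "\<sigma> \<in> cols"
    have sp: "\<sigma> permutes {..<d}" using s by (rule cols_permutes)
    show "of_int (sign \<sigma>) * (\<Prod>p<d. \<Sum>x<n. ?F (row p) x * ?F (row (inv \<sigma> p)) x) =
        (if \<sigma> = id then \<Prod>p<d. \<Sum>x<n. ?F (row p) x * ?F (row p) x else 0)"
    proof (cases "\<sigma> = id")
      case False
      have "\<exists>p<d. row (inv \<sigma> p) \<noteq> row p"
      proof (rule ccontr)
        assume no: "\<not> (\<exists>p<d. row (inv \<sigma> p) \<noteq> row p)"
        have "inv \<sigma> p = p" if p: "p < d" for p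
        proof -
          have i: "inv \<sigma> p < d" using permutes_in_image[OF permutes_inv[OF sp], of p] p by simp
          then have "col (\<sigma> (inv \<sigma> p)) = col (inv \<sigma> p)" using s by (simp add: cols_def)
          then have c: "col (inv \<sigma> p) = col p" using permutes_inverses(1)[OF sp, of p] by simp
          have r: "row (inv \<sigma> p) = row p" using no p by blast
          show ?thesis by (rule rc_inj[OF i p r c])
        qed
        then have "\<sigma> p = p" for p
          using permutes_inverses(1)[OF sp, of p] permutes_not_in[OF sp, of p] by (cases "p < d") auto
        then show False using False by auto
      qed
      then obtain p where p: "p < d" "row (inv \<sigma> p) \<noteq> row p" by blast
      have "inv \<sigma> p < d" using permutes_in_image[OF permutes_inv[OF sp], of p] p by simp
      then have "(\<Sum>x<n. ?F (row p) x * ?F (row (inv \<sigma> p)) x) = 0"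
        using p fr by (intro frame_orthogonal) auto
      then have "(\<Prod>p<d. \<Sum>x<n. ?F (row p) x * ?F (row (inv \<sigma> p)) x) = 0"
        using p(1) by (intro prod_zero) auto
      then show ?thesis using False by simp
    qed (simp add: inv_id[unfolded id_def])
  qed
  also have "\<dots> = (\<Prod>p<d. \<Sum>x<n. ?F (row p) x * ?F (row p) x)"
    using id_cols finite_cols by simp
  also have "\<dots> \<noteq> 0" using frame_nonzero fr by simp
  finally have "(\<Sum>w\<in>words n d. witness w * csym witness w) \<noteq> 0" .
  then obtain w where w: "w \<in> words n d" "csym witness w \<noteq> 0"
    by (metis (no_types, lifting) mult_zero_right sum.neutral)
  moreover have "card rows \<noteq> 0" using id_rows finite_rows by auto
  ultimately show ?thesis using csym_rsym_witness by auto
qed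

lemma witness_weight:
  assumes "witness w \<noteq> 0"
  shows "int lam1 \<le> weight n w"
proof -
  have w: "w \<in> words n d" using assms by (auto simp: witness_def split: if_splits)
  have len: "length w = d" using w by (rule words_length)
  have nz: "frame n (n - h 0) (row p) (w ! p) \<noteq> 0" if "p < d" for p
    using assms w that by (auto simp: witness_def)
  have "int lam1 = (\<Sum>c<lam1. \<Sum>p\<in>column c. of_bool (0 = row p))"
  proof -
    have "(\<Sum>p\<in>column c. of_bool (0 = row p)) = (1::int)" if c: "c < lam1" for c
    proof -
      have "0 \<in> row ` column c" using h_pos[OF c] by (simp only: row_column[OF c]) simp
      then show ?thesis using sum_bool_eq_inj[OF _ inj_row[of c], of 0] by simp
    qed
    then show ?thesis by simp
  qed
  also have "\<dots> = (\<Sum>p<d. of_bool (0 = row p))" by (rule sum_columns[symmetric])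
  also have "\<dots> \<le> (\<Sum>p<d. letter_weight n (w ! p))"
  proof (rule sum_mono)
    fix p assume "p \<in> {..<d}"
    then have p: "p < d" by simp
    have r: "row p < h 0" using row_less[OF p] .
    show "of_bool (0 = row p) \<le> letter_weight n (w ! p)"
    proof (cases "row p = 0")
      case True
      then have "w ! p = 0" using nz[OF p] h_less by (auto simp: frame_def frame_b_def split: if_splits)
      then show ?thesis using n3 by (simp add: letter_weight_def True)
    next
      case False
      have ne: "n - 1 \<noteq> row p" "n - 1 \<noteq> n - 1 - row p" using False r h_less by auto
      have "frame n (n - h 0) (row p) (n - 1) = 0" unfolding frame_def using ne by simp
      then have "w ! p \<noteq> n - 1" using nz[OF p] by auto
      then show ?thesis using False by (simp add: letter_weight_def)
    qed
  qed
  finally show ?thesis by (simp add: weight_def len)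
qed

lemma schur_words_top:
  "\<exists>t\<in>schur_words. t \<noteq> 0 \<and> (\<forall>w. t w \<noteq> 0 \<longrightarrow> weight n w = int lam1)"
proof -
  let ?t = "csym (rsym witness)"
  have t: "?t \<in> schur_words" using witness_traceless by (simp add: schur_words_def)
  moreover have "?t \<noteq> 0" using csym_rsym_witness_nonzero by auto
  moreover have "weight n w = int lam1" if "?t w \<noteq> 0" for w
  proof -
    have w: "w \<in> words n d" using schur_words_support[OF t] that by blast
    then have "csym witness w \<noteq> 0" using that csym_rsym_witness by simp
    then obtain \<sigma> where s: "\<sigma> \<in> cols" "witness (permute_list \<sigma> w) \<noteq> 0"
      unfolding csym_def by (metis (no_types, lifting) mult_zero_right sum.neutral)
    then have "int lam1 \<le> weight n (permute_list \<sigma> w)" by (intro witness_weight)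
    also have "\<dots> = weight n w" using s w by (intro weight_permute) (simp add: words_length cols_permutes)
    finally show ?thesis using schur_words_weight_bounds(2)[OF t that] by simp
  qed
  ultimately show ?thesis by blast
qed

end

section \<open>Dimensions of direct sums\<close>

lemma (in vector_space) independent_Un:
  assumes ind: "independent A" "independent B" and fin: "finite A" "finite B"
    and disj: "span A \<inter> span B = {0}"
  shows "independent (A \<union> B)" "A \<inter> B = {}"
proof -
  show AB: "A \<inter> B = {}"
  proof (rule ccontr)
    assume "A \<inter> B \<noteq> {}"
    then obtain x where x: "x \<in> A" "x \<in> B" by blast
    then have "x \<in> span A \<inter> span B" by (simp add: span_base)
    then have "x = 0" using disj by blast
    then show False using x(1) ind(1) dependent_zero by blast
  qed
  show "independent (A \<union> B)"
  proof
    assume "dependent (A \<union> B)"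
    then obtain u where u: "\<exists>v\<in>A \<union> B. u v \<noteq> 0" "(\<Sum>v\<in>A \<union> B. u v *s v) = 0"
      using fin by (auto simp: dependent_finite)
    have s: "(\<Sum>v\<in>A. u v *s v) = - (\<Sum>v\<in>B. u v *s v)"
      using u(2) AB fin by (simp add: sum.union_disjoint eq_neg_iff_add_eq_0)
    moreover have "(\<Sum>v\<in>A. u v *s v) \<in> span A" "(\<Sum>v\<in>B. u v *s v) \<in> span B"
      by (rule span_sum, rule span_scale, rule span_base, assumption)+
    ultimately have "(\<Sum>v\<in>A. u v *s v) \<in> span A \<inter> span B" by (simp add: span_neg)
    then have "(\<Sum>v\<in>A. u v *s v) = 0" "(\<Sum>v\<in>B. u v *s v) = 0" using disj s by auto
    then have "\<forall>v\<in>A. u v = 0" "\<forall>v\<in>B. u v = 0" using ind fin by (auto simp: dependent_finite)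
    then show False using u(1) by blast
  qed
qed

lemma (in vector_space) dim_direct_sum:
  assumes sub: "subspace A" "subspace B" and fin: "finite T" "A \<subseteq> span T" "B \<subseteq> span T"
    and int: "A \<inter> B = {0}" and C: "C = {a + b | a b. a \<in> A \<and> b \<in> B}"
  shows "dim C = dim A + dim B"
proof -
  obtain X where X: "X \<subseteq> A" "independent X" "A \<subseteq> span X" "card X = dim A" using basis_exists[of A] by metis
  obtain Y where Y: "Y \<subseteq> B" "independent Y" "B \<subseteq> span Y" "card Y = dim B" using basis_exists[of B] by metis
  have sp: "span X = A" "span Y = B"
    using span_subspace[OF X(1,3) sub(1)] span_subspace[OF Y(1,3) sub(2)] .
  have f: "finite X" "finite Y"
    using independent_span_bound[OF fin(1) X(2) order_trans[OF X(1) fin(2)]]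
      independent_span_bound[OF fin(1) Y(2) order_trans[OF Y(1) fin(3)]] by simp_all
  have "independent (X \<union> Y)" "X \<inter> Y = {}"
    using independent_Un[OF X(2) Y(2) f] sp int by auto
  moreover have "span (X \<union> Y) = C" unfolding span_Un sp C ..
  ultimately show ?thesis
    using f X(4) Y(4) by (metis card_Un_disjoint dim_span_eq_card_independent)
qed

lemma cfun_dim_image:
  fixes f :: "('x \<Rightarrow> complex) \<Rightarrow> ('y \<Rightarrow> complex)"
  assumes add: "\<And>x y. f (x + y) = f x + f y" and scale: "\<And>c x. f (fscale c x) = fscale c (f x)"
    and inj: "inj_on f S" and S: "cfun.subspace S"
  shows "cfun.dim (f ` S) = cfun.dim S"
proof -
  have lin: "Vector_Spaces.linear fscale fscale f"
    using add scale by (simp add: Vector_Spaces.linear_iff cfun.vector_space_axioms)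
  interpret lf: Vector_Spaces.linear fscale fscale f by (fact lin)
  obtain B where B: "B \<subseteq> S" "cfun.independent B" "S \<subseteq> cfun.span B" "card B = cfun.dim S"
    using cfun.basis_exists[of S] by metis
  have sp: "cfun.span B = S" using cfun.span_subspace[OF B(1,3) S] .
  have "cfun.independent (f ` B)"
    using lf.independent_injective_image[OF B(2)] inj sp by simp
  moreover have "cfun.span (f ` B) = f ` S" using lf.span_image[of B] sp by simp
  moreover have "card (f ` B) = card B" using inj_on_subset[OF inj B(1)] by (rule card_image)
  ultimately show ?thesis using B(4) by (metis cfun.dim_span_eq_card_independent)
qed

section \<open>The kernel of the raising operators\<close>

context tableau
begin

text \<open>
  The three properties of \<open>V\<^sub>\<lambda>\<close> used by the Casimir argument; unlike membership in \<open>V\<^sub>\<lambda>\<close> they visibly pass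
  to the images under derivations.
\<close>

definition schur_relations :: "(nat list \<Rightarrow> complex) \<Rightarrow> bool" where
  "schur_relations t \<longleftrightarrow>
    (\<forall>w\<in>words n d. \<forall>i<d. \<forall>j<d. i \<noteq> j \<longrightarrow> (\<Sum>x<n. t (w[i := x, j := n - 1 - x])) = 0) \<and>
    (\<forall>w\<in>words n d. \<forall>p<d. \<forall>q<d. p \<noteq> q \<longrightarrow> col p = col q \<longrightarrow>
       t (permute_list (Transposition.transpose p q) w) = - t w) \<and>
    (\<forall>w\<in>words n d. swap_sum d t w = of_int content * t w)"

lemma schur_words_relations: "t \<in> schur_words \<Longrightarrow> schur_relations t"
proof -
  assume t: "t \<in> schur_words"
  then obtain c where c: "t = csym (rsym c)" by (auto simp: schur_words_def)
  show ?thesis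
    unfolding schur_relations_def
  proof (intro conjI ballI allI impI)
    fix w i j assume "w \<in> words n d" "i < d" "j < d" "i \<noteq> j"
    then show "(\<Sum>x<n. t (w[i := x, j := n - 1 - x])) = 0"
      using schur_words_traceless[OF t] by (simp add: traceless_words_def)
  next
    fix w p q assume "w \<in> words n d" "p < d" "q < d" "p \<noteq> q" "col p = col q"
    then show "t (permute_list (Transposition.transpose p q) w) = - t w"
      unfolding c by (intro csym_swap) (auto simp: words_length)
  next
    fix w assume "w \<in> words n d"
    then show "swap_sum d t w = of_int content * t w"
      unfolding c by (intro swap_sum_young) (simp add: words_length)
  qed
qed

lemma schur_relations_distinct:
  assumes t: "schur_relations t" and w: "w \<in> words n d" "t w \<noteq> 0"
  shows "column_distinct w"
  unfolding column_distinct_def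
proof (intro allI inj_onI)
  fix c p q assume pq: "p \<in> column c" "q \<in> column c" "w ! p = w ! q"
  show "p = q"
  proof (rule ccontr)
    assume "p \<noteq> q"
    then have "t (permute_list (Transposition.transpose p q) w) = - t w"
      using t pq w by (auto simp: schur_relations_def)
    moreover have "permute_list (Transposition.transpose p q) w = w"
      using pq w words_length[OF w(1)] by (simp add: permute_list_transpose) (metis list_update_id)
    ultimately show False using w(2) by simp
  qed
qed

lemma schur_relations_derivation:
  assumes t: "schur_relations t" and uv: "u < n" "v < n"
  shows "schur_relations (derivation n (skew n u v) t)"
  unfolding schur_relations_def
proof (intro conjI ballI allI impI)
  fix w i j assume "w \<in> words n d" "i < d" "j < d" "i \<noteq> j"
  then show "(\<Sum>x<n. derivation n (skew n u v) t (w[i := x, j := n - 1 - x])) = 0"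
    using t uv by (intro derivation_traceless skew_antisym') (auto simp: schur_relations_def)
next
  fix w p q assume w: "w \<in> words n d" and pq: "p < d" "q < d" "p \<noteq> q" "col p = col q"
  have "derivation n (skew n u v) t (permute_list (Transposition.transpose p q) w) =
      derivation n (skew n u v) (act (Transposition.transpose p q) t) w"
    using w pq by (intro derivation_permute) (simp add: words_length transpose_permutes)
  also have "\<dots> = derivation n (skew n u v) (\<lambda>x. - 1 * t x) w"
    using t w pq by (intro derivation_cong[OF _ w]) (simp add: act_def schur_relations_def)
  also have "\<dots> = - derivation n (skew n u v) t w"
    by (simp only: derivation_scale) simp
  finally show "derivation n (skew n u v) t (permute_list (Transposition.transpose p q) w) =
      - derivation n (skew n u v) t w" .
next
  fix w assume w: "w \<in> words n d"
  let ?D = "derivation n (skew n u v)" and ?t = Transposition.transpose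
  have "swap_sum d (?D t) w = (\<Sum>p<d. \<Sum>q<d. ?D (\<lambda>x. if p = q then 0 else t (permute_list (?t p q) x)) w)"
    unfolding swap_sum_def
  proof (intro sum.cong refl)
    fix p q assume pq: "p \<in> {..<d}" "q \<in> {..<d}"
    have z: "?D (\<lambda>x. 0) w = 0" using derivation_scale[of n _ 0] by simp
    have "?D t (permute_list (?t p q) w) = ?D (act (?t p q) t) w"
      using w pq by (intro derivation_permute) (simp add: words_length transpose_permutes)
    then show "(if p = q then 0 else ?D t (permute_list (?t p q) w)) =
       ?D (\<lambda>x. if p = q then 0 else t (permute_list (?t p q) x)) w"
      using z by (simp add: act_def[abs_def])
  qed
  also have "\<dots> = ?D (swap_sum d t) w"
    unfolding swap_sum_def derivation_sum ..
  also have "\<dots> = ?D (\<lambda>x. of_int content * t x) w"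
    using t by (intro derivation_cong[OF _ w]) (simp add: schur_relations_def)
  also have "\<dots> = of_int content * ?D t w" by (rule derivation_scale)
  finally show "swap_sum d (?D t) w = of_int content * ?D t w" .
qed

text \<open>
  Induction on the sum of the letters of \<open>w\<close>.  If an operator \<open>skew n u v\<close> with inner letters \<open>u, v\<close> gives a
  tensor with a word of the same weight and smaller sum in its support, that tensor satisfies the assumptions again,
  as these operators normalize the Lie algebra of the unipotent radical.  Otherwise every raising operator vanishes
  at the words needed by \<open>casimir_at_word\<close>.
\<close>

lemma raising_kernel_top:
  assumes "schur_relations t" and "\<And>y w. 1 \<le> y \<Longrightarrow> y < n - 1 \<Longrightarrow> w \<in> words n d \<Longrightarrow> derivation n (skew n 0 y) t w = 0"
    and "w \<in> words n d" "t w \<noteq> 0"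
  shows "weight n w = int lam1"
  using assms
proof (induction "sum_list w" arbitrary: t w rule: less_induct)
  case less
  note t = less.prems(1) and raise = less.prems(2) and w = less.prems(3) and nz = less.prems(4)
  have len: "length w = d" using w by (rule words_length)
  show ?case
  proof (cases "\<exists>u v w'. 1 \<le> u \<and> u < n - 1 \<and> 1 \<le> v \<and> v < n - 1 \<and> w' \<in> words n d \<and> weight n w' = weight n w \<and>
      sum_list w' < sum_list w \<and> derivation n (skew n u v) t w' \<noteq> 0")
    case True
    then obtain u v w' where u: "1 \<le> u" "u < n - 1" and v: "1 \<le> v" "v < n - 1" and w': "w' \<in> words n d"
      "weight n w' = weight n w" "sum_list w' < sum_list w" "derivation n (skew n u v) t w' \<noteq> 0" by blast
    have "derivation n (skew n 0 y) (derivation n (skew n u v) t) x = 0"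
      if y: "1 \<le> y" "y < n - 1" and x: "x \<in> words n d" for y x
    proof -
      have "derivation n (skew n u v) (derivation n (skew n 0 y) t) x = derivation n (skew n u v) (\<lambda>u. 0 * t u) x"
        using raise[OF y] by (intro derivation_cong[OF _ x]) simp
      then have z: "derivation n (skew n u v) (derivation n (skew n 0 y) t) x = 0"
        by (simp only: derivation_scale) simp
      have "derivation n (skew n 0 y) (derivation n (skew n u v) t) x =
          derivation n (\<lambda>a b. of_bool (y = u) * skew n 0 v a b - of_bool (y = n - 1 - v) * skew n 0 (n - 1 - u) a b) t x"
        using derivation_commutator[of n "skew n 0 y" "skew n u v" t x] z
          derivation_cong_matrix[OF skew_commutator[OF n3 y u v] x, where t = t] by simp
      also have "\<dots> = of_bool (y = u) * derivation n (skew n 0 v) t x - of_bool (y = n - 1 - v) * derivation n (skew n 0 (n - 1 - u)) t x"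
        unfolding derivation_matrix_diff derivation_matrix_scale ..
      also have "\<dots> = 0" using raise[of v x] raise[of "n - 1 - u" x] u v x by simp
      finally show ?thesis .
    qed
    moreover have "schur_relations (derivation n (skew n u v) t)" using t u v by (intro schur_relations_derivation) auto
    ultimately have "weight n w' = int lam1" using less.hyps[OF w'(3)] w' by blast
    then show ?thesis using w'(2) by simp
  next
    case False
    \<comment> \<open>A raising operator is zero, or kills \<open>t\<close> by assumption, or involves inner letters only; in the last case it
    vanishes at \<open>w[i := z]\<close>, a word of the same weight with a smaller sum of letters.\<close>
    have up: "derivation n (skew n x y) t (w[i := z]) = 0"
      if xy: "x < y" "y < n" and i: "i < d" and z: "w ! i = y \<and> z = x \<or> w ! i = n - 1 - x \<and> z = n - 1 - y" for x y i z
    proof -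
      have zn: "z < n" using z xy by auto
      have wz: "w[i := z] \<in> words n d" using w zn by (rule words_update)
      have zi: "z < w ! i" using z xy by auto
      consider "x = 0" "y = n - 1" | "x = 0" "y < n - 1" | "x \<ge> 1" "y = n - 1" | "x \<ge> 1" "y < n - 1" using xy by linarith
      then show ?thesis
      proof cases
        case 1
        then have e: "skew n x y a b = 0 * skew n x y a b" for a b by (simp add: skew_def)
        have "derivation n (skew n x y) t (w[i := z]) = derivation n (\<lambda>a b. 0 * skew n x y a b) t (w[i := z])"
          by (rule derivation_cong_matrix[OF _ wz]) (rule e)
        also have "\<dots> = 0 * derivation n (skew n x y) t (w[i := z])" by (rule derivation_matrix_scale)
        finally show ?thesis by (simp only: mult_zero_left)
      next
        case 2
        then show ?thesis using raise wz xy by simp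
      next
        case 3
        have e: "skew n x y a b = - 1 * skew n 0 (n - 1 - x) a b" for a b
          using skew_antisym[of x n y a b] xy 3 by simp
        have "derivation n (skew n x y) t (w[i := z]) = derivation n (\<lambda>a b. - 1 * skew n 0 (n - 1 - x) a b) t (w[i := z])"
          by (rule derivation_cong_matrix[OF _ wz]) (rule e)
        also have "\<dots> = - 1 * derivation n (skew n 0 (n - 1 - x)) t (w[i := z])" by (rule derivation_matrix_scale)
        also have "\<dots> = 0" using raise[of "n - 1 - x" "w[i := z]"] wz xy 3 by simp
        finally show ?thesis .
      next
        case 4
        have "letter_weight n (w ! i) = 0" "letter_weight n z = 0"
          using z 4 xy by (force simp: letter_weight_def)+
        then have "weight n (w[i := z]) = weight n w" using i len by (simp add: weight_update)
        moreover have "sum_list (w[i := z]) < sum_list w"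
          using zi i len elem_le_sum_list[of i w] by (simp add: sum_list_update)
        ultimately show ?thesis using False wz xy 4 by (metis le_trans less_imp_le less_trans)
      qed
    qed
    have "swap_sum d t w = of_int (casimir_value n w) * t w"
      unfolding swap_sum_def
    proof (rule casimir_at_word[OF w])
      show "(\<Sum>x<n. t (w[i := x, j := n - 1 - x])) = 0" if "i < d" "j < d" "i \<noteq> j" for i j
        using t w that by (simp add: schur_relations_def)
    qed (use up in blast)+
    moreover have "swap_sum d t w = of_int content * t w" using t w by (simp add: schur_relations_def)
    ultimately have "content = casimir_value n w" using nz by simp
    then show ?thesis using extremal_weight w schur_relations_distinct[OF t w nz] by blast
  qed
qed

end

lemma sum_fun_apply: "(\<Sum>i\<in>I. f i) u = (\<Sum>i\<in>I. f i u)"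
  by (induction I rule: infinite_finite_induct) auto

section \<open>Invariants of the unipotent radical on words\<close>

text \<open>
  The map \<open>G \<otimes> \<dots> \<otimes> G\<close> in coordinates.
\<close>

definition mat_act :: "nat \<Rightarrow> nat \<Rightarrow> (nat \<Rightarrow> nat \<Rightarrow> complex) \<Rightarrow> (nat list \<Rightarrow> complex) \<Rightarrow> nat list \<Rightarrow> complex" where
  "mat_act n d G t = (\<lambda>w. if w \<in> words n d then \<Sum>u\<in>words n d. (\<Prod>i<d. G (w ! i) (u ! i)) * t u else 0)"

text \<open>
  The matrix of \<open>exp (s X)\<close> for \<open>X = skew n 0 y\<close> with \<open>0 < y < n - 1\<close>; the square of \<open>X\<close> is nonzero only if \<open>v\<^sub>y\<close>
  is the anisotropic middle vector.
\<close>

definition eichler :: "nat \<Rightarrow> nat \<Rightarrow> complex \<Rightarrow> nat \<Rightarrow> nat \<Rightarrow> complex" where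
  "eichler n y s a b = of_bool (a = b) + s * skew n 0 y a b - s\<^sup>2 / 2 * of_bool (a = 0 \<and> b = n - 1 \<and> 2 * y = n - 1)"

lemma mat_act_permute:
  assumes s: "\<sigma> permutes {..<d}" and w: "w \<in> words n d"
  shows "mat_act n d G t (permute_list \<sigma> w) = mat_act n d G (act \<sigma> t) w"
proof -
  have len: "length w = d" using w by (rule words_length)
  have "mat_act n d G t (permute_list \<sigma> w) =
      (\<Sum>u\<in>words n d. (\<Prod>i<d. G (w ! \<sigma> i) (permute_list \<sigma> u ! i)) * t (permute_list \<sigma> u))"
    unfolding sum_words_permute[OF s, of "\<lambda>u. (\<Prod>i<d. G (w ! \<sigma> i) (u ! i)) * t u"]
    using w s len by (simp add: mat_act_def permute_list_words permute_list_nth)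
  also have "\<dots> = (\<Sum>u\<in>words n d. (\<Prod>i<d. G (w ! \<sigma> i) (u ! \<sigma> i)) * t (permute_list \<sigma> u))"
    using s by (intro sum.cong refl arg_cong2[where f = "(*)"] prod.cong) (simp add: permute_list_nth words_length)
  also have "\<dots> = (\<Sum>u\<in>words n d. (\<Prod>i<d. G (w ! i) (u ! i)) * t (permute_list \<sigma> u))"
    using prod.permute[OF s, of "\<lambda>i. G (w ! i) (u ! i)" for u] by (simp add: comp_def)
  finally show ?thesis using w by (simp add: mat_act_def act_def)
qed

text \<open>
  Differentiate the invariance under a one-parameter family at the identity.
\<close>

lemma mat_act_derivation:
  assumes w: "w \<in> words n d" and fix_t: "\<And>s. mat_act n d (G s) t w = t w"
    and G0: "\<And>a b. a < n \<Longrightarrow> b < n \<Longrightarrow> G 0 a b = of_bool (a = b)"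
    and der: "\<And>a b. a < n \<Longrightarrow> b < n \<Longrightarrow> ((\<lambda>s. G s a b) has_field_derivative A a b) (at 0)"
  shows "derivation n A t w = 0"
proof -
  have len: "length w = d" using w by (rule words_length)
  have "((\<lambda>s. \<Sum>u\<in>words n d. (\<Prod>i<d. G s (w ! i) (u ! i)) * t u) has_field_derivative
      (\<Sum>u\<in>words n d. (\<Sum>i<d. A (w ! i) (u ! i) * (\<Prod>j\<in>{..<d} - {i}. G 0 (w ! j) (u ! j))) * t u)) (at 0)"
  proof (rule DERIV_sum)
    fix u assume u: "u \<in> words n d"
    have "((\<lambda>s. \<Prod>i<d. G s (w ! i) (u ! i)) has_field_derivative
      (\<Sum>i<d. A (w ! i) (u ! i) * (\<Prod>j\<in>{..<d} - {i}. G 0 (w ! j) (u ! j)))) (at 0)"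
      by (rule has_field_derivative_prod) (use u w in \<open>auto intro: der words_nth\<close>)
    then show "((\<lambda>s. (\<Prod>i<d. G s (w ! i) (u ! i)) * t u) has_field_derivative
      (\<Sum>i<d. A (w ! i) (u ! i) * (\<Prod>j\<in>{..<d} - {i}. G 0 (w ! j) (u ! j))) * t u) (at 0)"
      by (rule DERIV_cmult_right)
  qed
  moreover have "(\<lambda>s. \<Sum>u\<in>words n d. (\<Prod>i<d. G s (w ! i) (u ! i)) * t u) = (\<lambda>s. t w)"
    using fix_t w by (auto simp: mat_act_def fun_eq_iff)
  ultimately have "((\<lambda>s. t w) has_field_derivative
      (\<Sum>u\<in>words n d. (\<Sum>i<d. A (w ! i) (u ! i) * (\<Prod>j\<in>{..<d} - {i}. G 0 (w ! j) (u ! j))) * t u)) (at 0)"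
    by simp
  then have z: "(\<Sum>u\<in>words n d. (\<Sum>i<d. A (w ! i) (u ! i) * (\<Prod>j\<in>{..<d} - {i}. G 0 (w ! j) (u ! j))) * t u) = 0"
    by (rule DERIV_unique) simp
  have "(\<Sum>u\<in>words n d. (\<Sum>i<d. A (w ! i) (u ! i) * (\<Prod>j\<in>{..<d} - {i}. G 0 (w ! j) (u ! j))) * t u) =
      (\<Sum>u\<in>words n d. \<Sum>i<d. if \<forall>p<d. p \<noteq> i \<longrightarrow> u ! p = w ! p then A (w ! i) (u ! i) * t u else 0)"
    unfolding sum_distrib_right
  proof (intro sum.cong refl)
    fix u i assume u: "u \<in> words n d" and i: "i \<in> {..<d}"
    have "(\<Prod>j\<in>{..<d} - {i}. G 0 (w ! j) (u ! j)) = (\<Prod>j\<in>{..<d} - {i}. of_bool (w ! j = u ! j))"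
      using u w by (intro prod.cong refl G0) (auto intro: words_nth)
    also have "\<dots> = of_bool (\<forall>p<d. p \<noteq> i \<longrightarrow> u ! p = w ! p)"
    proof (cases "\<forall>p<d. p \<noteq> i \<longrightarrow> u ! p = w ! p")
      case False
      then obtain p where "p \<in> {..<d} - {i}" "w ! p \<noteq> u ! p" by force
      then have "(\<Prod>j\<in>{..<d} - {i}. of_bool (w ! j = u ! j)) = (0::complex)"
        by (intro prod_zero) (auto intro!: bexI[of _ p])
      then show ?thesis using False by simp
    qed simp
    finally show "A (w ! i) (u ! i) * (\<Prod>j\<in>{..<d} - {i}. G 0 (w ! j) (u ! j)) * t u =
        (if \<forall>p<d. p \<noteq> i \<longrightarrow> u ! p = w ! p then A (w ! i) (u ! i) * t u else 0)" by simp
  qed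
  also have "\<dots> = (\<Sum>i<d. \<Sum>u\<in>words n d. if \<forall>p<d. p \<noteq> i \<longrightarrow> u ! p = w ! p then A (w ! i) (u ! i) * t u else 0)"
    by (rule sum.swap)
  also have "\<dots> = (\<Sum>i<d. \<Sum>b<n. A (w ! i) (w[i := b] ! i) * t (w[i := b]))"
    by (intro sum.cong refl sum_words_line[OF w]) simp
  also have "\<dots> = derivation n A t w"
    unfolding derivation_def site_def len using len by (intro sum.cong refl) simp
  finally show ?thesis using z by simp
qed

lemma eichler_derivative:
  "((\<lambda>s. eichler n y s a b) has_field_derivative skew n 0 y a b) (at 0)"
  unfolding eichler_def by (auto intro!: derivative_eq_intros)

context tableau
begin

text \<open>
  Off the diagonal \<open>G\<close> strictly raises weights, so \<open>t\<close> can only change in weights above \<open>lam1\<close>.  There the image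
  vanishes, because it is still antisymmetric along the columns.
\<close>

lemma mat_act_fixes_top:
  assumes t: "t \<in> schur_words" and top: "\<And>w. t w \<noteq> 0 \<Longrightarrow> weight n w = int lam1"
    and diag: "\<And>a. a < n \<Longrightarrow> G a a = 1"
    and raise: "\<And>a b. a < n \<Longrightarrow> b < n \<Longrightarrow> a \<noteq> b \<Longrightarrow> G a b \<noteq> 0 \<Longrightarrow> letter_weight n b < letter_weight n a"
  shows "mat_act n d G t = t"
proof (rule ext)
  fix w
  show "mat_act n d G t w = t w"
  proof (cases "w \<in> words n d")
    case False
    then show ?thesis using schur_words_support[OF t] by (simp add: mat_act_def)
  next
    case w: True
    have len: "length w = d" using w by (rule words_length)
    \<comment> \<open>A nonzero off-diagonal product of matrix entries raises the weight of some letter and lowers none.\<close>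
    have key: "weight n u < weight n w" if u: "u \<in> words n d" "u \<noteq> w" "(\<Prod>i<d. G (w ! i) (u ! i)) \<noteq> 0" for u
    proof -
      have le: "letter_weight n (u ! i) \<le> letter_weight n (w ! i)" and
        lt: "u ! i \<noteq> w ! i \<Longrightarrow> letter_weight n (u ! i) < letter_weight n (w ! i)" if i: "i < d" for i
      proof -
        have "G (w ! i) (u ! i) \<noteq> 0" using u(3) i by auto
        then show "u ! i \<noteq> w ! i \<Longrightarrow> letter_weight n (u ! i) < letter_weight n (w ! i)"
          using raise[of "w ! i" "u ! i"] words_nth[OF w i] words_nth[OF u(1) i] by metis
        then show "letter_weight n (u ! i) \<le> letter_weight n (w ! i)" by fastforce
      qed
      obtain i where i: "i < d" "u ! i \<noteq> w ! i"
        using u w nth_equalityI[of u w] by (auto simp: words_length)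
      show ?thesis
        unfolding weight_def len words_length[OF u(1)]
        by (rule sum_strict_mono_ex1) (use le lt i in auto)
    qed
    show ?thesis
    proof (cases "weight n w = int lam1")
      case True
      have "(\<Sum>u\<in>words n d. (\<Prod>i<d. G (w ! i) (u ! i)) * t u) = (\<Sum>u\<in>words n d. if u = w then t w else 0)"
      proof (intro sum.cong refl)
        fix u assume u: "u \<in> words n d"
        show "(\<Prod>i<d. G (w ! i) (u ! i)) * t u = (if u = w then t w else 0)"
        proof (cases "u = w")
          case eq: True
          have "(\<Prod>i<d. G (w ! i) (w ! i)) = 1" using diag words_nth[OF w] by (intro prod.neutral) auto
          then show ?thesis using eq by simp
        next
          case ne: False
          have "(\<Prod>i<d. G (w ! i) (u ! i)) * t u = 0"
          proof (rule ccontr)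
            assume "(\<Prod>i<d. G (w ! i) (u ! i)) * t u \<noteq> 0"
            then have "(\<Prod>i<d. G (w ! i) (u ! i)) \<noteq> 0" "t u \<noteq> 0" by (metis mult_eq_0_iff)+
            then show False using key[OF u ne] top[of u] True by simp
          qed
          then show ?thesis using ne by simp
        qed
      qed
      then show ?thesis using w finite_words by (simp add: mat_act_def)
    next
      case False
      then have tw: "t w = 0" using top by blast
      obtain c where c: "t = csym (rsym c)" using t by (auto simp: schur_words_def)
      have "mat_act n d G t w = 0"
      proof (rule ccontr)
        assume nz: "mat_act n d G t w \<noteq> 0"
        have "column_distinct w"
          unfolding column_distinct_def
        proof (intro allI inj_onI)
          fix c' p q assume pq: "p \<in> column c'" "q \<in> column c'" "w ! p = w ! q"
          show "p = q"
          proof (rule ccontr)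
            assume "p \<noteq> q"
            have "mat_act n d G t (permute_list (Transposition.transpose p q) w) =
               mat_act n d G (act (Transposition.transpose p q) t) w"
              using pq w by (intro mat_act_permute) (auto simp: transpose_permutes)
            also have "\<dots> = - mat_act n d G t w"
            proof -
              have "act (Transposition.transpose p q) t u = - t u" if "u \<in> words n d" for u
                unfolding act_def c using pq \<open>p \<noteq> q\<close> words_length[OF that] by (intro csym_swap) auto
              then have "(\<Sum>u\<in>words n d. (\<Prod>i<d. G (w ! i) (u ! i)) * act (Transposition.transpose p q) t u) =
                 (\<Sum>u\<in>words n d. - ((\<Prod>i<d. G (w ! i) (u ! i)) * t u))"
                by (intro sum.cong refl) simp
              then show ?thesis using w by (simp add: mat_act_def sum_negf)
            qed
            finally have "mat_act n d G t (permute_list (Transposition.transpose p q) w) = - mat_act n d G t w" .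
            moreover have "permute_list (Transposition.transpose p q) w = w"
              using pq len by (simp add: permute_list_transpose) (metis list_update_id)
            ultimately show False using nz by simp
          qed
        qed
        then have "weight n w \<le> int lam1" using weight_bounds len by blast
        moreover have "\<exists>u\<in>words n d. (\<Prod>i<d. G (w ! i) (u ! i)) * t u \<noteq> 0"
          using nz w by (auto simp: mat_act_def dest: sum.not_neutral_contains_not_neutral)
        then obtain u where u: "u \<in> words n d" "(\<Prod>i<d. G (w ! i) (u ! i)) \<noteq> 0" "t u \<noteq> 0" by auto
        then have "int lam1 < weight n w" using key[of u] top[of u] tw by metis
        ultimately show False by simp
      qed
      then show ?thesis using tw by simp
    qed
  qed
qed

section \<open>The filtration by weight and its graded pieces\<close>

definition level :: "int \<Rightarrow> (nat list \<Rightarrow> complex) set" where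
  "level r = {t \<in> schur_words. \<forall>w. t w \<noteq> 0 \<longrightarrow> r \<le> weight n w}"

text \<open>
  The operators \<open>eichler n y s\<close> come from elements of the unipotent radical, and their derivatives at \<open>s = 0\<close> span
  its Lie algebra.
\<close>

lemma level_top_iff_invariant:
  assumes t: "t \<in> schur_words"
  shows "t \<in> level (int lam1) \<longleftrightarrow> (\<forall>y s. 1 \<le> y \<and> y < n - 1 \<longrightarrow> mat_act n d (eichler n y s) t = t)"
proof
  assume l: "t \<in> level (int lam1)"
  have top: "weight n w = int lam1" if "t w \<noteq> 0" for w
    using l schur_words_weight_bounds(2)[OF t that] that by (auto simp: level_def)
  show "\<forall>y s. 1 \<le> y \<and> y < n - 1 \<longrightarrow> mat_act n d (eichler n y s) t = t"
  proof (intro allI impI)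
    fix y s assume y: "1 \<le> y \<and> y < n - 1"
    show "mat_act n d (eichler n y s) t = t"
    proof (rule mat_act_fixes_top[OF t top])
      show "eichler n y s a a = 1" for a
        using y n3 by (auto simp: eichler_def skew_def)
      show "letter_weight n b < letter_weight n a" if ab: "a < n" "b < n" "a \<noteq> b" "eichler n y s a b \<noteq> 0" for a b
      proof -
        have sk: "skew n 0 y a b = 0" if "\<not> (a = 0 \<and> b = y)" "\<not> (a = n - 1 - y \<and> b = n - 1)"
        proof -
          have "(a = 0 \<and> b = y) = False" "(a = n - 1 - y \<and> b = n - 1) = False" using that by blast+
          then show ?thesis unfolding skew_def diff_zero by (simp only: of_bool_eq diff_self)
        qed
        have "eichler n y s a b = 0" if "\<not> (a = 0 \<and> b = y)" "\<not> (a = n - 1 - y \<and> b = n - 1)" "\<not> (a = 0 \<and> b = n - 1)"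
        proof -
          have "(a = 0 \<and> b = n - 1 \<and> 2 * y = n - 1) = False" "(a = b) = False" "skew n 0 y a b = 0"
            using that \<open>a \<noteq> b\<close> sk by blast+
          then show ?thesis unfolding eichler_def by (simp only: of_bool_eq mult_zero_right diff_self add_0)
        qed
        then consider "a = 0 \<and> b = y" | "a = n - 1 - y \<and> b = n - 1" | "a = 0 \<and> b = n - 1" using ab(4) by blast
        moreover have "n - 1 - y \<noteq> 0" "n - 1 - y \<noteq> n - 1" "y \<noteq> 0" "y \<noteq> n - 1" "n - 1 \<noteq> 0" using y n3 by auto
        ultimately show ?thesis by cases (simp_all add: letter_weight_def)
      qed
    qed
  qed
next
  assume inv: "\<forall>y s. 1 \<le> y \<and> y < n - 1 \<longrightarrow> mat_act n d (eichler n y s) t = t"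
  have "weight n w = int lam1" if nz: "t w \<noteq> 0" for w
  proof (rule raising_kernel_top[OF schur_words_relations[OF t]])
    show "w \<in> words n d" using schur_words_support[OF t] nz by blast
    show "derivation n (skew n 0 y) t u = 0" if "1 \<le> y" "y < n - 1" "u \<in> words n d" for y u
    proof (rule mat_act_derivation[OF that(3)])
      show "mat_act n d (eichler n y s) t u = t u" for s using inv that by simp
      show "eichler n y 0 a b = of_bool (a = b)" for a b by (simp add: eichler_def)
    qed (rule eichler_derivative)
  qed (rule nz)
  then show "t \<in> level (int lam1)" using t by (simp add: level_def)
qed

lemma level_subset: "level r \<subseteq> schur_words" by (auto simp: level_def)

lemma level_anti: "r \<le> r' \<Longrightarrow> level r' \<subseteq> level r" by (fastforce simp: level_def)

lemma level_subspace: "cfun.subspace (level r)"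
proof -
  have "x + y \<in> level r" if "x \<in> level r" "y \<in> level r" for x y
  proof -
    have "x w \<noteq> 0 \<or> y w \<noteq> 0" if "(x + y) w \<noteq> 0" for w using that by auto
    then show ?thesis using that cfun.subspace_add[OF schur_words_subspace, of x y]
      unfolding level_def by blast
  qed
  moreover have "fscale c x \<in> level r" if "x \<in> level r" for c x
    using that cfun.subspace_scale[OF schur_words_subspace, of x c] by (auto simp: level_def fscale_def)
  moreover have "0 \<in> level r" using cfun.subspace_0[OF schur_words_subspace] by (simp add: level_def)
  ultimately show ?thesis by (simp add: cfun.subspace_def)
qed

lemma level_zero: "int lam1 < r \<Longrightarrow> level r = {0}"
proof -
  assume r: "int lam1 < r"
  have "t = 0" if "t \<in> level r" for t
  proof (rule ext)
    fix w
    have "t \<in> schur_words" "t w \<noteq> 0 \<Longrightarrow> r \<le> weight n w" using that by (auto simp: level_def)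
    then have "t w = 0" using r schur_words_weight_bounds(2)[of t w] by force
    then show "t w = 0 w" by simp
  qed
  then show ?thesis using cfun.subspace_0[OF level_subspace] by blast
qed

lemma level_full: "r \<le> - int lam1 \<Longrightarrow> level r = schur_words"
proof -
  assume r: "r \<le> - int lam1"
  have "t \<in> level r" if t: "t \<in> schur_words" for t
  proof -
    have "r \<le> weight n w" if "t w \<noteq> 0" for w
      using schur_words_weight_bounds(1)[OF t that] r by simp
    then show ?thesis using t by (simp add: level_def)
  qed
  then show ?thesis using level_subset by blast
qed

lemma level_top_nonzero: "level (int lam1) \<noteq> {0}"
proof -
  obtain t where t: "t \<in> schur_words" "t \<noteq> 0" "\<forall>w. t w \<noteq> 0 \<longrightarrow> weight n w = int lam1"
    using schur_words_top by blast
  then have "t \<in> level (int lam1)" by (simp add: level_def)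
  then show ?thesis using t(2) by blast
qed

lemma flip_flip:
  assumes "\<And>w. w \<notin> words n d \<Longrightarrow> t w = 0" shows "flip n d (flip n d t) = t"
proof (rule ext)
  fix w show "flip n d (flip n d t) w = t w"
  proof (cases "w \<in> words n d")
    case True
    have e: "map (\<lambda>x. n - 1 - x) (map (\<lambda>x. n - 1 - x) w) = w"
    proof (rule nth_equalityI)
      fix i assume "i < length (map (\<lambda>x. n - 1 - x) (map (\<lambda>x. n - 1 - x) w))"
      then show "map (\<lambda>x. n - 1 - x) (map (\<lambda>x. n - 1 - x) w) ! i = w ! i"
        using words_nth[OF True, of i] words_length[OF True] by simp
    qed simp
    show ?thesis unfolding flip_def by (simp only: True flip_word[OF True] e if_True)
  qed (simp add: flip_def assms)
qed

lemma flip_weight: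
  assumes t: "t \<in> schur_words" "\<And>w. t w \<noteq> 0 \<Longrightarrow> weight n w = r" and nz: "flip n d t w \<noteq> 0"
  shows "weight n w = - r"
proof -
  have w: "w \<in> words n d"
    by (rule ccontr) (use nz in \<open>simp add: flip_def\<close>)
  have "t (map (\<lambda>x. n - 1 - x) w) \<noteq> 0"
    using nz unfolding flip_def by (simp only: w if_True not_False_eq_True)
  then have "weight n (map (\<lambda>x. n - 1 - x) w) = r" using t(2) by blast
  then show ?thesis using weight_flip[OF _ w] n3 by simp
qed

text \<open>
  The flip of a vector of weight \<open>lam1\<close> has weight \<open>-lam1\<close>.
\<close>

lemma level_bottom_strict: "level (- int lam1 + 1) \<noteq> level (- int lam1)"
proof -
  obtain t where t: "t \<in> schur_words" "t \<noteq> 0" "\<And>w. t w \<noteq> 0 \<Longrightarrow> weight n w = int lam1"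
    using schur_words_top by blast
  have f: "flip n d t \<in> schur_words" using t(1) by (rule schur_words_flip)
  have "flip n d t \<noteq> 0"
  proof
    assume z: "flip n d t = 0"
    have "flip n d 0 = (0 :: nat list \<Rightarrow> complex)" by (simp add: flip_def fun_eq_iff)
    then have "flip n d (flip n d t) = 0" by (simp add: z)
    moreover have "flip n d (flip n d t) = t" using schur_words_support[OF t(1)] by (rule flip_flip)
    ultimately show False using t(2) by simp
  qed
  then obtain w where w: "flip n d t w \<noteq> 0" by (auto simp: fun_eq_iff)
  then have "weight n w = - int lam1" using flip_weight[OF t(1,3)] by blast
  then have "flip n d t \<notin> level (- int lam1 + 1)" using w by (auto simp: level_def)
  then show ?thesis using f level_full[of "- int lam1"] by blast
qed

definition weight_space :: "int \<Rightarrow> (nat list \<Rightarrow> complex) set" where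
  "weight_space r = {t \<in> schur_words. \<forall>w. t w \<noteq> 0 \<longrightarrow> weight n w = r}"

lemma weight_space_subspace: "cfun.subspace (weight_space r)"
proof -
  have "x + y \<in> weight_space r" if "x \<in> weight_space r" "y \<in> weight_space r" for x y
  proof -
    have "x w \<noteq> 0 \<or> y w \<noteq> 0" if "(x + y) w \<noteq> 0" for w using that by auto
    then show ?thesis using that cfun.subspace_add[OF schur_words_subspace, of x y]
      unfolding weight_space_def by blast
  qed
  moreover have "fscale c x \<in> weight_space r" if "x \<in> weight_space r" for c x
    using that cfun.subspace_scale[OF schur_words_subspace, of x c] by (auto simp: weight_space_def fscale_def)
  moreover have "0 \<in> weight_space r" using cfun.subspace_0[OF schur_words_subspace] by (simp add: weight_space_def)
  ultimately show ?thesis by (simp add: cfun.subspace_def)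
qed

lemma schur_words_finite_span: "\<exists>T. finite T \<and> schur_words \<subseteq> cfun.span T"
proof (intro exI conjI subsetI)
  let ?e = "\<lambda>w u. of_bool (u = w) :: complex"
  show "finite (?e ` words n d)" by (simp add: finite_words)
  fix t assume t: "t \<in> schur_words"
  have "t = (\<Sum>w\<in>words n d. fscale (t w) (?e w))"
  proof (rule ext)
    fix u
    have "(\<Sum>w\<in>words n d. fscale (t w) (?e w)) u = (\<Sum>w\<in>words n d. t w * of_bool (u = w))"
      by (simp add: sum_fun_apply fscale_def)
    also have "\<dots> = (\<Sum>w\<in>words n d. if w = u then t u else 0)" by (intro sum.cong) auto
    also have "\<dots> = t u" using schur_words_support[OF t] finite_words by auto
    finally show "t u = (\<Sum>w\<in>words n d. fscale (t w) (?e w)) u" by simp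
  qed
  also have "\<dots> \<in> cfun.span (?e ` words n d)"
    by (intro cfun.span_sum cfun.span_scale cfun.span_base) auto
  finally show "t \<in> cfun.span (?e ` words n d)" .
qed

lemma dim_level: "cfun.dim (level r) = cfun.dim (weight_space r) + cfun.dim (level (r + 1))"
proof -
  obtain T where T: "finite T" "schur_words \<subseteq> cfun.span T" using schur_words_finite_span by blast
  show ?thesis
  proof (rule cfun.dim_direct_sum[OF weight_space_subspace level_subspace T(1)])
    show "weight_space r \<subseteq> cfun.span T" "level (r + 1) \<subseteq> cfun.span T"
      using T(2) by (auto simp: weight_space_def level_def)
    show "weight_space r \<inter> level (r + 1) = {0}"
    proof -
      have "t = 0" if "t \<in> weight_space r" "t \<in> level (r + 1)" for t
        using that by (force simp: weight_space_def level_def fun_eq_iff)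
      then show ?thesis
        using cfun.subspace_0[OF weight_space_subspace] cfun.subspace_0[OF level_subspace] by blast
    qed
    show "level r = {a + b | a b. a \<in> weight_space r \<and> b \<in> level (r + 1)}"
    proof (intro equalityI subsetI)
      fix t assume t: "t \<in> level r"
      have w: "weight_part n r t \<in> schur_words" using t by (intro schur_words_weight_part) (simp add: level_def)
      then have d: "t - weight_part n r t \<in> schur_words"
        using t cfun.subspace_diff[OF schur_words_subspace] by (simp add: level_def)
      have "weight_part n r t \<in> weight_space r"
        using w by (auto simp: weight_space_def weight_part_def)
      moreover have "t - weight_part n r t \<in> level (r + 1)"
        using d t by (force simp: level_def weight_part_def)
      ultimately show "t \<in> {a + b | a b. a \<in> weight_space r \<and> b \<in> level (r + 1)}"
        by (intro CollectI exI[of _ "weight_part n r t"] exI[of _ "t - weight_part n r t"]) auto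
    next
      fix t assume "t \<in> {a + b | a b. a \<in> weight_space r \<and> b \<in> level (r + 1)}"
      then obtain a b where ab: "t = a + b" "a \<in> weight_space r" "b \<in> level (r + 1)" by blast
      then have "a \<in> level r" "b \<in> level r" using level_anti[of r "r + 1"] by (auto simp: weight_space_def level_def)
      then show "t \<in> level r" unfolding ab(1) by (rule cfun.subspace_add[OF level_subspace])
    qed
  qed
qed

lemma dim_weight_space_neg: "cfun.dim (weight_space (- r)) = cfun.dim (weight_space r)"
proof -
  have sub: "flip n d ` weight_space r \<subseteq> weight_space (- r)" for r
    using schur_words_flip flip_weight by (auto simp: weight_space_def)
  have inv: "flip n d (flip n d t) = t" if "t \<in> weight_space r" for t r
    using that schur_words_support by (intro flip_flip) (auto simp: weight_space_def)
  have "flip n d ` weight_space r = weight_space (- r)"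
  proof
    show "weight_space (- r) \<subseteq> flip n d ` weight_space r"
    proof
      fix t assume t: "t \<in> weight_space (- r)"
      then have "flip n d t \<in> weight_space r" using sub[of "- r"] by auto
      then show "t \<in> flip n d ` weight_space r" using inv[OF t] by (metis imageI)
    qed
  qed (rule sub)
  moreover have "cfun.dim (flip n d ` weight_space r) = cfun.dim (weight_space r)"
  proof (rule cfun_dim_image[OF _ _ _ weight_space_subspace])
    show "inj_on (flip n d) (weight_space r)" by (rule inj_on_inverseI[of _ "flip n d"]) (rule inv)
  qed (auto simp: flip_def fscale_def fun_eq_iff)
  ultimately show ?thesis by simp
qed

end

section \<open>Coordinates on tensor powers\<close>

lemma nths_eq_map: "nths xs A = map ((!) xs) (filter (\<lambda>p. p \<in> A) [0..<length xs])"
proof -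
  have "zip xs [0..<length xs] = map (\<lambda>p. (xs ! p, p)) [0..<length xs]"
    by (rule nth_equalityI) auto
  then show ?thesis by (simp add: nths_def filter_map comp_def)
qed

lemma sum_words_update:
  fixes f :: "nat list \<Rightarrow> complex"
  assumes "i < d"
  shows "(\<Sum>w\<in>words n d. \<Sum>x<n. f (w[i := x])) = of_nat n * (\<Sum>w\<in>words n d. f w)"
proof -
  have "(\<Sum>w\<in>words n d. \<Sum>x<n. f (w[i := x])) = (\<Sum>z\<in>words n d \<times> {..<n}. f ((fst z)[i := snd z]))"
    by (simp add: sum.cartesian_product case_prod_unfold)
  also have "\<dots> = (\<Sum>z\<in>words n d \<times> {..<n}. f (fst z))"
    by (rule sum.reindex_bij_witness[of _ "\<lambda>z. ((fst z)[i := snd z], fst z ! i)" "\<lambda>z. ((fst z)[i := snd z], fst z ! i)"])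
      (use assms in \<open>auto simp: words_update words_nth words_length\<close>)
  also have "\<dots> = (\<Sum>w\<in>words n d. \<Sum>x<n. f w)"
    by (simp add: sum.cartesian_product')
  finally show ?thesis by (simp add: sum_distrib_left)
qed

text \<open>
  A quadratic space with coordinates \<open>co\<close> for a basis \<open>bas\<close> in which the Gram matrix is the antidiagonal unit
  matrix.
\<close>

locale witt_space =
  fixes V :: "'v quad_space" and n :: nat and co :: "'v \<Rightarrow> nat \<Rightarrow> complex" and bas :: "nat \<Rightarrow> 'v"
  assumes bas_carr: "x < n \<Longrightarrow> bas x \<in> carr V"
    and add_carr: "v \<in> carr V \<Longrightarrow> w \<in> carr V \<Longrightarrow> vadd V v w \<in> carr V"
    and smul_carr: "v \<in> carr V \<Longrightarrow> smul V c v \<in> carr V"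
    and co_add: "v \<in> carr V \<Longrightarrow> w \<in> carr V \<Longrightarrow> x < n \<Longrightarrow> co (vadd V v w) x = co v x + co w x"
    and co_smul: "v \<in> carr V \<Longrightarrow> x < n \<Longrightarrow> co (smul V c v) x = c * co v x"
    and co_bas: "x < n \<Longrightarrow> y < n \<Longrightarrow> co (bas x) y = of_bool (x = y)"
    and co_inj: "v \<in> carr V \<Longrightarrow> w \<in> carr V \<Longrightarrow> (\<And>x. x < n \<Longrightarrow> co v x = co w x) \<Longrightarrow> v = w"
    and form: "v \<in> carr V \<Longrightarrow> w \<in> carr V \<Longrightarrow> qform V v w = (\<Sum>x<n. co v x * co w (n - 1 - x))"
    and n3: "n \<ge> 3"
begin

text \<open>
  The linear combination of the first \<open>k\<close> basis vectors, together with its image under every linear form.  A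
  \<open>quad_space\<close> has no finite sums, so both are built up by induction.
\<close>

lemma combination:
  assumes "k \<le> n"
  shows "\<exists>u\<in>carr V. (\<forall>x<n. co u x = (if x < k then c x else 0)) \<and>
    (\<forall>\<psi> :: 'v \<Rightarrow> complex. (\<forall>v\<in>carr V. \<forall>w\<in>carr V. \<psi> (vadd V v w) = \<psi> v + \<psi> w) \<longrightarrow>
      (\<forall>a. \<forall>v\<in>carr V. \<psi> (smul V a v) = a * \<psi> v) \<longrightarrow> \<psi> u = (\<Sum>x<k. c x * \<psi> (bas x)))"
  using assms
proof (induction k)
  case 0
  have b: "bas 0 \<in> carr V" using n3 by (intro bas_carr) simp
  show ?case
    by (intro bexI[of _ "smul V 0 (bas 0)"] conjI allI impI)
      (use b in \<open>auto simp: co_smul smul_carr\<close>)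
next
  case (Suc k)
  then obtain u where u: "u \<in> carr V" "\<forall>x<n. co u x = (if x < k then c x else 0)"
    "\<forall>\<psi> :: 'v \<Rightarrow> complex. (\<forall>v\<in>carr V. \<forall>w\<in>carr V. \<psi> (vadd V v w) = \<psi> v + \<psi> w) \<longrightarrow>
      (\<forall>a. \<forall>v\<in>carr V. \<psi> (smul V a v) = a * \<psi> v) \<longrightarrow> \<psi> u = (\<Sum>x<k. c x * \<psi> (bas x))"
    by auto
  have b: "bas k \<in> carr V" "smul V (c k) (bas k) \<in> carr V" using Suc.prems by (simp_all add: bas_carr smul_carr)
  show ?case
  proof (intro bexI[of _ "vadd V u (smul V (c k) (bas k))"] conjI allI impI)
    fix x assume "x < n"
    then show "co (vadd V u (smul V (c k) (bas k))) x = (if x < Suc k then c x else 0)"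
      using u(1,2) b Suc.prems by (auto simp: co_add co_smul co_bas less_Suc_eq)
  next
    fix \<psi> :: "'v \<Rightarrow> complex" assume a: "\<forall>v\<in>carr V. \<forall>w\<in>carr V. \<psi> (vadd V v w) = \<psi> v + \<psi> w"
      "\<forall>a. \<forall>v\<in>carr V. \<psi> (smul V a v) = a * \<psi> v"
    have "\<psi> (vadd V u (smul V (c k) (bas k))) = \<psi> u + c k * \<psi> (bas k)"
      using a u(1) b by simp
    then show "\<psi> (vadd V u (smul V (c k) (bas k))) = (\<Sum>x<Suc k. c x * \<psi> (bas x))"
      using u(3) a by simp
  qed (use u b in \<open>auto intro: add_carr\<close>)
qed

lemma vector_ex: "\<exists>u\<in>carr V. \<forall>x<n. co u x = c x"
  using combination[of n c] by auto

lemma linear_expand: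
  fixes \<psi> :: "'v \<Rightarrow> complex"
  assumes "\<And>v w. v \<in> carr V \<Longrightarrow> w \<in> carr V \<Longrightarrow> \<psi> (vadd V v w) = \<psi> v + \<psi> w"
    and "\<And>a v. v \<in> carr V \<Longrightarrow> \<psi> (smul V a v) = a * \<psi> v" and v: "v \<in> carr V"
  shows "\<psi> v = (\<Sum>x<n. co v x * \<psi> (bas x))"
proof -
  obtain u where u: "u \<in> carr V" "\<forall>x<n. co u x = co v x" "\<psi> u = (\<Sum>x<n. co v x * \<psi> (bas x))"
    using combination[of n "co v"] assms(1,2) by auto
  then have "u = v" using v by (intro co_inj) auto
  then show ?thesis using u(3) by simp
qed

lemma mlformsD:
  assumes "\<phi> \<in> mlforms V d" "vs \<in> lists (carr V)" "length vs = d" "k < d" "x \<in> carr V"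
  shows "y \<in> carr V \<Longrightarrow> \<phi> (vs[k := vadd V x y]) = \<phi> (vs[k := x]) + \<phi> (vs[k := y])"
    "\<phi> (vs[k := smul V c x]) = c * \<phi> (vs[k := x])"
  using assms by (auto simp: mlforms_def)

lemma mlforms_Cons:
  assumes phi: "\<phi> \<in> mlforms V (Suc d)" and v: "v \<in> carr V"
  shows "(\<lambda>vs. \<phi> (v # vs)) \<in> mlforms V d"
  unfolding mlforms_def
proof (intro CollectI ballI allI impI)
  fix vs k x y c assume vs: "vs \<in> lists (carr V)" "length vs = d" and k: "k < d" and xy: "x \<in> carr V" "y \<in> carr V"
  have "v # vs \<in> lists (carr V)" "length (v # vs) = Suc d" "Suc k < Suc d" using vs v k by auto
  from mlformsD[OF phi this xy(1)] xy(2)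
  show "\<phi> (v # vs[k := vadd V x y]) = \<phi> (v # vs[k := x]) + \<phi> (v # vs[k := y]) \<and>
      \<phi> (v # vs[k := smul V c x]) = c * \<phi> (v # vs[k := x])" by simp
qed

lemma multilinear_expand:
  assumes "\<phi> \<in> mlforms V d" "vs \<in> lists (carr V)" "length vs = d"
  shows "\<phi> vs = (\<Sum>w\<in>words n d. (\<Prod>i<d. co (vs ! i) (w ! i)) * \<phi> (map bas w))"
  using assms
proof (induction d arbitrary: \<phi> vs)
  case 0
  then show ?case by (simp add: words_0)
next
  case (Suc d)
  then obtain v us where vs: "vs = v # us" "v \<in> carr V" "us \<in> lists (carr V)" "length us = d"
    by (cases vs) auto
  have lin: "\<phi> (vadd V x y # us) = \<phi> (x # us) + \<phi> (y # us)" "\<phi> (smul V c x # us) = c * \<phi> (x # us)"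
    if "x \<in> carr V" "y \<in> carr V" for x y c
    using mlformsD[OF Suc.prems(1), of "v # us" 0 x] vs that by simp_all
  have lin2: "\<phi> (smul V c x # us) = c * \<phi> (x # us)" if "x \<in> carr V" for x c
    using lin(2)[OF that that] .
  have "\<phi> vs = (\<Sum>x<n. co v x * \<phi> (bas x # us))"
    unfolding vs(1) by (rule linear_expand) (use vs(2) in \<open>auto simp: lin(1) lin2\<close>)
  also have "\<dots> = (\<Sum>x<n. co v x * (\<Sum>w\<in>words n d. (\<Prod>i<d. co (us ! i) (w ! i)) * \<phi> (bas x # map bas w)))"
  proof (intro sum.cong refl arg_cong2[where f = "(*)"])
    fix x assume "x \<in> {..<n}"
    then have "(\<lambda>vs. \<phi> (bas x # vs)) \<in> mlforms V d" by (intro mlforms_Cons Suc.prems(1) bas_carr) auto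
    from Suc.IH[OF this vs(3,4)]
    show "\<phi> (bas x # us) = (\<Sum>w\<in>words n d. (\<Prod>i<d. co (us ! i) (w ! i)) * \<phi> (bas x # map bas w))" .
  qed
  finally show ?case
    unfolding sum_words_Suc vs(1)
    by (simp add: prod.lessThan_Suc_shift sum_distrib_left mult.assoc del: prod.lessThan_Suc)
qed

text \<open>
  The product of coordinate forms dual to a word; evaluation at these forms reads off the coordinates of a tensor.
\<close>

definition coform :: "nat list \<Rightarrow> 'v list \<Rightarrow> complex" where
  "coform w vs = (\<Prod>i<length w. co (vs ! i) (w ! i))"

lemma coform_mlforms:
  assumes w: "w \<in> words n d"
  shows "coform w \<in> mlforms V d"
  unfolding mlforms_def
proof (intro CollectI ballI allI impI)
  fix vs k x y c assume vs: "vs \<in> lists (carr V)" "length vs = d" and k: "k < d" and xy: "x \<in> carr V" "y \<in> carr V"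
  have len: "length w = d" using w by (rule words_length)
  have "coform w (vs[k := z]) = co z (w ! k) * (\<Prod>i\<in>{..<d} - {k}. co (vs ! i) (w ! i))" for z
    unfolding coform_def len using k vs(2) by (simp add: prod.remove[of "{..<d}" k])
  moreover have "w ! k < n" using w k by (rule words_nth)
  ultimately show "coform w (vs[k := vadd V x y]) = coform w (vs[k := x]) + coform w (vs[k := y]) \<and>
      coform w (vs[k := smul V c x]) = c * coform w (vs[k := x])"
    using xy by (simp add: co_add co_smul distrib_right)
qed

lemma coform_bas:
  assumes "w \<in> words n d" "u \<in> words n d"
  shows "coform w (map bas u) = of_bool (u = w)"
proof -
  have "coform w (map bas u) = (\<Prod>i<d. of_bool (u ! i = w ! i))"
    unfolding coform_def using assms
    by (intro prod.cong) (auto simp: words_length words_nth co_bas)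
  also have "\<dots> = of_bool (u = w)"
  proof (cases "u = w")
    case False
    then obtain i where "i < d" "u ! i \<noteq> w ! i"
      using assms nth_equalityI[of u w] by (auto simp: words_length)
    then have "(\<Prod>i<d. of_bool (u ! i = w ! i)) = (0::complex)" by (intro prod_zero) auto
    then show ?thesis using False by simp
  qed simp
  finally show ?thesis .
qed

definition rep :: "nat \<Rightarrow> (nat list \<Rightarrow> complex) \<Rightarrow> 'v tensor" where
  "rep d c = (\<lambda>\<phi>. if \<phi> \<in> mlforms V d then \<Sum>w\<in>words n d. c w * \<phi> (map bas w) else 0)"

definition supported :: "nat \<Rightarrow> (nat list \<Rightarrow> complex) set" where
  "supported d = {c. \<forall>w. w \<notin> words n d \<longrightarrow> c w = 0}"

lemma rep_coform: "w \<in> words n d \<Longrightarrow> rep d c (coform w) = c w"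
  by (simp add: rep_def coform_mlforms coform_bas finite_words)

lemma rep_inj: "inj_on (rep d) (supported d)"
proof (rule inj_onI, rule ext)
  fix c c' w assume "c \<in> supported d" "c' \<in> supported d" "rep d c = rep d c'"
  then show "c w = c' w" by (cases "w \<in> words n d") (metis rep_coform, simp add: supported_def)
qed

lemma rep_add: "rep d (c + c') = rep d c + rep d c'"
  by (auto simp: rep_def fun_eq_iff sum.distrib distrib_right)

lemma rep_scale: "rep d (fscale k c) = fscale k (rep d c)"
  by (auto simp: rep_def fun_eq_iff fscale_def sum_distrib_left mult.assoc)

lemma rep_zero: "rep d 0 = 0"
  by (auto simp: rep_def fun_eq_iff)

definition pure_coords :: "nat \<Rightarrow> 'v list \<Rightarrow> nat list \<Rightarrow> complex" where
  "pure_coords d vs w = (if w \<in> words n d then \<Prod>i<d. co (vs ! i) (w ! i) else 0)"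

lemma pure_rep:
  assumes "vs \<in> lists (carr V)" "length vs = d"
  shows "pure V d vs = rep d (pure_coords d vs)"
  unfolding pure_def rep_def using multilinear_expand[OF _ assms]
  by (auto simp: fun_eq_iff pure_coords_def intro!: sum.cong)

lemma map_bas_lists: "w \<in> words n d \<Longrightarrow> map bas w \<in> lists (carr V)"
  by (auto simp: words_def intro!: bas_carr)

lemma rep_sum_pure:
  "rep d c = (\<Sum>w\<in>words n d. fscale (c w) (pure V d (map bas w)))"
  by (auto simp: rep_def fun_eq_iff sum_fun_apply fscale_def pure_def)

lemma subspace_rep_image:
  assumes "cfun.subspace S" shows "cfun.subspace (rep d ` S)"
proof -
  have "0 \<in> rep d ` S" using rep_zero cfun.subspace_0[OF assms] by (metis imageI)
  moreover have "x + y \<in> rep d ` S" if "x \<in> rep d ` S" "y \<in> rep d ` S" for x y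
    using that rep_add cfun.subspace_add[OF assms] by (auto simp flip: rep_add)
  moreover have "fscale k x \<in> rep d ` S" if "x \<in> rep d ` S" for k x
    using that cfun.subspace_scale[OF assms] by (auto simp flip: rep_scale)
  ultimately show ?thesis by (simp add: cfun.subspace_def)
qed

lemma supported_subspace: "cfun.subspace (supported d)"
  by (auto simp: cfun.subspace_def supported_def fscale_def)

lemma pure_coords_supported: "pure_coords d vs \<in> supported d"
  by (simp add: pure_coords_def supported_def)

lemma tensor_power_rep: "tensor_power V d = rep d ` supported d"
proof
  show "tensor_power V d \<subseteq> rep d ` supported d"
    unfolding tensor_power_def
  proof (rule cfun.span_minimal)
    show "pure V d ` {vs \<in> lists (carr V). length vs = d} \<subseteq> rep d ` supported d"
      using pure_rep pure_coords_supported by auto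
  qed (rule subspace_rep_image[OF supported_subspace])
  show "rep d ` supported d \<subseteq> tensor_power V d"
    unfolding tensor_power_def
  proof (rule image_subsetI)
    fix c show "rep d c \<in> cfun.span (pure V d ` {vs \<in> lists (carr V). length vs = d})"
      unfolding rep_sum_pure
    proof (intro cfun.span_sum cfun.span_scale cfun.span_base imageI CollectI conjI)
      fix w assume "w \<in> words n d"
      then show "map bas w \<in> lists (carr V)" "length (map bas w) = d"
        by (simp_all add: map_bas_lists words_length)
    qed
  qed
qed

lemma perm_tensor_rep:
  assumes s: "\<sigma> permutes {..<d}"
  shows "perm_tensor V d \<sigma> (rep d c) = rep d (act \<sigma> c)"
proof (rule ext)
  fix \<phi>
  show "perm_tensor V d \<sigma> (rep d c) \<phi> = rep d (act \<sigma> c) \<phi>"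
  proof (cases "\<phi> \<in> mlforms V d")
    case True
    have i: "inv \<sigma> permutes {..<d}" using s by (rule permutes_inv)
    let ?P = "\<lambda>vs. \<phi> (permute_list (inv \<sigma>) vs)"
    have "?P \<in> mlforms V d"
      unfolding mlforms_def
    proof (intro CollectI ballI allI impI)
      fix vs k x y a assume vs: "vs \<in> lists (carr V)" "length vs = d" and k: "k < d" and xy: "x \<in> carr V" "y \<in> carr V"
      have u: "permute_list (inv \<sigma>) (vs[k := z]) = (permute_list (inv \<sigma>) vs)[inv (inv \<sigma>) k := z]" "inv (inv \<sigma>) k < d" for z
        using permute_list_update_inv(1)[of "inv \<sigma>" vs k z] permute_list_update_inv(2)[of "inv \<sigma>" vs k] i vs k by auto
      have "permute_list (inv \<sigma>) vs \<in> lists (carr V)" "length (permute_list (inv \<sigma>) vs) = d"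
        using vs i by auto
      from mlformsD[OF True this u(2) xy(1)] xy(2)
      show "?P (vs[k := vadd V x y]) = ?P (vs[k := x]) + ?P (vs[k := y]) \<and> ?P (vs[k := smul V a x]) = a * ?P (vs[k := x])"
        unfolding u(1) by simp
    qed
    then have "perm_tensor V d \<sigma> (rep d c) \<phi> = (\<Sum>w\<in>words n d. c w * \<phi> (permute_list (inv \<sigma>) (map bas w)))"
      using True by (simp add: perm_tensor_def transpose_map_def rep_def)
    also have "\<dots> = (\<Sum>w\<in>words n d. c (permute_list \<sigma> (permute_list (inv \<sigma>) w)) * \<phi> (map bas (permute_list (inv \<sigma>) w)))"
    proof (intro sum.cong refl)
      fix w assume "w \<in> words n d"
      then have "length w = d" by (rule words_length)
      then show "c w * \<phi> (permute_list (inv \<sigma>) (map bas w)) =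
          c (permute_list \<sigma> (permute_list (inv \<sigma>) w)) * \<phi> (map bas (permute_list (inv \<sigma>) w))"
        using permute_list_inv(1)[of \<sigma> w] s i by (simp add: permute_list_map)
    qed
    also have "\<dots> = (\<Sum>w\<in>words n d. c (permute_list \<sigma> w) * \<phi> (map bas w))"
      by (rule sum_words_permute[OF i])
    finally show ?thesis using True by (simp add: rep_def act_def)
  qed (simp add: perm_tensor_def transpose_map_def rep_def)
qed

lemma qform_bas: "x < n \<Longrightarrow> y < n \<Longrightarrow> qform V (bas x) (bas y) = of_bool (x + y = n - 1)"
proof -
  assume xy: "x < n" "y < n"
  have "qform V (bas x) (bas y) = (\<Sum>z<n. if z = x then of_bool (x + y = n - 1) else 0)"
    unfolding form[OF bas_carr[OF xy(1)] bas_carr[OF xy(2)]]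
    using xy by (intro sum.cong refl) (auto simp: co_bas)
  then show ?thesis using xy by simp
qed

lemma qform_linear:
  assumes "u \<in> carr V" "v \<in> carr V" "w \<in> carr V"
  shows "qform V (vadd V u v) w = qform V u w + qform V v w" "qform V (smul V c u) w = c * qform V u w"
    "qform V w (vadd V u v) = qform V w u + qform V w v" "qform V w (smul V c u) = c * qform V w u"
proof -
  show "qform V (vadd V u v) w = qform V u w + qform V v w"
    unfolding form[OF add_carr[OF assms(1,2)] assms(3)] form[OF assms(1,3)] form[OF assms(2,3)] sum.distrib[symmetric]
    by (intro sum.cong refl) (simp add: co_add assms distrib_right)
  show "qform V (smul V c u) w = c * qform V u w"
    unfolding form[OF smul_carr[OF assms(1)] assms(3)] form[OF assms(1,3)] sum_distrib_left
    by (intro sum.cong refl) (simp add: co_smul assms)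
  show "qform V w (vadd V u v) = qform V w u + qform V w v"
    unfolding form[OF assms(3) add_carr[OF assms(1,2)]] form[OF assms(3,1)] form[OF assms(3,2)] sum.distrib[symmetric]
    by (intro sum.cong refl) (simp add: co_add assms distrib_left)
  show "qform V w (smul V c u) = c * qform V w u"
    unfolding form[OF assms(3) smul_carr[OF assms(1)]] form[OF assms(3,1)] sum_distrib_left
    by (intro sum.cong refl) (simp add: co_smul assms)
qed

end

section \<open>Contractions and the filtration in coordinates\<close>

text \<open>
  Keep a level as long as the remaining ones can make up the difference, then lower as far as necessary.
\<close>

lemma lower_weight_list:
  assumes "set zs \<subseteq> {-1, 0, 1::int}" "- int (length zs) \<le> r" "r \<le> sum_list zs"
  shows "\<exists>is. length is = length zs \<and> set is \<subseteq> {-1, 0, 1} \<and> sum_list is = r \<and> (\<forall>k<length zs. is ! k \<le> zs ! k)"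
  using assms
proof (induction zs arbitrary: r)
  case Nil
  then show ?case by simp
next
  case (Cons z zs)
  have lb: "- int (length zs) \<le> sum_list zs"
    using Cons.prems(1) by (induction zs) auto
  \<comment> \<open>Either keep the head, or lower it just enough for a tail of levels \<open>-1\<close>.\<close>
  define i where "i = (if - int (length zs) \<le> r - z then z else r + int (length zs))"
  have i: "i \<in> {-1, 0, 1}" "i \<le> z" "- int (length zs) \<le> r - i" "r - i \<le> sum_list zs"
    using Cons.prems lb by (auto simp: i_def)
  obtain js where js: "length js = length zs" "set js \<subseteq> {-1, 0, 1}" "sum_list js = r - i" "\<forall>k<length zs. js ! k \<le> zs ! k"
    using Cons.IH[of "r - i"] Cons.prems(1) i by auto
  show ?case
    by (rule exI[of _ "i # js"]) (use js i in \<open>auto simp: nth_Cons split: nat.split\<close>)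
qed

context witt_space
begin

lemma rep_sum: "rep d (\<Sum>i\<in>I. f i) = (\<Sum>i\<in>I. rep d (f i))"
proof (rule ext)
  fix \<phi>
  show "rep d (\<Sum>i\<in>I. f i) \<phi> = (\<Sum>i\<in>I. rep d (f i)) \<phi>"
    unfolding rep_def sum_fun_apply sum_distrib_right by (simp add: sum.swap[of _ I])
qed

definition rest :: "nat \<Rightarrow> nat \<Rightarrow> nat \<Rightarrow> nat list" where
  "rest d i j = filter (\<lambda>p. p \<in> - {i, j}) [0..<d]"

lemma set_rest: "set (rest d i j) = {..<d} - {i, j}"
  by (auto simp: rest_def)

lemma distinct_rest: "distinct (rest d i j)"
  by (simp add: rest_def)

lemma nths_rest: "length xs = d \<Longrightarrow> nths xs (- {i, j}) = map ((!) xs) (rest d i j)"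
  by (simp add: rest_def nths_eq_map)

lemma length_rest:
  assumes "i < d" "j < d" "i \<noteq> j" shows "length (rest d i j) = d - 2"
proof -
  have "length (rest d i j) = card (set (rest d i j))" by (rule distinct_card[symmetric, OF distinct_rest])
  also have "set (rest d i j) = {..<d} - {i, j}" by (rule set_rest)
  also have "card ({..<d} - {i, j}) = d - 2" using assms by (simp add: card_Diff_subset)
  finally show ?thesis .
qed

lemma nths_rest_words:
  assumes "w \<in> words n d" "i < d" "j < d" "i \<noteq> j"
  shows "nths w (- {i, j}) \<in> words n (d - 2)"
proof -
  have "length (nths w (- {i, j})) = d - 2"
    using length_rest[OF assms(2-4)] words_length[OF assms(1)] by (simp add: nths_rest)
  moreover have "set (nths w (- {i, j})) \<subseteq> {..<n}"
    using assms(1) set_nths_subset[of w "- {i, j}"] by (auto simp: words_def)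
  ultimately show ?thesis by (simp add: words_def)
qed

lemma nths_rest_update:
  assumes len: "length vs = d" and ij: "i < d" "j < d" "i \<noteq> j" and k: "k < d"
  shows "k \<in> {i, j} \<Longrightarrow> nths (vs[k := z]) (- {i, j}) = nths vs (- {i, j})"
    and "k \<notin> {i, j} \<Longrightarrow> \<exists>k'<d - 2. \<forall>z. nths (vs[k := z]) (- {i, j}) = (nths vs (- {i, j}))[k' := z]"
proof -
  let ?L = "rest d i j"
  have L: "nths xs (- {i, j}) = map ((!) xs) ?L" if "length xs = d" for xs :: "'a list"
    using that by (rule nths_rest)
  show "nths (vs[k := z]) (- {i, j}) = nths vs (- {i, j})" if "k \<in> {i, j}"
  proof -
    have "vs[k := z] ! p = vs ! p" if "p \<in> set ?L" for p
      using that \<open>k \<in> {i, j}\<close> by (metis DiffD2 nth_list_update_neq set_rest)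
    then show ?thesis using len by (simp add: L)
  qed
  show "\<exists>k'<d - 2. \<forall>z. nths (vs[k := z]) (- {i, j}) = (nths vs (- {i, j}))[k' := z]" if "k \<notin> {i, j}"
  proof -
    have "k \<in> set ?L" using that k by (simp add: set_rest)
    then obtain k' where k': "k' < length ?L" "?L ! k' = k" unfolding in_set_conv_nth by blast
    have "nths (vs[k := z]) (- {i, j}) = (nths vs (- {i, j}))[k' := z]" for z
    proof (rule nth_equalityI)
      show "length (nths (vs[k := z]) (- {i, j})) = length ((nths vs (- {i, j}))[k' := z])"
        using len by (simp add: L)
    next
      fix p assume "p < length (nths (vs[k := z]) (- {i, j}))"
      then have p: "p < length ?L" using len by (simp add: L)
      have "?L ! p \<in> set ?L" using p by (rule nth_mem)
      then have Lp: "?L ! p < d" by (simp add: set_rest)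
      have d: "distinct ?L" by (rule distinct_rest)
      show "nths (vs[k := z]) (- {i, j}) ! p = (nths vs (- {i, j}))[k' := z] ! p"
      proof (cases "p = k'")
        case True
        then have "nths (vs[k := z]) (- {i, j}) ! p = vs[k := z] ! k" using len p k' by (simp add: L)
        then show ?thesis using True k k' len by (simp add: L)
      next
        case False
        then have "?L ! p \<noteq> k" using d p k' nth_eq_iff_index_eq[OF d p k'(1)] by simp
        then show ?thesis using False len p by (simp add: L)
      qed
    qed
    then show ?thesis using k'(1) length_rest[OF ij] by auto
  qed
qed

lemma contraction_mlforms:
  assumes psi: "\<psi> \<in> mlforms V (d - 2)" and ij: "i < d" "j < d" "i \<noteq> j"
  shows "(\<lambda>vs. qform V (vs ! i) (vs ! j) * \<psi> (nths vs (- {i, j}))) \<in> mlforms V d"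
  unfolding mlforms_def
proof (intro CollectI ballI allI impI)
  fix vs k x y c assume vs: "vs \<in> lists (carr V)" "length vs = d" and k: "k < d" and xy: "x \<in> carr V" "y \<in> carr V"
  have c: "vs ! i \<in> carr V" "vs ! j \<in> carr V" using vs ij by auto
  let ?r = "nths vs (- {i, j})"
  have r: "?r \<in> lists (carr V)" "length ?r = d - 2"
  proof -
    show "?r \<in> lists (carr V)" using vs(1) set_nths_subset[of vs "- {i, j}"] by (auto simp: in_lists_conv_set)
    show "length ?r = d - 2" using length_rest[OF ij] vs(2) by (simp add: nths_rest)
  qed
  let ?P = "\<lambda>vs. qform V (vs ! i) (vs ! j) * \<psi> (nths vs (- {i, j}))"
  consider "k = i" | "k = j" "k \<noteq> i" | "k \<notin> {i, j}" by blast
  then show "?P (vs[k := vadd V x y]) = ?P (vs[k := x]) + ?P (vs[k := y]) \<and> ?P (vs[k := smul V c x]) = c * ?P (vs[k := x])"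
  proof cases
    case 1
    then have "?P (vs[k := z]) = qform V z (vs ! j) * \<psi> ?r" for z
      using ij vs nths_rest_update(1)[OF vs(2) ij k, of z] by simp
    then show ?thesis using qform_linear[OF xy(1) xy(2) c(2)] by (simp add: distrib_right)
  next
    case 2
    then have "?P (vs[k := z]) = qform V (vs ! i) z * \<psi> ?r" for z
      using ij vs nths_rest_update(1)[OF vs(2) ij k, of z] by simp
    then show ?thesis using qform_linear[OF xy(1) xy(2) c(1)] by (simp add: distrib_right)
  next
    case 3
    then obtain k' where k': "k' < d - 2" "\<forall>z. nths (vs[k := z]) (- {i, j}) = ?r[k' := z]"
      using nths_rest_update(2)[OF vs(2) ij k] by blast
    have "?P (vs[k := z]) = qform V (vs ! i) (vs ! j) * \<psi> (?r[k' := z])" for z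
      using k' 3 by simp
    moreover have "\<psi> (?r[k' := vadd V x y]) = \<psi> (?r[k' := x]) + \<psi> (?r[k' := y])" "\<psi> (?r[k' := smul V c x]) = c * \<psi> (?r[k' := x])"
      using mlformsD[OF psi r k'(1) xy(1)] xy(2) by auto
    ultimately show ?thesis by (simp add: distrib_left)
  qed
qed

lemma contraction_rep_apply:
  assumes psi: "\<psi> \<in> mlforms V (d - 2)" and ij: "i < d" "j < d" "i \<noteq> j"
  shows "contraction V d i j (rep d c) \<psi> =
    (\<Sum>w\<in>words n d. c w * (of_bool (w ! i + w ! j = n - 1) * \<psi> (map bas (nths w (- {i, j})))))"
proof -
  have "contraction V d i j (rep d c) \<psi> =
      (\<Sum>w\<in>words n d. c w * (qform V (map bas w ! i) (map bas w ! j) * \<psi> (nths (map bas w) (- {i, j}))))"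
    using psi contraction_mlforms[OF assms] by (simp add: contraction_def transpose_map_def rep_def)
  also have "\<dots> = (\<Sum>w\<in>words n d. c w * (of_bool (w ! i + w ! j = n - 1) * \<psi> (map bas (nths w (- {i, j})))))"
    using ij by (intro sum.cong refl) (simp add: words_length words_nth qform_bas nths_map)
  finally show ?thesis .
qed

text \<open>
  Evaluating the contraction at the dual form of the remaining word isolates one of the sums.  For the converse,
  average the sum over all words over the letters at positions \<open>i\<close> and \<open>j\<close>.
\<close>

lemma contraction_eq_0_iff:
  assumes ij: "i < d" "j < d" "i \<noteq> j"
  shows "contraction V d i j (rep d c) = 0 \<longleftrightarrow> (\<forall>w\<in>words n d. (\<Sum>x<n. c (w[i := x, j := n - 1 - x])) = 0)"
proof
  assume z: "contraction V d i j (rep d c) = 0"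
  show "\<forall>w\<in>words n d. (\<Sum>x<n. c (w[i := x, j := n - 1 - x])) = 0"
  proof
    fix w assume w: "w \<in> words n d"
    have len: "length w = d" using w by (rule words_length)
    let ?r = "nths w (- {i, j})"
    have r: "?r \<in> words n (d - 2)" using w ij by (rule nths_rest_words)
    have "(\<Sum>u\<in>words n d. c u * (of_bool (u ! i + u ! j = n - 1) * coform ?r (map bas (nths u (- {i, j}))))) = 0"
      using z contraction_rep_apply[OF coform_mlforms[OF r] ij, of c] by simp
    also have "(\<Sum>u\<in>words n d. c u * (of_bool (u ! i + u ! j = n - 1) * coform ?r (map bas (nths u (- {i, j}))))) =
        (\<Sum>u\<in>words n d. if u ! i + u ! j = n - 1 \<and> nths u (- {i, j}) = ?r then c u else 0)"
      using ij r by (intro sum.cong refl) (auto simp: coform_bas nths_rest_words)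
    also have "\<dots> = (\<Sum>u\<in>{u \<in> words n d. u ! i + u ! j = n - 1 \<and> nths u (- {i, j}) = ?r}. c u)"
      using finite_words by (simp add: sum.inter_filter)
    also have "\<dots> = (\<Sum>x<n. c (w[i := x, j := n - 1 - x]))"
    proof (rule sum.reindex_bij_witness[of _ "\<lambda>x. w[i := x, j := n - 1 - x]" "\<lambda>u. u ! i"])
      fix u assume "u \<in> {u \<in> words n d. u ! i + u ! j = n - 1 \<and> nths u (- {i, j}) = ?r}"
      then have u: "u \<in> words n d" "u ! i + u ! j = n - 1" "nths u (- {i, j}) = ?r" by auto
      have lu: "length u = d" using u(1) by (rule words_length)
      have eq: "u ! p = w ! p" if p: "p < d" "p \<noteq> i" "p \<noteq> j" for p
      proof -
        have "p \<in> set (rest d i j)" using p by (simp add: set_rest)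
        moreover have "map ((!) u) (rest d i j) = map ((!) w) (rest d i j)"
          using u(3) lu len by (simp add: nths_rest)
        ultimately show ?thesis by (metis map_eq_conv)
      qed
      show u': "w[i := u ! i, j := n - 1 - u ! i] = u"
      proof (rule nth_equalityI)
        fix p assume "p < length (w[i := u ! i, j := n - 1 - u ! i])"
        then show "w[i := u ! i, j := n - 1 - u ! i] ! p = u ! p"
          using eq[of p] u(2) len by (cases "p = j"; cases "p = i") auto
      qed (simp add: lu len)
      show "u ! i \<in> {..<n}" using u(1) ij by (auto intro: words_nth)
      show "c (w[i := u ! i, j := n - 1 - u ! i]) = c u" by (simp only: u')
    next
      fix x assume x: "x \<in> {..<n}"
      show "w[i := x, j := n - 1 - x] ! i = x" using ij len by simp
      have "nths (w[i := x, j := n - 1 - x]) (- {i, j}) = nths w (- {i, j})"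
        using nths_rest_update(1)[of "w[i := x]" d i j j "n - 1 - x"] nths_rest_update(1)[of w d i j i x] ij len by simp
      then show "w[i := x, j := n - 1 - x] \<in> {u \<in> words n d. u ! i + u ! j = n - 1 \<and> nths u (- {i, j}) = ?r}"
        using w x ij len by (auto simp: words_update)
    qed
    finally show "(\<Sum>x<n. c (w[i := x, j := n - 1 - x])) = 0" .
  qed
next
  assume z: "\<forall>w\<in>words n d. (\<Sum>x<n. c (w[i := x, j := n - 1 - x])) = 0"
  show "contraction V d i j (rep d c) = 0"
  proof (rule ext)
    fix \<psi>
    show "contraction V d i j (rep d c) \<psi> = 0 \<psi>"
    proof (cases "\<psi> \<in> mlforms V (d - 2)")
      case False
      then show ?thesis by (simp add: contraction_def transpose_map_def)
    next
      case True
      define f where "f w = c w * (of_bool (w ! i + w ! j = n - 1) * \<psi> (map bas (nths w (- {i, j}))))" for w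
      \<comment> \<open>Replacing the letters at \<open>i\<close> and \<open>j\<close> in all ways hits every word \<open>n\<^sup>2\<close> times.\<close>
      have "of_nat n * (of_nat n * (\<Sum>w\<in>words n d. f w)) = (\<Sum>w\<in>words n d. \<Sum>x<n. \<Sum>y<n. f (w[i := x, j := y]))"
        by (simp only: sum_words_update[OF ij(1), of "\<lambda>w. \<Sum>y<n. f (w[j := y])"] sum_words_update[OF ij(2)])
      also have "\<dots> = 0"
      proof (rule sum.neutral, rule ballI)
        fix w assume w: "w \<in> words n d"
        have len: "length w = d" using w by (rule words_length)
        have n: "nths (w[i := x, j := y]) (- {i, j}) = nths w (- {i, j})" for x y
          using nths_rest_update(1)[of "w[i := x]" d i j j y] nths_rest_update(1)[of w d i j i x] ij len by simp
        have "(\<Sum>x<n. \<Sum>y<n. f (w[i := x, j := y])) =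
           (\<Sum>x<n. \<Sum>y<n. if y = n - 1 - x then c (w[i := x, j := n - 1 - x]) * \<psi> (map bas (nths w (- {i, j}))) else 0)"
          using ij len unfolding f_def n by (intro sum.cong refl) auto
        also have "\<dots> = (\<Sum>x<n. c (w[i := x, j := n - 1 - x])) * \<psi> (map bas (nths w (- {i, j})))"
          unfolding sum_distrib_right by (intro sum.cong refl) auto
        also have "\<dots> = 0" using z w by simp
        finally show "(\<Sum>x<n. \<Sum>y<n. f (w[i := x, j := y])) = 0" .
      qed
      finally have "(\<Sum>w\<in>words n d. f w) = 0" using n3 by simp
      then show ?thesis unfolding contraction_rep_apply[OF True ij] f_def by simp
    qed
  qed
qed

lemma traceless_rep: "traceless V d = rep d ` traceless_words n d"
proof -
  have sym: "(\<Sum>x<n. c (w[j := x, i := n - 1 - x])) = (\<Sum>x<n. c (w[i := x, j := n - 1 - x]))"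
    if ij: "i \<noteq> j" for c :: "nat list \<Rightarrow> complex" and w i j
  proof -
    have "(\<Sum>x<n. c (w[j := x, i := n - 1 - x])) = (\<Sum>x<n. c (w[i := n - 1 - x, j := x]))"
      by (simp only: list_update_swap[OF ij])
    also have "\<dots> = (\<Sum>x<n. c (w[i := x, j := n - 1 - x]))"
      by (rule sum.reindex_bij_witness[of _ "\<lambda>x. n - 1 - x" "\<lambda>x. n - 1 - x"]) auto
    finally show ?thesis .
  qed
  have "contraction V d i j (rep d c) = 0"
    if "c \<in> traceless_words n d" "i < j" "j < d" for c i j
    using that by (subst contraction_eq_0_iff) (auto simp: traceless_words_def)
  moreover have "c \<in> traceless_words n d"
    if c: "c \<in> supported d" "\<forall>i j. i < j \<and> j < d \<longrightarrow> contraction V d i j (rep d c) = 0" for c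
    unfolding traceless_words_def
  proof (intro CollectI conjI allI ballI impI)
    fix w assume "w \<notin> words n d" then show "c w = 0" using c(1) by (simp add: supported_def)
  next
    fix w i j assume w: "w \<in> words n d" and ij: "i < d" "j < d" "i \<noteq> j"
    show "(\<Sum>x<n. c (w[i := x, j := n - 1 - x])) = 0"
    proof (cases "i < j")
      case True
      then show ?thesis using c(2) contraction_eq_0_iff[OF ij] w ij by blast
    next
      case False
      then have "contraction V d j i (rep d c) = 0" using c(2) ij by simp
      then have "(\<Sum>x<n. c (w[j := x, i := n - 1 - x])) = 0"
        using contraction_eq_0_iff[of j d i c] w ij by auto
      then show ?thesis using sym[OF ij(3), of c w] by simp
    qed
  qed
  moreover have "traceless_words n d \<subseteq> supported d" by (auto simp: traceless_words_def supported_def)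
  ultimately show ?thesis unfolding traceless_def tensor_power_rep by blast
qed

definition line0 :: "'v set" where
  "line0 = {v \<in> carr V. \<forall>x. 1 \<le> x \<and> x < n \<longrightarrow> co v x = 0}"

lemma line0_bas: "bas 0 \<in> line0"
  using n3 by (auto simp: line0_def co_bas bas_carr)

lemma qform_last: "v \<in> carr V \<Longrightarrow> w \<in> line0 \<Longrightarrow> qform V v w = co v (n - 1) * co w 0"
proof -
  assume v: "v \<in> carr V" and w: "w \<in> line0"
  have "qform V v w = (\<Sum>x<n. if x = n - 1 then co v (n - 1) * co w 0 else 0)"
  proof -
    have wc: "w \<in> carr V" "\<And>x. 1 \<le> x \<Longrightarrow> x < n \<Longrightarrow> co w x = 0" using w by (auto simp: line0_def)
    show ?thesis
      unfolding form[OF v wc(1)]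
    proof (intro sum.cong refl)
      fix x assume "x \<in> {..<n}"
      then show "co v x * co w (n - 1 - x) = (if x = n - 1 then co v (n - 1) * co w 0 else 0)"
        using wc(2)[of "n - 1 - x"] by (cases "x = n - 1") auto
    qed
  qed
  also have "\<dots> = co v (n - 1) * co w 0" using n3 by (simp add: sum.delta)
  finally show ?thesis .
qed

lemma qperp_line0: "qperp V line0 = {v \<in> carr V. co v (n - 1) = 0}"
proof -
  have "co (bas 0) 0 = 1" using n3 by (simp add: co_bas)
  then show ?thesis unfolding qperp_def using qform_last line0_bas by force
qed

lemma filt1_line0:
  "filt1 V line0 1 = line0" "filt1 V line0 0 = {v \<in> carr V. co v (n - 1) = 0}" "filt1 V line0 (-1) = carr V"
  by (simp_all add: filt1_def qperp_line0)

lemma filt1_letter: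
  assumes v: "v \<in> filt1 V line0 i" "i \<in> {-1, 0, 1}" and x: "x < n" "co v x \<noteq> 0"
  shows "i \<le> letter_weight n x"
proof -
  consider "i = -1" | "i = 0" | "i = 1" using v(2) by blast
  then show ?thesis
  proof cases
    case 1
    then show ?thesis by (simp add: letter_weight_def)
  next
    case 2
    then have "x \<noteq> n - 1" using v(1) x unfolding filt1_line0 2 by blast
    then show ?thesis using 2 by (simp add: letter_weight_def)
  next
    case 3
    then have "v \<in> line0" using v(1) by (simp only: filt1_line0)
    then have "\<not> 1 \<le> x" using x unfolding line0_def by blast
    then show ?thesis using 3 n3 by (simp add: letter_weight_def)
  qed
qed

lemma filt1_carr: "v \<in> filt1 V line0 i \<Longrightarrow> v \<in> carr V"
  by (auto simp: filt1_def qperp_def line0_def split: if_splits)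

lemma bas_filt1:
  assumes x: "x < n" "i \<le> letter_weight n x" and i: "i \<in> {-1, 0, 1}"
  shows "bas x \<in> filt1 V line0 i"
proof -
  consider "i = -1" | "i = 0" | "i = 1" using i by blast
  then show ?thesis
  proof cases
    case 1
    then show ?thesis using x by (simp add: filt1_line0 bas_carr)
  next
    case 2
    then have "x \<noteq> n - 1" using x n3 by (auto simp: letter_weight_def)
    then show ?thesis using 2 x n3 by (simp add: filt1_line0 bas_carr co_bas)
  next
    case 3
    then have "x = 0" using x by (cases "x = 0"; cases "x = n - 1") (simp_all add: letter_weight_def)
    then show ?thesis using 3 by (simp add: filt1_line0 line0_bas)
  qed
qed

text \<open>
  A pure tensor of basis vectors of weight at least \<open>r\<close> lies in \<open>F\<^sup>r\<close> because the levels \<open>i\<^sub>1, \<dots>, i\<^sub>d\<close> of its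
  factors can be lowered one at a time until they sum to \<open>r\<close>; here \<open>r \<ge> -d\<close> is needed.
\<close>

lemma filt_tensor_rep:
  assumes r: "- int d \<le> r"
  shows "filt_tensor V line0 d r = rep d ` {c \<in> supported d. \<forall>w. c w \<noteq> 0 \<longrightarrow> r \<le> weight n w}"
    (is "_ = rep d ` ?S")
proof
  have sub: "cfun.subspace ?S"
  proof -
    have "x + y \<in> ?S" if x: "x \<in> ?S" and y: "y \<in> ?S" for x y
    proof -
      have nz: "x w \<noteq> 0 \<or> y w \<noteq> 0" if "(x + y) w \<noteq> 0" for w using that by auto
      have "x + y \<in> supported d" using x y cfun.subspace_add[OF supported_subspace, of x d y] by simp
      moreover have "r \<le> weight n w" if "(x + y) w \<noteq> 0" for w using nz[OF that] x y by blast
      ultimately show ?thesis by simp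
    qed
    moreover have "fscale c x \<in> ?S" if x: "x \<in> ?S" for c x
    proof -
      have "fscale c x \<in> supported d" using x cfun.subspace_scale[OF supported_subspace, of x d c] by simp
      moreover have "r \<le> weight n w" if "fscale c x w \<noteq> 0" for w using that x by (simp add: fscale_def)
      ultimately show ?thesis by simp
    qed
    moreover have "0 \<in> ?S" using cfun.subspace_0[OF supported_subspace, of d] by simp
    ultimately show ?thesis unfolding cfun.subspace_def by blast
  qed
  show "filt_tensor V line0 d r \<subseteq> rep d ` ?S"
    unfolding filt_tensor_def
  proof (rule cfun.span_minimal[OF _ subspace_rep_image[OF sub]], rule subsetI)
    fix t assume "t \<in> {pure V d vs |vs is. length vs = d \<and> length is = d \<and> set is \<subseteq> {- 1, 0, 1} \<and> sum_list is = r \<and>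
        (\<forall>k<d. vs ! k \<in> filt1 V line0 (is ! k))}"
    then obtain vs "is" where t: "t = pure V d vs" and vs: "length vs = d" "length is = d" "set is \<subseteq> {- 1, 0, 1}"
      "sum_list is = r" "\<forall>k<d. vs ! k \<in> filt1 V line0 (is ! k)" by blast
    have "vs ! k \<in> carr V" if "k < d" for k using filt1_carr vs(5) that by blast
    then have "vs \<in> lists (carr V)" using vs(1) by (auto simp: in_lists_conv_set in_set_conv_nth)
    then have "t = rep d (pure_coords d vs)" using t vs(1) pure_rep by simp
    moreover have "r \<le> weight n w" if nz: "pure_coords d vs w \<noteq> 0" for w
    proof -
      have w: "w \<in> words n d" "\<And>k. k < d \<Longrightarrow> co (vs ! k) (w ! k) \<noteq> 0"
        using nz by (auto simp: pure_coords_def split: if_splits)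
      have "is ! k \<le> letter_weight n (w ! k)" if k: "k < d" for k
      proof (rule filt1_letter)
        show "vs ! k \<in> filt1 V line0 (is ! k)" using vs k by simp
        show "is ! k \<in> {-1, 0, 1}" using vs k nth_mem[of k "is"] by (auto simp: subset_iff)
        show "w ! k < n" using words_nth[OF w(1) k] .
        show "co (vs ! k) (w ! k) \<noteq> 0" using w(2) k .
      qed
      then have "(\<Sum>k<d. is ! k) \<le> weight n w"
        unfolding weight_def words_length[OF w(1)] by (intro sum_mono) simp
      then show ?thesis using vs(2,4) by (simp add: sum_list_sum_nth atLeast0LessThan)
    qed
    ultimately show "t \<in> rep d ` ?S" using pure_coords_supported by blast
  qed
  show "rep d ` ?S \<subseteq> filt_tensor V line0 d r"
  proof (rule image_subsetI)
    fix c assume c: "c \<in> ?S"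
    have "fscale (c w) (pure V d (map bas w)) \<in> filt_tensor V line0 d r" if w: "w \<in> words n d" for w
    proof (cases "c w = 0")
      case True
      then show ?thesis by (simp add: filt_tensor_def cfun.span_zero)
    next
      case False
      have len: "length w = d" using w by (rule words_length)
      let ?z = "map (letter_weight n) w"
      have z: "set ?z \<subseteq> {-1, 0, 1}" by (auto simp: letter_weight_def)
      have "sum_list ?z = weight n w"
        by (simp add: weight_def sum_list_sum_nth atLeast0LessThan)
      then obtain "is" where is': "length is = d" "set is \<subseteq> {-1, 0, 1}" "sum_list is = r" "\<forall>k<d. is ! k \<le> ?z ! k"
        using lower_weight_list[OF z, of r] c False r len by auto
      have "map bas w ! k \<in> filt1 V line0 (is ! k)" if k: "k < d" for k
      proof -
        have "bas (w ! k) \<in> filt1 V line0 (is ! k)"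
        proof (rule bas_filt1)
          show "w ! k < n" using words_nth[OF w k] .
          show "is ! k \<le> letter_weight n (w ! k)" using is'(4) k len by simp
          show "is ! k \<in> {-1, 0, 1}" using is' k nth_mem[of k "is"] by (auto simp: subset_iff)
        qed
        then show ?thesis using k len by simp
      qed
      then have "pure V d (map bas w) \<in> {pure V d vs |vs is. length vs = d \<and> length is = d \<and> set is \<subseteq> {- 1, 0, 1} \<and> sum_list is = r \<and>
        (\<forall>k<d. vs ! k \<in> filt1 V line0 (is ! k))}"
        using is' len by (intro CollectI exI[of _ "map bas w"] exI[of _ "is"]) simp
      then show ?thesis unfolding filt_tensor_def by (intro cfun.span_scale cfun.span_base)
    qed
    then show "rep d c \<in> filt_tensor V line0 d r"
      unfolding rep_sum_pure filt_tensor_def by (intro cfun.span_sum) auto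
  qed
qed

end

section \<open>The tableau of a partition\<close>

lemma down_closed_lessThan:
  fixes A :: "nat set"
  assumes "finite A" "\<And>x y. x \<in> A \<Longrightarrow> y \<le> x \<Longrightarrow> y \<in> A"
  shows "A = {..<card A}"
proof (rule card_subset_eq)
  show "A \<subseteq> {..<card A}"
  proof
    fix x assume "x \<in> A"
    then have "{..x} \<subseteq> A" using assms(2) by auto
    then have "card {..x} \<le> card A" using assms(1) by (intro card_mono)
    then show "x \<in> {..<card A}" by simp
  qed
qed auto

text \<open>
  A permutation preserving all fibres of \<open>f\<close> as sets is the same as one preserving the values of \<open>f\<close>; this compares
  the row and column subgroups with the ones of a \<open>tableau\<close>.
\<close>

lemma permutes_fibres:
  assumes s: "\<sigma> permutes {..<d::nat}" and K: "f ` {..<d} \<subseteq> K"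
  shows "(\<forall>k\<in>K. \<sigma> ` {p. p < d \<and> f p = k} = {p. p < d \<and> f p = k}) \<longleftrightarrow> (\<forall>p<d. f (\<sigma> p) = f p)"
proof
  assume *: "\<forall>k\<in>K. \<sigma> ` {p. p < d \<and> f p = k} = {p. p < d \<and> f p = k}"
  show "\<forall>p<d. f (\<sigma> p) = f p"
  proof (intro allI impI)
    fix p assume p: "p < d"
    then have "\<sigma> p \<in> \<sigma> ` {q. q < d \<and> f q = f p}" by simp
    moreover have "f p \<in> K" using K p by auto
    ultimately have "\<sigma> p \<in> {q. q < d \<and> f q = f p}" using * by blast
    then show "f (\<sigma> p) = f p" by simp
  qed
next
  assume *: "\<forall>p<d. f (\<sigma> p) = f p"
  show "\<forall>k\<in>K. \<sigma> ` {p. p < d \<and> f p = k} = {p. p < d \<and> f p = k}"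
  proof
    fix k
    have fin: "finite {p. p < d \<and> f p = k}" by simp
    have inj: "inj_on \<sigma> {p. p < d \<and> f p = k}" using permutes_inj[OF s] by (rule inj_on_subset) simp
    have "\<sigma> p < d" if "p < d" for p using permutes_in_image[OF s, of p] that by simp
    then have "\<sigma> ` {p. p < d \<and> f p = k} \<subseteq> {p. p < d \<and> f p = k}" using * by auto
    then show "\<sigma> ` {p. p < d \<and> f p = k} = {p. p < d \<and> f p = k}"
      by (intro endo_inj_surj[OF fin _ inj])
  qed
qed

definition col_height :: "nat list \<Rightarrow> nat \<Rightarrow> nat" where
  "col_height lam j = conj_part lam (Suc j)"

definition diagram :: "nat list \<Rightarrow> (nat \<times> nat) set" where
  "diagram lam = {(i, j). j < lam ! 0 \<and> i < col_height lam j}"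

text \<open>
  The row and the column of an entry of the column canonical tableau.
\<close>

definition cell :: "nat list \<Rightarrow> nat \<Rightarrow> nat \<times> nat" where
  "cell lam = inv_into (diagram lam) (\<lambda>(i, j). tab_entry lam i j)"

context
  fixes lam :: "nat list" and n :: nat
  assumes len: "length lam = n" and sorted: "sorted_wrt (\<ge>) lam" and npos: "0 < n"
begin

lemma lam_anti: "i \<le> i' \<Longrightarrow> i' < n \<Longrightarrow> lam ! i' \<le> lam ! i"
  using sorted len by (cases "i = i'") (auto simp: sorted_wrt_iff_nth_less)

lemma less_col_height: "i < col_height lam j \<longleftrightarrow> i < n \<and> j < lam ! i"
proof -
  have "{i. i < length lam \<and> Suc j \<le> lam ! i} = {..<card {i. i < length lam \<and> Suc j \<le> lam ! i}}"
    by (rule down_closed_lessThan) (use lam_anti len in \<open>auto intro: order_trans\<close>)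
  then show ?thesis unfolding col_height_def conj_part_def using len
    by (metis (mono_tags, lifting) Suc_le_eq lessThan_iff mem_Collect_eq)
qed

lemma diagram_iff: "(i, j) \<in> diagram lam \<longleftrightarrow> i < n \<and> j < lam ! i"
  unfolding diagram_def using less_col_height lam_anti[of 0 i] by (auto intro: order_less_le_trans)

lemma tab_entry_less:
  assumes "i < col_height lam j"
  shows "tab_entry lam i j < (\<Sum>j'<Suc j. col_height lam j')"
  using assms by (simp add: tab_entry_def col_height_def)

lemma col_sum_mono: "a \<le> b \<Longrightarrow> (\<Sum>j<a. col_height lam j) \<le> (\<Sum>j<b. col_height lam j)"
  by (rule sum_mono2) auto

lemma tab_entry_inj: "inj_on (\<lambda>(i, j). tab_entry lam i j) (diagram lam)"
proof -
  have ne: "tab_entry lam i j < tab_entry lam i' j'" if "i < col_height lam j" "j < j'" for i j i' j'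
  proof -
    have "tab_entry lam i j < (\<Sum>j'<Suc j. col_height lam j')" using that(1) by (rule tab_entry_less)
    also have "\<dots> \<le> (\<Sum>j<j'. col_height lam j)" using that(2) by (intro col_sum_mono) simp
    also have "\<dots> \<le> tab_entry lam i' j'" by (simp add: tab_entry_def col_height_def)
    finally show ?thesis .
  qed
  show ?thesis
  proof (rule inj_onI)
    fix x y assume x: "x \<in> diagram lam" and y: "y \<in> diagram lam"
      and eq: "(\<lambda>(i, j). tab_entry lam i j) x = (\<lambda>(i, j). tab_entry lam i j) y"
    obtain i j i' j' where xy: "x = (i, j)" "y = (i', j')" by (cases x, cases y)
    have c: "i < col_height lam j" "i' < col_height lam j'" using x y xy by (auto simp: diagram_def)
    have e: "tab_entry lam i j = tab_entry lam i' j'" using eq xy by simp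
    have "j = j'" using ne[OF c(1), of j' i'] ne[OF c(2), of j i] e by (metis less_irrefl nat_neq_iff)
    then show "x = y" using e xy by (simp add: tab_entry_def)
  qed
qed

lemma sum_col_height: "(\<Sum>j<lam ! 0. col_height lam j) = sum_list lam"
proof -
  have "col_height lam j = (\<Sum>i<n. if j < lam ! i then 1 else 0)" for j
  proof -
    have "{..<col_height lam j} = {i \<in> {..<n}. j < lam ! i}" using less_col_height by auto
    then have "col_height lam j = card {i \<in> {..<n}. j < lam ! i}" by (metis card_lessThan)
    then show ?thesis by (simp add: sum.inter_filter[symmetric])
  qed
  then have "(\<Sum>j<lam ! 0. col_height lam j) = (\<Sum>i<n. \<Sum>j<lam ! 0. if j < lam ! i then 1 else 0)"
    by (simp add: sum.swap[of _ "{..<n}"])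
  also have "\<dots> = (\<Sum>i<n. lam ! i)"
  proof (intro sum.cong refl)
    fix i assume "i \<in> {..<n}"
    then have "lam ! i \<le> lam ! 0" using lam_anti[of 0 i] by simp
    then have "{j \<in> {..<lam ! 0}. j < lam ! i} = {..<lam ! i}" by auto
    then show "(\<Sum>j<lam ! 0. if j < lam ! i then 1 else 0) = lam ! i"
      by (simp add: sum.inter_filter[symmetric])
  qed
  also have "\<dots> = sum_list lam" by (simp add: sum_list_sum_nth len atLeast0LessThan)
  finally show ?thesis .
qed

lemma tab_entry_bij: "bij_betw (\<lambda>(i, j). tab_entry lam i j) (diagram lam) {..<sum_list lam}"
proof -
  have dsig: "diagram lam = (\<lambda>(j, i). (i, j)) ` (SIGMA j:{..<lam ! 0}. {..<col_height lam j})"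
    by (auto simp: diagram_def image_iff)
  have "card (diagram lam) = sum_list lam"
    unfolding dsig by (subst card_image) (auto simp: inj_on_def sum_col_height)
  moreover have "(\<lambda>(i, j). tab_entry lam i j) ` diagram lam \<subseteq> {..<sum_list lam}"
  proof (rule image_subsetI)
    fix x assume "x \<in> diagram lam"
    then obtain i j where x: "x = (i, j)" "j < lam ! 0" "i < col_height lam j" by (auto simp: diagram_def)
    have "tab_entry lam i j < (\<Sum>j'<Suc j. col_height lam j')" using x(3) by (rule tab_entry_less)
    also have "\<dots> \<le> (\<Sum>j<lam ! 0. col_height lam j)" using x(2) by (intro col_sum_mono) simp
    finally show "(\<lambda>(i, j). tab_entry lam i j) x \<in> {..<sum_list lam}" by (simp add: x(1) sum_col_height)
  qed
  ultimately have "(\<lambda>(i, j). tab_entry lam i j) ` diagram lam = {..<sum_list lam}"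
    using tab_entry_inj by (intro card_subset_eq) (auto simp: card_image)
  then show ?thesis using tab_entry_inj by (simp add: bij_betw_def)
qed

lemma cell_bij: "bij_betw (cell lam) {..<sum_list lam} (diagram lam)"
  unfolding cell_def by (rule bij_betw_inv_into[OF tab_entry_bij])

lemma cell_tab_entry: "(i, j) \<in> diagram lam \<Longrightarrow> cell lam (tab_entry lam i j) = (i, j)"
  unfolding cell_def using inv_into_f_f[OF tab_entry_inj, of "(i, j)"] by simp

lemma tab_entry_cell: "p < sum_list lam \<Longrightarrow> (case cell lam p of (i, j) \<Rightarrow> tab_entry lam i j) = p"
  unfolding cell_def using f_inv_into_f[of p "\<lambda>(i, j). tab_entry lam i j" "diagram lam"] tab_entry_bij
  by (simp add: bij_betw_def)

lemma row_positions:
  assumes "i < n"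
  shows "{tab_entry lam i j | j. j < lam ! i} = {p. p < sum_list lam \<and> fst (cell lam p) = i}"
proof (intro equalityI subsetI)
  fix p assume "p \<in> {tab_entry lam i j | j. j < lam ! i}"
  then obtain j where j: "p = tab_entry lam i j" "(i, j) \<in> diagram lam" using assms by (auto simp: diagram_iff)
  then have "p < sum_list lam" using bij_betwE[OF tab_entry_bij] by force
  then show "p \<in> {p. p < sum_list lam \<and> fst (cell lam p) = i}" using j by (simp add: cell_tab_entry)
next
  fix p assume "p \<in> {p. p < sum_list lam \<and> fst (cell lam p) = i}"
  then obtain j where j: "p < sum_list lam" "cell lam p = (i, j)" by (cases "cell lam p") auto
  then have "(i, j) \<in> diagram lam" "tab_entry lam i j = p"
    using bij_betwE[OF cell_bij] tab_entry_cell[OF j(1)] by force+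
  then show "p \<in> {tab_entry lam i j | j. j < lam ! i}" by (auto simp: diagram_iff)
qed

lemma col_positions:
  "{tab_entry lam i j | i. i < conj_part lam (Suc j)} = {p. p < sum_list lam \<and> snd (cell lam p) = j}"
proof (intro equalityI subsetI)
  fix p assume "p \<in> {tab_entry lam i j | i. i < conj_part lam (Suc j)}"
  then obtain i where i: "p = tab_entry lam i j" "(i, j) \<in> diagram lam"
    using less_col_height diagram_iff by (auto simp: col_height_def)
  then have "p < sum_list lam" using bij_betwE[OF tab_entry_bij] by force
  then show "p \<in> {p. p < sum_list lam \<and> snd (cell lam p) = j}" using i by (simp add: cell_tab_entry)
next
  fix p assume "p \<in> {p. p < sum_list lam \<and> snd (cell lam p) = j}"
  then obtain i where i: "p < sum_list lam" "cell lam p = (i, j)" by (cases "cell lam p") auto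
  then have "(i, j) \<in> diagram lam" "tab_entry lam i j = p"
    using bij_betwE[OF cell_bij] tab_entry_cell[OF i(1)] by force+
  then show "p \<in> {tab_entry lam i j | i. i < conj_part lam (Suc j)}"
    by (auto simp: diagram_def col_height_def)
qed

text \<open>
  A first column of height \<open>n\<close> leaves no room for a second one, which is the excluded case of the determinant.
\<close>

lemma tableau_of_partition:
  assumes two: "conj_part lam 1 + conj_part lam 2 \<le> n" and det: "lam \<noteq> replicate n 1" and n3: "n \<ge> 3"
  shows "tableau (sum_list lam) (lam ! 0) n (\<lambda>p. fst (cell lam p)) (\<lambda>p. snd (cell lam p)) (col_height lam)"
proof
  show "bij_betw (\<lambda>p. (fst (cell lam p), snd (cell lam p))) {..<sum_list lam} {(i, j). j < lam ! 0 \<and> i < col_height lam j}"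
    using cell_bij by (simp add: diagram_def)
  show "col_height lam j \<le> col_height lam i" if "i \<le> j" for i j
    unfolding col_height_def conj_part_def using that by (intro card_mono) auto
  show "1 \<le> col_height lam j" if "j < lam ! 0" for j
    using less_col_height[of 0 j] that npos by simp
  have h1: "conj_part lam 1 = col_height lam 0" "conj_part lam 2 = col_height lam 1"
    by (simp_all add: col_height_def numeral_2_eq_2)
  show "col_height lam 0 + col_height lam 1 \<le> n" using two h1 by simp
  have le: "col_height lam 0 \<le> n" using two h1 by simp
  have "col_height lam 0 \<noteq> n"
  proof
    assume e: "col_height lam 0 = n"
    then have "col_height lam 1 = 0" using two h1 by simp
    have "lam ! i = 1" if "i < n" for i
      using less_col_height[of i 0] less_col_height[of i 1] e \<open>col_height lam 1 = 0\<close> that by auto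
    then have "lam = replicate n 1" using len by (intro nth_equalityI) auto
    then show False using det by simp
  qed
  then show "col_height lam 0 < n" using le by simp
  show "3 \<le> n" by (rule n3)
qed

lemma row_subgroup_eq:
  assumes T: "tableau (sum_list lam) (lam ! 0) n (\<lambda>p. fst (cell lam p)) (\<lambda>p. snd (cell lam p)) (col_height lam)"
  shows "row_subgroup lam = tableau.rows (sum_list lam) (\<lambda>p. fst (cell lam p))"
    and "column_subgroup lam = tableau.cols (sum_list lam) (\<lambda>p. snd (cell lam p))"
proof -
  interpret T: tableau "sum_list lam" "lam ! 0" n "\<lambda>p. fst (cell lam p)" "\<lambda>p. snd (cell lam p)" "col_height lam"
    by (rule T)
  have r: "(\<lambda>p. fst (cell lam p)) ` {..<sum_list lam} \<subseteq> {..<n}"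
  proof (rule image_subsetI)
    fix p assume "p \<in> {..<sum_list lam}"
    then show "fst (cell lam p) \<in> {..<n}" using T.row_less[of p] T.h_less by simp
  qed
  have E1: "(\<forall>i<length lam. \<sigma> ` {tab_entry lam i j | j. j < lam ! i} = {tab_entry lam i j | j. j < lam ! i}) \<longleftrightarrow>
     (\<forall>p<sum_list lam. fst (cell lam (\<sigma> p)) = fst (cell lam p))" if "\<sigma> permutes {..<sum_list lam}" for \<sigma>
  proof -
    have "(\<forall>i<length lam. \<sigma> ` {tab_entry lam i j | j. j < lam ! i} = {tab_entry lam i j | j. j < lam ! i}) \<longleftrightarrow>
      (\<forall>k\<in>{..<n}. \<sigma> ` {p. p < sum_list lam \<and> fst (cell lam p) = k} = {p. p < sum_list lam \<and> fst (cell lam p) = k})"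
    proof -
      define R where "R i = {tab_entry lam i j | j. j < lam ! i}" for i
      define P where "P i = {p. p < sum_list lam \<and> fst (cell lam p) = i}" for i
      have "R i = P i" if "i < n" for i unfolding R_def P_def using that by (rule row_positions)
      then have "(\<forall>i<length lam. \<sigma> ` R i = R i) \<longleftrightarrow> (\<forall>k\<in>{..<n}. \<sigma> ` P k = P k)"
        by (simp add: len Ball_def)
      then show ?thesis unfolding R_def P_def .
    qed
    then show ?thesis by (rule trans) (rule permutes_fibres[OF that r])
  qed
  show "row_subgroup lam = T.rows"
    unfolding row_subgroup_def T.rows_def by (rule Collect_cong, rule conj_cong[OF refl], rule E1)
  have E2: "(\<forall>j. \<sigma> ` {tab_entry lam i j | i. i < conj_part lam (Suc j)} = {tab_entry lam i j | i. i < conj_part lam (Suc j)}) \<longleftrightarrow>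
     (\<forall>p<sum_list lam. snd (cell lam (\<sigma> p)) = snd (cell lam p))" if "\<sigma> permutes {..<sum_list lam}" for \<sigma>
    unfolding col_positions
    using permutes_fibres[OF that, of "\<lambda>p. snd (cell lam p)" UNIV] by (simp only: ball_UNIV subset_UNIV simp_thms)
  show "column_subgroup lam = T.cols"
    unfolding column_subgroup_def T.cols_def by (rule Collect_cong, rule conj_cong[OF refl], rule E2)
qed

end

section \<open>Schur functors and linear maps in coordinates\<close>

lemma (in witt_space) schur_orth_rep:
  assumes d: "d = sum_list lam" and T: "tableau d l1 n rw cl ht"
    and R: "row_subgroup lam = tableau.rows d rw" and C: "column_subgroup lam = tableau.cols d cl"
  shows "schur_orth V lam = rep d ` tableau.schur_words d n rw cl"
proof -
  interpret T: tableau d l1 n rw cl ht by (rule T)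
  have a: "young_a V lam (rep d c) = rep d (T.rsym c)" for c
  proof -
    have "young_a V lam (rep d c) = (\<Sum>\<sigma>\<in>T.rows. rep d (act \<sigma> c))"
      unfolding young_a_def R d[symmetric] by (intro sum.cong refl perm_tensor_rep T.rows_permutes)
    also have "\<dots> = rep d (\<Sum>\<sigma>\<in>T.rows. act \<sigma> c)" by (rule rep_sum[symmetric])
    also have "(\<Sum>\<sigma>\<in>T.rows. act \<sigma> c) = T.rsym c"
      by (rule ext) (simp add: sum_fun_apply T.rsym_def act_def)
    finally show ?thesis .
  qed
  have b: "young_b V lam (rep d c) = rep d (T.csym c)" for c
  proof -
    have "young_b V lam (rep d c) = (\<Sum>\<sigma>\<in>T.cols. rep d (fscale (of_int (sign \<sigma>)) (act \<sigma> c)))"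
      unfolding young_b_def C d[symmetric] rep_scale
      by (intro sum.cong refl arg_cong2[where f = fscale] perm_tensor_rep T.cols_permutes)
    also have "\<dots> = rep d (\<Sum>\<sigma>\<in>T.cols. fscale (of_int (sign \<sigma>)) (act \<sigma> c))" by (rule rep_sum[symmetric])
    also have "(\<Sum>\<sigma>\<in>T.cols. fscale (of_int (sign \<sigma>)) (act \<sigma> c)) = T.csym c"
      by (rule ext) (simp add: sum_fun_apply T.csym_def act_def fscale_def)
    finally show ?thesis .
  qed
  show ?thesis
    unfolding schur_orth_def T.schur_words_def d[symmetric] traceless_rep image_image a b ..
qed

text \<open>
  Expand every factor \<open>g (bas (w ! i))\<close> in the basis of the target.
\<close>

lemma map_tensor_rep:
  assumes A: "witt_space V n co bas" and B: "witt_space V' n co' bas'"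
    and g: "\<And>v. v \<in> carr V \<Longrightarrow> g v \<in> carr V'"
    and gadd: "\<And>v w. v \<in> carr V \<Longrightarrow> w \<in> carr V \<Longrightarrow> g (vadd V v w) = vadd V' (g v) (g w)"
    and gsmul: "\<And>a v. v \<in> carr V \<Longrightarrow> g (smul V a v) = smul V' a (g v)"
  shows "map_tensor V' d g (witt_space.rep V n bas d c) =
    witt_space.rep V' n bas' d (mat_act n d (\<lambda>a b. co' (g (bas b)) a) c)"
proof (rule ext)
  interpret A: witt_space V n co bas by (rule A)
  interpret B: witt_space V' n co' bas' by (rule B)
  fix \<phi>
  show "map_tensor V' d g (A.rep d c) \<phi> = B.rep d (mat_act n d (\<lambda>a b. co' (g (bas b)) a) c) \<phi>"
  proof (cases "\<phi> \<in> mlforms V' d")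
    case False
    then show ?thesis by (simp add: map_tensor_def transpose_map_def B.rep_def)
  next
    case True
    have lists: "map g vs \<in> lists (carr V')" if "vs \<in> lists (carr V)" for vs
      using that g by auto
    have "(\<lambda>us. \<phi> (map g us)) \<in> mlforms V d"
      unfolding mlforms_def
    proof (intro CollectI ballI allI impI)
      fix vs k x y a assume vs: "vs \<in> lists (carr V)" "length vs = d" and k: "k < d" and xy: "x \<in> carr V" "y \<in> carr V"
      have l: "map g vs \<in> lists (carr V')" "length (map g vs) = d" using lists vs by auto
      show "\<phi> (map g (vs[k := vadd V x y])) = \<phi> (map g (vs[k := x])) + \<phi> (map g (vs[k := y])) \<and>
          \<phi> (map g (vs[k := smul V a x])) = a * \<phi> (map g (vs[k := x]))"
        using B.mlformsD[OF True l k g[OF xy(1)]] g[OF xy(2)] xy by (simp add: map_update gadd gsmul)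
    qed
    then have "map_tensor V' d g (A.rep d c) \<phi> = (\<Sum>w\<in>words n d. c w * \<phi> (map g (map bas w)))"
      using True by (simp add: map_tensor_def transpose_map_def A.rep_def)
    also have "\<dots> = (\<Sum>w\<in>words n d. c w * (\<Sum>u\<in>words n d. (\<Prod>i<d. co' (g (bas (w ! i))) (u ! i)) * \<phi> (map bas' u)))"
    proof (intro sum.cong refl arg_cong2[where f = "(*)"])
      fix w assume w: "w \<in> words n d"
      have "map g (map bas w) \<in> lists (carr V')" "length (map g (map bas w)) = d"
        using lists[OF A.map_bas_lists[OF w]] words_length[OF w] by simp_all
      from B.multilinear_expand[OF True this]
      show "\<phi> (map g (map bas w)) = (\<Sum>u\<in>words n d. (\<Prod>i<d. co' (g (bas (w ! i))) (u ! i)) * \<phi> (map bas' u))"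
        using words_length[OF w] by simp
    qed
    also have "\<dots> = (\<Sum>w\<in>words n d. \<Sum>u\<in>words n d. (\<Prod>i<d. co' (g (bas (w ! i))) (u ! i)) * c w * \<phi> (map bas' u))"
      by (simp add: sum_distrib_left mult_ac)
    also have "\<dots> = (\<Sum>u\<in>words n d. \<Sum>w\<in>words n d. (\<Prod>i<d. co' (g (bas (w ! i))) (u ! i)) * c w * \<phi> (map bas' u))"
      by (rule sum.swap)
    also have "\<dots> = B.rep d (mat_act n d (\<lambda>a b. co' (g (bas b)) a) c) \<phi>"
      using True by (simp add: B.rep_def mat_act_def sum_distrib_right)
    finally show ?thesis .
  qed
qed

section \<open>The unipotent radical of an isotropic line\<close>

definition eichler_coords :: "nat \<Rightarrow> nat \<Rightarrow> complex \<Rightarrow> (nat \<Rightarrow> complex) \<Rightarrow> nat \<Rightarrow> complex" where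
  "eichler_coords n y s c a = c a
     + (if a = 0 then s * c y - s\<^sup>2 / 2 * of_bool (2 * y = n - 1) * c (n - 1) else 0)
     - (if a = n - 1 - y then s * c (n - 1) else 0)"

lemma eichler_coords_unit:
  assumes "1 \<le> y" "y < n - 1" "b < n" "a < n"
  shows "eichler_coords n y s (\<lambda>x. of_bool (b = x)) a = eichler n y s a b"
proof -
  have "n - 1 - y \<noteq> 0" "n - 1 - 0 = n - 1" using assms by auto
  then show ?thesis
    unfolding eichler_coords_def eichler_def skew_def
    by (auto simp: eq_commute[of b])
qed

text \<open>
  \<open>exp (- s X) exp (s X) = 1\<close>.
\<close>

lemma eichler_coords_inverse:
  assumes "1 \<le> y" "y < n - 1" "a < n"
  shows "eichler_coords n y (- s) (eichler_coords n y s c) a = c a"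
proof -
  have l: "eichler_coords n y s c (n - 1) = c (n - 1)"
    using assms by (auto simp: eichler_coords_def)
  have y: "eichler_coords n y s c y = c y - of_bool (2 * y = n - 1) * s * c (n - 1)"
    using assms by (auto simp: eichler_coords_def)
  have z: "n - 1 - y \<noteq> 0" using assms by auto
  show ?thesis
    unfolding eichler_coords_def[of n y "- s"] l y
    unfolding eichler_coords_def using z
    by (auto simp: algebra_simps power2_eq_square)
qed

lemma eichler_coords_isometry:
  assumes y: "1 \<le> y" "y < n - 1"
  shows "(\<Sum>a<n. eichler_coords n y s c a * eichler_coords n y s e (n - 1 - a)) = (\<Sum>a<n. c a * e (n - 1 - a))"
proof -
  define A where "A c = s * c y - s\<^sup>2 / 2 * of_bool (2 * y = n - 1) * c (n - 1)" for c :: "nat \<Rightarrow> complex"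
  define B where "B c = s * c (n - 1)" for c :: "nat \<Rightarrow> complex"
  have "(\<Sum>a<n. eichler_coords n y s c a * eichler_coords n y s e (n - 1 - a)) =
    (\<Sum>a<n. c a * e (n - 1 - a)
      + (if a = n - 1 then c (n - 1) * A e else 0) - (if a = y then c y * B e else 0)
      + (if a = 0 then A c * e (n - 1) else 0) - (if a = n - 1 - y then B c * e y else 0)
      + (if a = y then of_bool (2 * y = n - 1) * B c * B e else 0))"
  proof (intro sum.cong refl)
    fix a assume a: "a \<in> {..<n}"
    have ee: "eichler_coords n y s e (n - 1 - a) = e (n - 1 - a) + (if a = n - 1 then A e else 0) - (if a = y then B e else 0)"
      using a y by (auto simp: eichler_coords_def A_def B_def)
    have ce: "eichler_coords n y s c a = c a + (if a = 0 then A c else 0) - (if a = n - 1 - y then B c else 0)"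
      by (simp add: eichler_coords_def A_def B_def)
    have f: "0 \<noteq> n - 1" "0 \<noteq> y" "n - 1 - y \<noteq> n - 1" "n - 1 - y \<noteq> 0" "n - 1 - (n - 1 - y) = y" "(y = n - 1 - y) = (2 * y = n - 1)"
      "y \<noteq> n - 1"
      using y by auto
    show "eichler_coords n y s c a * eichler_coords n y s e (n - 1 - a) = c a * e (n - 1 - a)
      + (if a = n - 1 then c (n - 1) * A e else 0) - (if a = y then c y * B e else 0)
      + (if a = 0 then A c * e (n - 1) else 0) - (if a = n - 1 - y then B c * e y else 0)
      + (if a = y then of_bool (2 * y = n - 1) * B c * B e else 0)"
      unfolding ee ce
    proof (cases "a = 0")
      case True
      then show "(c a + (if a = 0 then A c else 0) - (if a = n - 1 - y then B c else 0)) *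
          (e (n - 1 - a) + (if a = n - 1 then A e else 0) - (if a = y then B e else 0)) = c a * e (n - 1 - a)
      + (if a = n - 1 then c (n - 1) * A e else 0) - (if a = y then c y * B e else 0)
      + (if a = 0 then A c * e (n - 1) else 0) - (if a = n - 1 - y then B c * e y else 0)
      + (if a = y then of_bool (2 * y = n - 1) * B c * B e else 0)"
        using f by (simp add: algebra_simps)
    next
      case a0: False
      show "(c a + (if a = 0 then A c else 0) - (if a = n - 1 - y then B c else 0)) *
          (e (n - 1 - a) + (if a = n - 1 then A e else 0) - (if a = y then B e else 0)) = c a * e (n - 1 - a)
      + (if a = n - 1 then c (n - 1) * A e else 0) - (if a = y then c y * B e else 0)
      + (if a = 0 then A c * e (n - 1) else 0) - (if a = n - 1 - y then B c * e y else 0)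
      + (if a = y then of_bool (2 * y = n - 1) * B c * B e else 0)"
      proof (cases "a = n - 1 - y")
        case True
        then show ?thesis using f a0
          by (cases "2 * y = n - 1") (auto simp: algebra_simps)
      next
        case False
        then have "a = y \<Longrightarrow> 2 * y \<noteq> n - 1" using f(6) by auto
        then show ?thesis using False a0 f
          by (cases "a = n - 1"; cases "a = y") (simp_all add: algebra_simps)
      qed
    qed
  qed
  also have "\<dots> = (\<Sum>a<n. c a * e (n - 1 - a)) + c (n - 1) * A e - c y * B e + A c * e (n - 1) - B c * e y
      + of_bool (2 * y = n - 1) * B c * B e"
    using y by (simp add: sum.distrib sum_subtractf)
  also have "\<dots> = (\<Sum>a<n. c a * e (n - 1 - a))"
    by (simp add: A_def B_def algebra_simps power2_eq_square)
  finally show ?thesis .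
qed

lemma eichler_coords_linear:
  "eichler_coords n y s (\<lambda>x. c x + e x) a = eichler_coords n y s c a + eichler_coords n y s e a"
  "eichler_coords n y s (\<lambda>x. k * c x) a = k * eichler_coords n y s c a"
  by (auto simp: eichler_coords_def algebra_simps)

context witt_space
begin

definition vec_of :: "(nat \<Rightarrow> complex) \<Rightarrow> 'v" where
  "vec_of c = (SOME u. u \<in> carr V \<and> (\<forall>x<n. co u x = c x))"

lemma vec_of_coords: "vec_of c \<in> carr V" "x < n \<Longrightarrow> co (vec_of c) x = c x"
proof -
  have "\<exists>u. u \<in> carr V \<and> (\<forall>x<n. co u x = c x)" using vector_ex[of c] by blast
  then have "vec_of c \<in> carr V \<and> (\<forall>x<n. co (vec_of c) x = c x)"
    unfolding vec_of_def by (rule someI_ex)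
  then show "vec_of c \<in> carr V" "x < n \<Longrightarrow> co (vec_of c) x = c x" by auto
qed

text \<open>
  On \<open>N\<^sup>\<bottom>\<close> the element \<open>g\<close> is the identity modulo \<open>N\<close>, and the coefficient of \<open>g (bas (n - 1))\<close> at
  \<open>bas (n - 1)\<close> is its product with \<open>bas 0 = g (bas 0)\<close>.
\<close>

lemma unip_radical_matrix:
  assumes g: "g \<in> unip_radical V line0"
  shows "\<And>v. v \<in> carr V \<Longrightarrow> g v \<in> carr V"
    and "\<And>a. a < n \<Longrightarrow> co (g (bas a)) a = 1"
    and "\<And>a b. a < n \<Longrightarrow> b < n \<Longrightarrow> a \<noteq> b \<Longrightarrow> co (g (bas b)) a \<noteq> 0 \<Longrightarrow> letter_weight n b < letter_weight n a"
proof -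
  have o: "g \<in> orth_group V" and fix_line: "\<And>v. v \<in> line0 \<Longrightarrow> g v = v"
    and quot: "\<And>v. v \<in> qperp V line0 \<Longrightarrow> \<exists>w\<in>line0. g v = vadd V v w"
    using g by (auto simp: unip_radical_def)
  show gc: "g v \<in> carr V" if "v \<in> carr V" for v
    using o that by (auto simp: orth_group_def dest: bij_betwE)
  have col0: "co (g (bas 0)) a = of_bool (0 = a)" if "a < n" for a
    using fix_line[OF line0_bas] that n3 by (simp add: co_bas)
  have col: "co (g (bas b)) a = of_bool (b = a)" if b: "b < n - 1" and a: "a < n" "a \<noteq> 0" for a b
  proof -
    have "bas b \<in> qperp V line0" using b by (simp add: qperp_line0 bas_carr co_bas)
    then obtain w where w: "w \<in> line0" "g (bas b) = vadd V (bas b) w" using quot by blast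
    have "w \<in> carr V" "co w a = 0" using w(1) a by (auto simp: line0_def)
    then show ?thesis using w(2) a b by (simp add: co_add co_bas bas_carr)
  qed
  have last: "co (g (bas (n - 1))) (n - 1) = 1"
  proof -
    have b: "bas (n - 1) \<in> carr V" "bas 0 \<in> carr V" using n3 by (auto intro: bas_carr)
    have "co (g (bas (n - 1))) (n - 1) = qform V (g (bas (n - 1))) (bas 0)"
      using qform_last[OF gc[OF b(1)] line0_bas] n3 by (simp add: co_bas)
    also have "\<dots> = qform V (g (bas (n - 1))) (g (bas 0))" using fix_line[OF line0_bas] by simp
    also have "\<dots> = qform V (bas (n - 1)) (bas 0)" using o b by (simp add: orth_group_def)
    also have "\<dots> = 1" using n3 by (simp add: qform_bas)
    finally show ?thesis .
  qed
  show "co (g (bas a)) a = 1" if "a < n" for a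
  proof -
    consider "a = 0" | "a = n - 1" | "a \<noteq> 0" "a < n - 1" using \<open>a < n\<close> by linarith
    then show ?thesis using col0[OF that] last col[of a a] that by cases auto
  qed
  show "letter_weight n b < letter_weight n a" if "a < n" "b < n" "a \<noteq> b" "co (g (bas b)) a \<noteq> 0" for a b
  proof -
    consider "b = 0" | "b = n - 1" | "b \<noteq> 0" "b < n - 1" using \<open>b < n\<close> by linarith
    then show ?thesis
    proof cases
      case 1
      then show ?thesis using col0[OF that(1)] that by simp
    next
      case 2
      then have "letter_weight n b = - 1" using n3 by (simp add: letter_weight_def)
      moreover have "- 1 < letter_weight n a" using 2 that(3) by (simp add: letter_weight_def)
      ultimately show ?thesis by simp
    next
      case 3
      have "a = 0" using col[OF 3(2) that(1)] that(3,4) by auto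
      then show ?thesis using 3 n3 by (simp add: letter_weight_def)
    qed
  qed
qed

lemma eichler_unip_radical:
  assumes y: "1 \<le> y" "y < n - 1"
  shows "\<exists>g\<in>unip_radical V line0. \<forall>a<n. \<forall>b<n. co (g (bas b)) a = eichler n y s a b"
proof -
  define g where "g s v = vec_of (eichler_coords n y s (co v))" for s v
  have gc: "g s v \<in> carr V" for s v unfolding g_def by (rule vec_of_coords)
  have cg: "co (g s v) a = eichler_coords n y s (co v) a" if "a < n" for s v a
    unfolding g_def using that by (rule vec_of_coords)
  have cong: "eichler_coords n y s c a = eichler_coords n y s e a" if "a < n" "\<And>x. x < n \<Longrightarrow> c x = e x" for s c e a
    using that y by (simp add: eichler_coords_def)
  have inv: "g (- s) (g s v) = v" if v: "v \<in> carr V" for s v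
  proof (rule co_inj[OF gc v])
    fix x assume x: "x < n"
    have "co (g (- s) (g s v)) x = eichler_coords n y (- s) (eichler_coords n y s (co v)) x"
      unfolding cg[OF x] by (rule cong[OF x]) (rule cg)
    then show "co (g (- s) (g s v)) x = co v x" using eichler_coords_inverse[OF y x] by simp
  qed
  have bij: "bij_betw (g s) (carr V) (carr V)"
    by (rule bij_betw_byWitness[where f' = "g (- s)"]) (use inv[of _ s] inv[of _ "- s"] gc in auto)
  have add: "g s (vadd V v w) = vadd V (g s v) (g s w)" if "v \<in> carr V" "w \<in> carr V" for v w
  proof (rule co_inj[OF gc add_carr[OF gc gc]])
    fix x assume x: "x < n"
    have "co (g s (vadd V v w)) x = eichler_coords n y s (\<lambda>x. co v x + co w x) x"
      unfolding cg[OF x] by (rule cong[OF x]) (simp add: co_add that)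
    then show "co (g s (vadd V v w)) x = co (vadd V (g s v) (g s w)) x"
      by (simp add: eichler_coords_linear co_add gc x cg)
  qed
  have smul: "g s (smul V k v) = smul V k (g s v)" if "v \<in> carr V" for k v
  proof (rule co_inj[OF gc smul_carr[OF gc]])
    fix x assume x: "x < n"
    have "co (g s (smul V k v)) x = eichler_coords n y s (\<lambda>x. k * co v x) x"
      unfolding cg[OF x] by (rule cong[OF x]) (simp add: co_smul that)
    then show "co (g s (smul V k v)) x = co (smul V k (g s v)) x"
      by (simp add: eichler_coords_linear co_smul gc x cg)
  qed
  have iso: "qform V (g s v) (g s w) = qform V v w" if "v \<in> carr V" "w \<in> carr V" for v w
  proof -
    have "qform V (g s v) (g s w) = (\<Sum>x<n. eichler_coords n y s (co v) x * eichler_coords n y s (co w) (n - 1 - x))"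
      unfolding form[OF gc gc] by (intro sum.cong refl) (simp add: cg)
    then show ?thesis unfolding form[OF that] eichler_coords_isometry[OF y] .
  qed
  have ln: "g s v = v" if "v \<in> line0" for v
  proof (rule co_inj[OF gc])
    show "v \<in> carr V" using that by (simp add: line0_def)
    fix x assume x: "x < n"
    have "co v y = 0" "co v (n - 1) = 0" using that y by (auto simp: line0_def)
    then show "co (g s v) x = co v x" by (simp add: cg[OF x] eichler_coords_def)
  qed
  have pp: "\<exists>w\<in>line0. g s v = vadd V v w" if "v \<in> qperp V line0" for v
  proof -
    have v: "v \<in> carr V" "co v (n - 1) = 0" using that by (auto simp: qperp_line0)
    let ?w = "smul V (s * co v y) (bas 0)"
    have b: "bas 0 \<in> carr V" using n3 by (intro bas_carr) simp
    have w: "?w \<in> carr V" using b by (rule smul_carr)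
    have cw: "co ?w x = s * co v y * of_bool (0 = x)" if "x < n" for x
      using b that n3 by (simp add: co_smul co_bas)
    show ?thesis
    proof (rule bexI[of _ ?w])
      show "?w \<in> line0" using w cw by (simp add: line0_def)
      show "g s v = vadd V v ?w"
      proof (rule co_inj[OF gc add_carr[OF v(1) w]])
        fix x assume "x < n"
        then show "co (g s v) x = co (vadd V v ?w) x"
          using v w cw by (auto simp: cg co_add eichler_coords_def)
      qed
    qed
  qed
  have "g s \<in> unip_radical V line0"
    unfolding unip_radical_def orth_group_def using bij add smul iso ln pp by (auto simp: image_iff)
  moreover have "co (g s (bas b)) a = eichler n y s a b" if "a < n" "b < n" for a b
  proof -
    have "co (g s (bas b)) a = eichler_coords n y s (\<lambda>x. of_bool (b = x)) a"
      unfolding cg[OF that(1)] by (rule cong[OF that(1)]) (simp add: co_bas that)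
    then show ?thesis using eichler_coords_unit[OF y that(2,1)] by simp
  qed
  ultimately show ?thesis by blast
qed

lemma mat_act_cong:
  "(\<And>a b. a < n \<Longrightarrow> b < n \<Longrightarrow> A a b = B a b) \<Longrightarrow> mat_act n d A c = mat_act n d B c"
  unfolding mat_act_def by (rule ext) (auto intro!: sum.cong prod.cong simp: words_nth)

lemma mat_act_supported: "mat_act n d A c \<in> supported d"
  by (simp add: mat_act_def supported_def)

text \<open>
  All elements of the radical are unitriangular for the weights, which gives one inclusion; the Eichler
  transformations alone give the other.
\<close>

lemma unip_radical_invariants:
  assumes T: "tableau d l1 n rw cl ht"
  shows "{t \<in> rep d ` tableau.schur_words d n rw cl. \<forall>g\<in>unip_radical V line0. map_tensor V d g t = t} =
    rep d ` tableau.level d n rw cl (int l1)"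
proof -
  interpret T: tableau d l1 n rw cl ht by (rule T)
  have sup: "T.schur_words \<subseteq> supported d" using T.schur_words_support by (auto simp: supported_def)
  have mt: "map_tensor V d g (rep d c) = rep d (mat_act n d (\<lambda>a b. co (g (bas b)) a) c)" if "g \<in> unip_radical V line0" for g c
    by (rule map_tensor_rep[OF witt_space_axioms witt_space_axioms unip_radical_matrix(1)[OF that]])
      (use that in \<open>auto simp: unip_radical_def orth_group_def\<close>)
  have key: "(\<forall>g\<in>unip_radical V line0. map_tensor V d g (rep d c) = rep d c) \<longleftrightarrow> c \<in> T.level (int l1)"
    if c: "c \<in> T.schur_words" for c
  proof
    assume inv: "\<forall>g\<in>unip_radical V line0. map_tensor V d g (rep d c) = rep d c"
    have "mat_act n d (eichler n y s) c = c" if y: "1 \<le> y" "y < n - 1" for y s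
    proof -
      obtain g where g: "g \<in> unip_radical V line0" "\<forall>a<n. \<forall>b<n. co (g (bas b)) a = eichler n y s a b"
        using eichler_unip_radical[OF y] by blast
      have "mat_act n d (\<lambda>a b. co (g (bas b)) a) c = mat_act n d (eichler n y s) c"
        using g(2) by (intro mat_act_cong) simp
      then have "rep d (mat_act n d (eichler n y s) c) = rep d c" using mt[OF g(1), of c] inv g(1) by simp
      then show ?thesis using rep_inj[of d] mat_act_supported c sup by (auto simp: inj_on_def)
    qed
    then show "c \<in> T.level (int l1)" using T.level_top_iff_invariant[OF c] by blast
  next
    assume l: "c \<in> T.level (int l1)"
    have top: "weight n w = int l1" if "c w \<noteq> 0" for w
      using l T.schur_words_weight_bounds(2)[OF c that] that by (auto simp: T.level_def intro: antisym)
    show "\<forall>g\<in>unip_radical V line0. map_tensor V d g (rep d c) = rep d c"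
    proof
      fix g assume g: "g \<in> unip_radical V line0"
      have "mat_act n d (\<lambda>a b. co (g (bas b)) a) c = c"
        by (rule T.mat_act_fixes_top[OF c top]) (use unip_radical_matrix(2,3)[OF g] in auto)
      then show "map_tensor V d g (rep d c) = rep d c" using mt[OF g] by simp
    qed
  qed
  show ?thesis using key T.level_subset by blast
qed

end

section \<open>The form of a lattice of signature (2, n)\<close>

lemma lform_add_left: "lform G (x + y) z = lform G x z + lform G y z"
  by (simp add: lform_def distrib_left distrib_right sum.distrib)

lemma lform_add_right: "lform G z (x + y) = lform G z x + lform G z y"
  by (simp add: lform_def distrib_left sum.distrib)

lemma lform_scale_left: "lform G (c *s x) z = c * lform G x z"
  by (simp add: lform_def sum_distrib_left mult_ac)

lemma lform_scale_right: "lform G z (c *s x) = c * lform G z x"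
  by (simp add: lform_def sum_distrib_left mult_ac)

lemma lform_minus_left: "lform G (- x) z = - lform G x z"
  by (simp add: lform_def sum_negf)

lemma lform_minus_right: "lform G z (- x) = - lform G z x"
  by (simp add: lform_def sum_negf)

lemma lform_diff_left: "lform G (x - y) z = lform G x z - lform G y z"
  using lform_add_left[of G x "- y" z] by (simp add: lform_minus_left)

lemma lform_diff_right: "lform G z (x - y) = lform G z x - lform G z y"
  using lform_add_right[of G z x "- y"] by (simp add: lform_minus_right)

lemma lform_0_left: "lform G 0 z = 0" by (simp add: lform_def)
lemma lform_0_right: "lform G z 0 = 0" by (simp add: lform_def)

lemma lform_sum_left: "lform G (\<Sum>i\<in>I. f i) z = (\<Sum>i\<in>I. lform G (f i) z)"
  by (induction I rule: infinite_finite_induct) (simp_all add: lform_add_left lform_0_left)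

lemmas lform_simps = lform_add_left lform_add_right lform_scale_left lform_scale_right
  lform_diff_left lform_diff_right lform_minus_left lform_minus_right lform_0_left lform_0_right

lemma lform_axis: "lform G (axis i 1) (axis j 1 :: int ^ 'm) = G $ i $ j"
  by (simp add: lform_def axis_def if_distrib[of "\<lambda>x. _ * x"] if_distrib[of "\<lambda>x. x * _"] cong: if_cong)

lemma lform_sym:
  assumes "lattice_form G" shows "lform G x y = lform G y x"
proof -
  have "G $ i $ j = G $ j $ i" for i j
    using assms lform_axis[of G i j] lform_axis[of G j i] by (simp add: lattice_form_def)
  then have "lform G x y = (\<Sum>i\<in>UNIV. \<Sum>j\<in>UNIV. of_int (G $ j $ i) * y $ j * x $ i)"
    unfolding lform_def by (intro sum.cong refl) (simp add: mult_ac)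
  also have "\<dots> = lform G y x" unfolding lform_def by (rule sum.swap)
  finally show ?thesis .
qed

text \<open>
  Complex vectors are handled through their real and imaginary parts, since the signature concerns real vectors.
\<close>

definition cvec :: "real ^ 'm \<Rightarrow> complex ^ 'm" where "cvec x = (\<chi> i. of_real (x $ i))"
definition re_vec :: "complex ^ 'm \<Rightarrow> real ^ 'm" where "re_vec x = (\<chi> i. Re (x $ i))"
definition im_vec :: "complex ^ 'm \<Rightarrow> real ^ 'm" where "im_vec x = (\<chi> i. Im (x $ i))"

lemma lform_cvec: "lform G (cvec x) (cvec y) = of_real (lform G x y)"
  by (simp add: lform_def cvec_def)

lemma cvec_decompose: "x = cvec (re_vec x) + \<i> *s cvec (im_vec x)"
  by (simp add: vec_eq_iff cvec_def re_vec_def im_vec_def complex_eq_iff)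

lemma cnj_decompose: "(\<chi> i. cnj (x $ i)) = cvec (re_vec x) - \<i> *s cvec (im_vec x)"
  by (simp add: vec_eq_iff cvec_def re_vec_def im_vec_def complex_eq_iff)

lemma lform_cvec_right: "lform G x (cvec v) = Complex (lform G (re_vec x) v) (lform G (im_vec x) v)"
  by (subst cvec_decompose[of x]) (simp add: lform_simps lform_cvec complex_eq_iff)

lemma lform_self_parts:
  assumes "lattice_form G"
  shows "lform G w w = Complex (lform G (re_vec w) (re_vec w) - lform G (im_vec w) (im_vec w)) (2 * lform G (re_vec w) (im_vec w))"
    and "Re (lform G w (\<chi> i. cnj (w $ i))) = lform G (re_vec w) (re_vec w) + lform G (im_vec w) (im_vec w)"
proof -
  have s: "lform G (im_vec w) (re_vec w) = lform G (re_vec w) (im_vec w)" using assms by (rule lform_sym)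
  have "lform G w w = lform G (cvec (re_vec w) + \<i> *s cvec (im_vec w)) (cvec (re_vec w) + \<i> *s cvec (im_vec w))"
    using cvec_decompose[of w] by simp
  also have "\<dots> = Complex (lform G (re_vec w) (re_vec w) - lform G (im_vec w) (im_vec w)) (2 * lform G (re_vec w) (im_vec w))"
    by (simp add: lform_simps lform_cvec s complex_eq_iff)
  finally show "lform G w w = Complex (lform G (re_vec w) (re_vec w) - lform G (im_vec w) (im_vec w)) (2 * lform G (re_vec w) (im_vec w))" .
  have "lform G w (\<chi> i. cnj (w $ i)) = lform G (cvec (re_vec w) + \<i> *s cvec (im_vec w)) (cvec (re_vec w) - \<i> *s cvec (im_vec w))"
    using cvec_decompose[of w] cnj_decompose[of w] by simp
  then show "Re (lform G w (\<chi> i. cnj (w $ i))) = lform G (re_vec w) (re_vec w) + lform G (im_vec w) (im_vec w)"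
    by (simp add: lform_simps lform_cvec s)
qed

definition orthogonal_frame :: "int ^ 'm ^ 'm \<Rightarrow> nat \<Rightarrow> ('m \<Rightarrow> real ^ 'm) \<Rightarrow> bool" where
  "orthogonal_frame G p b \<longleftrightarrow> (\<forall>i j. i \<noteq> j \<longrightarrow> lform G (b i) (b j) = 0) \<and> (\<forall>i. lform G (b i) (b i) \<noteq> 0) \<and>
     card {i. lform G (b i) (b i) > 0} = p \<and>
     (\<forall>x. x = (\<Sum>i\<in>UNIV. (lform G x (b i) / lform G (b i) (b i)) *s b i))"

lemma signature_basis:
  fixes G :: "int ^ 'm ^ 'm"
  assumes "has_signature G p q"
  shows "\<exists>b :: 'm \<Rightarrow> real ^ 'm. orthogonal_frame G p b"
proof -
  obtain b :: "'m \<Rightarrow> real ^ 'm" where inj: "inj b" and ind: "independent (range b)"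
    and orth: "\<And>i j. i \<noteq> j \<Longrightarrow> lform G (b i) (b j) = 0"
    and P: "card {i. lform G (b i) (b i) > 0} = p" and N: "card {i. lform G (b i) (b i) < 0} = q"
    and pq: "p + q = CARD('m)"
    using assms unfolding has_signature_def by blast
  have nz: "lform G (b i) (b i) \<noteq> 0" for i
  proof -
    have "card ({i. lform G (b i) (b i) > 0} \<union> {i. lform G (b i) (b i) < 0}) = CARD('m)"
      using P N pq by (subst card_Un_disjoint) auto
    then have "{i. lform G (b i) (b i) > 0} \<union> {i. lform G (b i) (b i) < 0} = UNIV"
      by (intro card_subset_eq) auto
    then have "i \<in> {i. lform G (b i) (b i) > 0} \<union> {i. lform G (b i) (b i) < 0}" by simp
    then show ?thesis by auto
  qed
  have ex: "x = (\<Sum>i\<in>UNIV. (lform G x (b i) / lform G (b i) (b i)) *s b i)" for x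
  proof -
    have "card (range b) = CARD('m)" using inj by (simp add: card_image)
    then have "UNIV \<subseteq> span (range b)" using ind by (intro card_ge_dim_independent) auto
    then have "x \<in> span (range b)" by blast
    then obtain u where "x = (\<Sum>v\<in>range b. u v *\<^sub>R v)" unfolding span_finite[OF finite_imageI[OF finite]] by auto
    then have x: "x = (\<Sum>i\<in>UNIV. u (b i) *s b i)" using inj by (simp add: sum.reindex scalar_mult_eq_scaleR)
    have "lform G x (b j) = u (b j) * lform G (b j) (b j)" for j
    proof -
      have "lform G x (b j) = (\<Sum>i\<in>UNIV. u (b i) * lform G (b i) (b j))"
        by (subst x) (simp add: lform_sum_left lform_scale_left)
      also have "\<dots> = (\<Sum>i\<in>UNIV. if i = j then u (b j) * lform G (b j) (b j) else 0)"
        by (intro sum.cong refl) (use orth in auto)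
      finally show ?thesis by simp
    qed
    then have "lform G x (b j) / lform G (b j) (b j) = u (b j)" for j using nz[of j] by simp
    then show ?thesis using x by simp
  qed
  show ?thesis
    unfolding orthogonal_frame_def
    by (intro exI[of _ b] conjI allI impI) (fact orth nz P ex)+
qed

text \<open>
  The cross product of the two rows of coefficients, unless these are proportional.
\<close>

lemma nontrivial_solution:
  fixes a1 b1 c1 a2 b2 c2 :: real
  shows "\<exists>x y z. (x \<noteq> 0 \<or> y \<noteq> 0 \<or> z \<noteq> 0) \<and> x * a1 + y * b1 + z * c1 = 0 \<and> x * a2 + y * b2 + z * c2 = 0"
proof -
  have wit: ?thesis if "x \<noteq> 0 \<or> y \<noteq> 0 \<or> z \<noteq> 0" "x * a1 + y * b1 + z * c1 = 0" "x * a2 + y * b2 + z * c2 = 0" for x y z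
    using that by blast
  show ?thesis
  proof (cases "b1 * c2 - c1 * b2 = 0 \<and> c1 * a2 - a1 * c2 = 0 \<and> a1 * b2 - b1 * a2 = 0")
    case False
    show ?thesis
      by (rule wit[of "b1 * c2 - c1 * b2" "c1 * a2 - a1 * c2" "a1 * b2 - b1 * a2"])
        (use False in blast, algebra, algebra)
  next
    case True
    have minors: "c1 * a2 = a1 * c2" "a1 * b2 = b1 * a2" using True by auto
    consider "a1 \<noteq> 0" | "a1 = 0" "b1 \<noteq> 0 \<or> c1 \<noteq> 0" | "a1 = 0" "b1 = 0" "c1 = 0" "a2 \<noteq> 0" | "a1 = 0" "b1 = 0" "c1 = 0" "a2 = 0"
      by blast
    then show ?thesis
    proof cases
      case 1
      show ?thesis by (rule wit[of b1 "- a1" 0]) (use 1 minors in \<open>simp_all\<close>)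
    next
      case 2
      have "a2 = 0" using minors 2 by auto
      then show ?thesis using 2 by (intro wit[of 1 0 0]) simp_all
    next
      case 3
      show ?thesis by (rule wit[of b2 "- a2" 0]) (use 3 in \<open>simp_all\<close>)
    next
      case 4
      show ?thesis by (rule wit[of 1 0 0]) (use 4 in \<open>simp_all\<close>)
    qed
  qed
qed

text \<open>
  The three vectors \<open>a, c, v\<close> have a nontrivial linear combination \<open>u\<close> orthogonal to the two positive vectors of an
  orthogonal basis.  Its norm is both nonpositive and equal to \<open>x\<^sup>2 + y\<^sup>2\<close> times that of \<open>a\<close>, hence zero; then \<open>u\<close>
  is a multiple of \<open>v\<close>, and it is zero because the form is definite on the span of the negative basis vectors.
\<close>

lemma positive_plane_perp:
  fixes G :: "int ^ 'm ^ 'm"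
  assumes lat: "lattice_form G" and sig: "has_signature G 2 n"
    and pos: "lform G a a = lform G c c" "lform G a a > 0" "lform G a c = 0"
    and v: "lform G v v = (0::real)" "lform G a v = 0" "lform G c v = 0"
  shows "v = 0"
proof -
  obtain b :: "'m \<Rightarrow> real ^ 'm" where b: "orthogonal_frame G 2 b"
    using signature_basis[OF sig] ..
  note frame = b[unfolded orthogonal_frame_def, THEN conjunct2]
  have nz: "lform G (b i) (b i) \<noteq> 0" for i using frame[THEN conjunct1] by (rule spec)
  have P: "card {i. lform G (b i) (b i) > 0} = 2" using frame[THEN conjunct2, THEN conjunct1] .
  have ex: "x = (\<Sum>i\<in>UNIV. (lform G x (b i) / lform G (b i) (b i)) *s b i)" for x
    using frame[THEN conjunct2, THEN conjunct2] by (rule spec)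
  obtain i j where ij: "{i. lform G (b i) (b i) > 0} = {i, j}" using P unfolding card_2_iff by blast
  obtain x y z where xyz: "x \<noteq> 0 \<or> y \<noteq> 0 \<or> z \<noteq> 0"
    "x * lform G a (b i) + y * lform G c (b i) + z * lform G v (b i) = 0"
    "x * lform G a (b j) + y * lform G c (b j) + z * lform G v (b j) = 0"
    using nontrivial_solution[of "lform G a (b i)" "lform G c (b i)" "lform G v (b i)" "lform G a (b j)" "lform G c (b j)" "lform G v (b j)"]
    by (elim exE conjE)
  define u where "u = x *s a + y *s c + z *s v"
  have ub: "lform G u (b k) = 0" if "lform G (b k) (b k) > 0" for k
  proof -
    have "k = i \<or> k = j" using ij that by blast
    then show ?thesis using xyz(2,3) by (auto simp: u_def lform_simps)
  qed
  have sym: "lform G c a = 0" "lform G v a = 0" "lform G v c = 0"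
    using pos(3) v(2,3) lform_sym[OF lat] by metis+
  have uu: "lform G u u = (x\<^sup>2 + y\<^sup>2) * lform G a a"
    using pos v sym by (simp add: u_def lform_simps power2_eq_square algebra_simps)
  have s: "lform G u u = (\<Sum>k\<in>UNIV. (lform G u (b k))\<^sup>2 / lform G (b k) (b k))"
    by (subst (1) ex[of u]) (simp add: lform_sum_left lform_scale_left lform_sym[OF lat, of _ u] power2_eq_square)
  have le: "(lform G u (b k))\<^sup>2 / lform G (b k) (b k) \<le> 0" for k
    using ub[of k] nz[of k] by (cases "lform G (b k) (b k) > 0") (auto simp: divide_nonneg_neg)
  have le0: "lform G u u \<le> 0" unfolding s by (rule sum_nonpos) (rule le)
  have z0: "(lform G u (b k))\<^sup>2 / lform G (b k) (b k) = 0" if "lform G u u = 0" for k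
  proof -
    have "(\<Sum>k\<in>UNIV. - ((lform G u (b k))\<^sup>2 / lform G (b k) (b k))) = 0" using s that by (simp add: sum_negf)
    moreover have "0 \<le> - ((lform G u (b k))\<^sup>2 / lform G (b k) (b k))" for k using le[of k] by linarith
    ultimately have "\<forall>k\<in>UNIV. - ((lform G u (b k))\<^sup>2 / lform G (b k) (b k)) = 0"
      by (subst (asm) sum_nonneg_eq_0_iff) auto
    then show ?thesis by simp
  qed
  have "x\<^sup>2 + y\<^sup>2 \<le> 0" using le0 uu pos(2) by (simp add: mult_le_0_iff)
  then have xy: "x = 0" "y = 0" by (auto simp: sum_power2_le_zero_iff)
  then have uz: "lform G u u = 0" using uu by simp
  have "lform G u (b k) = 0" for k using z0[OF uz, of k] nz[of k] by simp
  then have "u = 0" using ex[of u] by simp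
  then have "z *s v = 0" using xy by (simp add: u_def)
  then show ?thesis using xyz(1) xy by (simp add: vector_mul_eq_0)
qed

lemma lform_nondegenerate:
  fixes G :: "int ^ 'm ^ 'm" and x :: "complex ^ 'm"
  assumes sig: "has_signature G p q" and x: "\<And>y. lform G x y = 0"
  shows "x = 0"
proof -
  obtain b :: "'m \<Rightarrow> real ^ 'm" where b: "orthogonal_frame G p b"
    using signature_basis[OF sig] ..
  have ex: "x = (\<Sum>i\<in>UNIV. (lform G x (b i) / lform G (b i) (b i)) *s b i)" for x
    using b unfolding orthogonal_frame_def by (elim conjE) (rule spec)
  have "lform G (re_vec x) v = 0" "lform G (im_vec x) v = 0" for v
    using x[of "cvec v"] by (simp_all add: lform_cvec_right complex_eq_iff)
  then have "re_vec x = 0" "im_vec x = 0" using ex[of "re_vec x"] ex[of "im_vec x"] by simp_all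
  then show ?thesis using cvec_decompose[of x] by (simp add: cvec_def vec_eq_iff)
qed

text \<open>
  The real and imaginary parts of \<open>w\<close> span a positive definite plane, and a nonzero isotropic vector cannot be
  orthogonal to it.
\<close>

lemma period_not_perp:
  fixes G :: "int ^ 'm ^ 'm" and w :: "complex ^ 'm"
  assumes lat: "lattice_form G" and sig: "has_signature G 2 n"
    and w: "lform G w w = 0" "Re (lform G w (\<chi> i. cnj (w $ i))) > 0"
    and v: "lform G v v = (0::real)" "v \<noteq> 0"
  shows "lform G (cvec v) w \<noteq> 0"
proof
  assume "lform G (cvec v) w = 0"
  then have "lform G w (cvec v) = 0" using lform_sym[OF lat] by metis
  then have wv: "lform G (re_vec w) v = 0" "lform G (im_vec w) v = 0"
    by (simp_all add: lform_cvec_right complex_eq_iff)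
  have "lform G (re_vec w) (re_vec w) = lform G (im_vec w) (im_vec w)" "lform G (re_vec w) (im_vec w) = 0"
    using w(1) lform_self_parts(1)[OF lat, of w] by (simp_all add: complex_eq_iff)
  moreover from this have "lform G (re_vec w) (re_vec w) > 0"
    using w(2) lform_self_parts(2)[OF lat, of w] by simp
  ultimately have "v = 0" using positive_plane_perp[OF lat sig _ _ _ v(1) wv] by blast
  then show False using v(2) by simp
qed

section \<open>Witt bases\<close>

definition nondeg_on :: "int ^ 'm ^ 'm \<Rightarrow> (complex ^ 'm) set \<Rightarrow> bool" where
  "nondeg_on G T \<longleftrightarrow> vec.subspace T \<and> (\<forall>x\<in>T. (\<forall>y\<in>T. lform G x y = 0) \<longrightarrow> x = 0)"

lemma perp_subspace: "vec.subspace T \<Longrightarrow> vec.subspace {s \<in> T. lform G s p = 0 \<and> lform G s q = 0}"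
  by (auto simp: vec.subspace_def lform_simps)

text \<open>
  The plane spanned by \<open>p\<close> and \<open>q\<close> is nondegenerate, so the space is its direct sum with its orthogonal complement.
\<close>

lemma hyperbolic_split:
  fixes G :: "int ^ 'm ^ 'm"
  assumes lat: "lattice_form G" and T: "nondeg_on G T" and pq: "p \<in> T" "q \<in> T" "lform G p p = 0" "lform G p q \<noteq> 0"
  defines "S \<equiv> {s \<in> T. lform G s p = 0 \<and> lform G s q = 0}"
  shows "nondeg_on G S" "vec.dim T = vec.dim S + 2" "\<And>t. t \<in> T \<Longrightarrow> \<exists>a b. t - a *s p - b *s q \<in> S"
proof -
  have sT: "vec.subspace T" using T by (simp add: nondeg_on_def)
  have sS: "vec.subspace S" unfolding S_def using sT by (rule perp_subspace)
  have sym: "lform G q p = lform G p q" using lat by (rule lform_sym)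
  show dec: "\<exists>a b. t - a *s p - b *s q \<in> S" if t: "t \<in> T" for t
  proof -
    \<comment> \<open>The coefficients are determined by the products with \<open>p\<close> and then with \<open>q\<close>.\<close>
    define b where "b = lform G t p / lform G p q"
    define a where "a = (lform G t q - b * lform G q q) / lform G p q"
    have "t - a *s p - b *s q \<in> T" using t pq sT by (simp add: vec.subspace_diff vec.subspace_scale)
    moreover have "lform G (t - a *s p - b *s q) p = 0" "lform G (t - a *s p - b *s q) q = 0"
      using pq sym by (simp_all add: lform_simps a_def b_def)
    ultimately show ?thesis unfolding S_def by blast
  qed
  have ST: "s \<in> S \<Longrightarrow> s \<in> T \<and> lform G s p = 0 \<and> lform G s q = 0" for s by (simp add: S_def)
  show "nondeg_on G S"
    unfolding nondeg_on_def
  proof (intro conjI ballI impI sS)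
    fix s assume s: "s \<in> S" "\<forall>y\<in>S. lform G s y = 0"
    have "lform G s t = 0" if t: "t \<in> T" for t
    proof -
      obtain a b where "t - a *s p - b *s q \<in> S" using dec[OF t] by blast
      then have "lform G s (t - a *s p - b *s q) = 0" using s by blast
      then show ?thesis using ST[OF s(1)] by (simp add: lform_simps)
    qed
    then show "s = 0" using T ST[OF s(1)] by (simp add: nondeg_on_def)
  qed
  have spS: "vec.span S = S" using sS by (simp add: vec.span_eq_iff)
  have q: "q \<notin> vec.span S" unfolding spS using ST[of q] sym pq(4) by auto
  have p: "p \<notin> vec.span (insert q S)"
  proof
    assume "p \<in> vec.span (insert q S)"
    then obtain k where k: "p - k *s q \<in> S" unfolding vec.span_breakdown_eq spS by blast
    have "lform G (p - k *s q) p = 0" using ST[OF k] by blast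
    then have "k * lform G p q = 0" using pq(3) sym by (simp add: lform_diff_left lform_scale_left)
    then have "p \<in> S" using k pq(4) by simp
    then show False using ST pq(4) by blast
  qed
  have "T = vec.span (insert p (insert q S))"
  proof
    show "T \<subseteq> vec.span (insert p (insert q S))"
    proof
      fix t assume "t \<in> T"
      then obtain a b where "t - a *s p - b *s q \<in> S" using dec by blast
      then show "t \<in> vec.span (insert p (insert q S))" unfolding vec.span_breakdown_eq spS by blast
    qed
    show "vec.span (insert p (insert q S)) \<subseteq> T"
      using pq ST sT by (intro vec.span_minimal) auto
  qed
  then have "vec.dim T = vec.dim (insert p (insert q S))" by simp
  also have "\<dots> = vec.dim S + 2" using p q by (simp add: vec.dim_insert)
  finally show "vec.dim T = vec.dim S + 2" .
qed

text \<open>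
  Over \<open>\<complex>\<close>, a suitable combination of two orthogonal anisotropic vectors is isotropic.
\<close>

lemma isotropic_vector_exists:
  fixes G :: "int ^ 'm ^ 'm"
  assumes lat: "lattice_form G" and T: "nondeg_on G T" and dim: "2 \<le> vec.dim T"
  shows "\<exists>p\<in>T. p \<noteq> 0 \<and> lform G p p = 0"
proof (cases "\<exists>q\<in>T. lform G q q \<noteq> 0")
  case False
  have "\<not> T \<subseteq> {0}" using dim vec.dim_eq_0[of T] by linarith
  then show ?thesis using False by blast
next
  case True
  then obtain q where q: "q \<in> T" "lform G q q \<noteq> 0" by blast
  have sT: "vec.subspace T" using T by (simp add: nondeg_on_def)
  define T' where "T' = {t \<in> T. lform G t q = 0}"
  have "T \<subseteq> vec.span (insert q T')"
  proof
    fix t assume t: "t \<in> T"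
    define k where "k = lform G t q / lform G q q"
    have "t - k *s q \<in> T'" using t q sT by (simp add: T'_def k_def lform_simps vec.subspace_diff vec.subspace_scale)
    then show "t \<in> vec.span (insert q T')" unfolding vec.span_breakdown_eq using vec.span_base by blast
  qed
  then have "vec.dim T \<le> vec.dim (insert q T')" by (rule vec.dim_mono)
  also have "\<dots> \<le> vec.dim T' + 1" by (simp add: vec.dim_insert)
  finally have "vec.dim T' \<noteq> 0" using dim by linarith
  then have "\<not> T' \<subseteq> {0}" unfolding vec.dim_eq_0 .
  then obtain r where r: "r \<in> T'" "r \<noteq> 0" by blast
  show ?thesis
  proof (cases "lform G r r = 0")
    case True
    then show ?thesis using r by (auto simp: T'_def)
  next
    case False
    \<comment> \<open>The root is chosen such that the norms of \<open>r\<close> and \<open>k q\<close> cancel.\<close>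
    define k where "k = csqrt (- lform G r r / lform G q q)"
    have k2: "k * k = - lform G r r / lform G q q" unfolding k_def using power2_csqrt[of "- lform G r r / lform G q q"] by (simp add: power2_eq_square)
    have k0: "k \<noteq> 0" using False q(2) by (simp add: k_def)
    have rq: "lform G r q = 0" "lform G q r = 0" "r \<in> T" using r lform_sym[OF lat, of q r] by (auto simp: T'_def)
    have "lform G (r + k *s q) (r + k *s q) = lform G r r + (k * k) * lform G q q"
      using rq by (simp add: lform_simps)
    also have "\<dots> = 0" using q(2) by (simp add: k2)
    finally have "lform G (r + k *s q) (r + k *s q) = 0" .
    moreover have "lform G (r + k *s q) q \<noteq> 0" using rq k0 q(2) by (simp add: lform_simps)
    then have "r + k *s q \<noteq> 0" by (metis lform_0_left)
    moreover have "r + k *s q \<in> T" using rq q sT by (simp add: vec.subspace_add vec.subspace_scale)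
    ultimately show ?thesis by blast
  qed
qed

text \<open>
  The last condition expresses that the vectors span \<open>T\<close>.
\<close>

definition witt_basis :: "int ^ 'm ^ 'm \<Rightarrow> (complex ^ 'm) set \<Rightarrow> nat \<Rightarrow> (nat \<Rightarrow> complex ^ 'm) \<Rightarrow> bool" where
  "witt_basis G T k v \<longleftrightarrow> (\<forall>x<k. v x \<in> T) \<and> (\<forall>x<k. \<forall>y<k. lform G (v x) (v y) = of_bool (x + y = k - 1)) \<and>
     (\<forall>t\<in>T. (\<forall>x<k. lform G t (v x) = 0) \<longrightarrow> t = 0)"

text \<open>
  Complete \<open>p\<close> to a hyperbolic pair \<open>p, q\<close> and put a basis of the orthogonal complement in between.
\<close>

lemma witt_basis_extend:
  fixes G :: "int ^ 'm ^ 'm"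
  assumes lat: "lattice_form G" and T: "nondeg_on G T" and p: "p \<in> T" "p \<noteq> 0" "lform G p p = 0"
    and IH: "\<And>S. nondeg_on G S \<Longrightarrow> vec.dim T = vec.dim S + 2 \<Longrightarrow> \<exists>v. witt_basis G S (vec.dim S) v"
  shows "\<exists>v. witt_basis G T (vec.dim T) v \<and> v 0 = p"
proof -
  have sT: "vec.subspace T" using T by (simp add: nondeg_on_def)
  obtain q0 where q0: "q0 \<in> T" "lform G p q0 \<noteq> 0" using T p by (auto simp: nondeg_on_def)
  define q1 where "q1 = (1 / lform G p q0) *s q0"
  have q1: "q1 \<in> T" "lform G p q1 = 1" using q0 sT by (simp_all add: q1_def vec.subspace_scale lform_simps)
  have q1': "lform G q1 p = 1" using q1 lform_sym[OF lat] by metis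
  define q where "q = q1 - (lform G q1 q1 / 2) *s p"
  have q: "q \<in> T" "lform G p q = 1" "lform G q p = 1" "lform G q q = 0"
    using q1 q1' p sT by (simp_all add: q_def vec.subspace_diff vec.subspace_scale lform_simps)
  define S where "S = {s \<in> T. lform G s p = 0 \<and> lform G s q = 0}"
  have pq: "lform G p q \<noteq> 0" using q by simp
  note split = hyperbolic_split[OF lat T p(1) q(1) p(3) pq, folded S_def]
  obtain v where v: "witt_basis G S (vec.dim S) v" using IH[OF split(1,2)] by blast
  define k where "k = vec.dim S"
  have vS: "v x \<in> S" "v x \<in> T" "lform G (v x) p = 0" "lform G (v x) q = 0" "lform G p (v x) = 0" "lform G q (v x) = 0" if "x < k" for x
  proof -
    show s: "v x \<in> S" using v that by (simp add: witt_basis_def k_def)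
    then show "v x \<in> T" "lform G (v x) p = 0" "lform G (v x) q = 0" by (auto simp: S_def)
    then show "lform G p (v x) = 0" "lform G q (v x) = 0" using lform_sym[OF lat] by metis+
  qed
  have vv: "lform G (v x) (v y) = of_bool (x + y = k - 1)" if "x < k" "y < k" for x y
    using v that by (simp add: witt_basis_def k_def)
  define u where "u x = (if x = 0 then p else if x = k + 1 then q else v (x - 1))" for x
  have "witt_basis G T (k + 2) u"
    unfolding witt_basis_def
  proof (intro conjI allI impI ballI)
    fix x assume "x < k + 2"
    then show "u x \<in> T" using p q vS(2)[of "x - 1"] by (auto simp: u_def)
  next
    fix x y assume xy: "x < k + 2" "y < k + 2"
    consider "x = 0" | "x = k + 1" | "0 < x" "x < k + 1" using xy by linarith
    then show "lform G (u x) (u y) = of_bool (x + y = k + 2 - 1)"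
    proof cases
      case 1
      consider "y = 0" | "y = k + 1" | "0 < y" "y < k + 1" using xy by linarith
      then show ?thesis using 1 p q vS(5)[of "y - 1"] by cases (auto simp: u_def)
    next
      case 2
      consider "y = 0" | "y = k + 1" | "0 < y" "y < k + 1" using xy by linarith
      then show ?thesis using 2 p q vS(6)[of "y - 1"] by cases (auto simp: u_def)
    next
      case 3
      consider "y = 0" | "y = k + 1" | "0 < y" "y < k + 1" using xy by linarith
      then show ?thesis
      proof cases
        case 1
        then show ?thesis using 3 vS(3)[of "x - 1"] by (auto simp: u_def)
      next
        case 2
        then show ?thesis using 3 vS(4)[of "x - 1"] by (auto simp: u_def)
      next
        case y: 3
        have "lform G (u x) (u y) = of_bool (x - 1 + (y - 1) = k - 1)"
          using 3 y vv[of "x - 1" "y - 1"] by (simp add: u_def)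
        moreover have "(x - 1 + (y - 1) = k - 1) = (x + y = k + 2 - 1)" using 3 y by auto
        ultimately show ?thesis by simp
      qed
    qed
  next
    fix t assume t: "t \<in> T" "\<forall>x<k + 2. lform G t (u x) = 0"
    have "lform G t p = 0" using t(2)[rule_format, of 0] by (simp add: u_def)
    moreover have "lform G t q = 0" using t(2)[rule_format, of "k + 1"] by (simp add: u_def)
    ultimately have tS: "t \<in> S" using t(1) by (simp add: S_def)
    have "lform G t (v x) = 0" if "x < k" for x
      using t(2)[rule_format, of "x + 1"] that by (simp add: u_def)
    then show "t = 0" using v tS by (simp add: witt_basis_def k_def)
  qed
  moreover have "vec.dim T = k + 2" using split(2) by (simp add: k_def)
  ultimately show ?thesis by (intro exI[of _ u]) (simp add: u_def)
qed

lemma witt_basis_exists: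
  fixes G :: "int ^ 'm ^ 'm"
  assumes lat: "lattice_form G" and "nondeg_on G T"
  shows "\<exists>v. witt_basis G T (vec.dim T) v"
  using assms(2)
proof (induction "vec.dim T" arbitrary: T rule: less_induct)
  case less
  have T: "nondeg_on G T" by (rule less.prems)
  have sT: "vec.subspace T" using T by (simp add: nondeg_on_def)
  consider "vec.dim T = 0" | "vec.dim T = 1" | "2 \<le> vec.dim T" by linarith
  then show ?case
  proof cases
    case 1
    then have "T \<subseteq> {0}" using vec.dim_eq_0[of T] by blast
    then have "witt_basis G T (vec.dim T) v" for v unfolding witt_basis_def 1 by auto
    then show ?thesis by blast
  next
    case 2
    then obtain u where u: "u \<in> T" "u \<noteq> 0" using vec.dim_eq_0[of T] by auto
    have uu: "lform G u u \<noteq> 0"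
    proof
      assume z: "lform G u u = 0"
      obtain t where "t \<in> T" "lform G u t \<noteq> 0" using T u by (auto simp: nondeg_on_def)
      then have "vec.dim T \<ge> 2" using hyperbolic_split(2)[OF lat T u(1) _ z] by force
      then show False using 2 by simp
    qed
    define k where "k = 1 / csqrt (lform G u u)"
    have k2: "k * k * lform G u u = 1"
      using power2_csqrt[of "lform G u u"] uu by (simp add: k_def power2_eq_square field_simps)
    have k0: "k \<noteq> 0" using k2 by auto
    have "t = 0" if t: "t \<in> T" "lform G t (k *s u) = 0" for t
    proof (rule ccontr)
      assume t0: "t \<noteq> 0"
      have tu: "lform G t u = 0" using t(2) k0 by (simp add: lform_simps)
      have "u \<notin> vec.span {t}"
        using uu tu by (auto simp: vec.span_singleton lform_simps)
      then have "vec.dim {u, t} = 2" using t0 by (simp add: vec.dim_insert)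
      moreover have "vec.dim {u, t} \<le> vec.dim T" using u t by (intro vec.dim_subset) auto
      ultimately show False using 2 by simp
    qed
    then have "witt_basis G T 1 (\<lambda>_. k *s u)"
      using u sT k2 by (simp add: witt_basis_def vec.subspace_scale lform_simps mult.assoc)
    then show ?thesis using 2 by auto
  next
    case 3
    obtain p where p: "p \<in> T" "p \<noteq> 0" "lform G p p = 0" using isotropic_vector_exists[OF lat T 3] by blast
    have "\<exists>v. witt_basis G S (vec.dim S) v" if "nondeg_on G S" "vec.dim T = vec.dim S + 2" for S
      using less.hyps[of S] that by simp
    then show ?thesis using witt_basis_extend[OF lat T p] by blast
  qed
qed

lemma witt_basis_starting:
  fixes G :: "int ^ 'm ^ 'm"
  assumes "lattice_form G" "nondeg_on G T" "p \<in> T" "p \<noteq> 0" "lform G p p = 0"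
  shows "\<exists>v. witt_basis G T (vec.dim T) v \<and> v 0 = p"
  by (rule witt_basis_extend[OF assms]) (rule witt_basis_exists[OF assms(1)])

section \<open>Quotients by an isotropic line\<close>

text \<open>
  Vectors \<open>v x\<close> of \<open>u\<^sup>\<bottom>\<close> whose cosets form a basis of \<open>u\<^sup>\<bottom>/\<complex>u\<close> with antidiagonal Gram matrix.
\<close>

locale isotropic_quotient =
  fixes G :: "int ^ 'm ^ 'm" and u :: "complex ^ 'm" and v :: "nat \<Rightarrow> complex ^ 'm" and n :: nat
  assumes lat: "lattice_form G" and uu: "lform G u u = 0"
    and vu: "x < n \<Longrightarrow> lform G (v x) u = 0"
    and vv: "x < n \<Longrightarrow> y < n \<Longrightarrow> lform G (v x) (v y) = of_bool (x + y = n - 1)"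
    and complete: "lform G t u = 0 \<Longrightarrow> (\<And>x. x < n \<Longrightarrow> lform G t (v x) = 0) \<Longrightarrow> t \<in> vec.span {u}"
    and n3: "n \<ge> 3"
begin

abbreviation Q where "Q \<equiv> quot_space G (perp G (vec.span {u})) (vec.span {u})"

definition cls :: "complex ^ 'm \<Rightarrow> (complex ^ 'm) set" where
  "cls x = x +o vec.span {u}"

definition qbas :: "nat \<Rightarrow> (complex ^ 'm) set" where "qbas x = cls (v x)"

definition qco :: "(complex ^ 'm) set \<Rightarrow> nat \<Rightarrow> complex" where
  "qco A x = qform Q A (qbas (n - 1 - x))"

text \<open>
  The radical of the form on \<open>u\<^sup>\<bottom>\<close> contains the line of \<open>u\<close>, so that the form descends to the quotient.
\<close>

lemma uu_span: "a \<in> vec.span {u} \<Longrightarrow> lform G x u = 0 \<Longrightarrow> lform G x a = 0" "a \<in> vec.span {u} \<Longrightarrow> lform G x u = 0 \<Longrightarrow> lform G a x = 0"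
  using lform_sym[OF lat, of u x] by (auto simp: vec.span_singleton lform_simps)

lemma perp_iff: "x \<in> perp G (vec.span {u}) \<longleftrightarrow> lform G x u = 0"
  unfolding perp_def using uu_span(1) vec.span_base[of u "{u}"] by blast

lemma cls_mem: "y \<in> cls x \<longleftrightarrow> y - x \<in> vec.span {u}"
proof -
  have "(\<exists>b\<in>vec.span {u}. y = x + b) \<longleftrightarrow> y - x \<in> vec.span {u}"
  proof
    assume "y - x \<in> vec.span {u}"
    moreover have "y = x + (y - x)" by simp
    ultimately show "\<exists>b\<in>vec.span {u}. y = x + b" by blast
  qed auto
  then show ?thesis by (simp add: cls_def elt_set_plus_def)
qed

lemma cls_self: "x \<in> cls x" by (simp add: cls_mem vec.span_zero)

lemma cls_eq: "cls x = cls y \<longleftrightarrow> x - y \<in> vec.span {u}"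
proof
  assume "cls x = cls y"
  then have "x \<in> cls y" using cls_self by blast
  then show "x - y \<in> vec.span {u}" by (simp add: cls_mem)
next
  assume d: "x - y \<in> vec.span {u}"
  have "z - x \<in> vec.span {u} \<longleftrightarrow> z - y \<in> vec.span {u}" for z
    using vec.span_add[OF _ d, of "z - x"] vec.span_diff[OF _ d, of "z - y"] by auto
  then show "cls x = cls y" by (auto simp: cls_mem)
qed

lemma carr_Q: "carr Q = cls ` {x. lform G x u = 0}"
proof -
  have "perp G (vec.span {u}) = {x. lform G x u = 0}" using perp_iff by blast
  then show ?thesis by (simp add: quot_space_def cls_def[abs_def])
qed

lemma vadd_cls: "vadd Q (cls x) (cls y) = cls (x + y)"
proof -
  have "cls x + cls y = cls (x + y)"
  proof (intro equalityI subsetI)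
    fix z assume "z \<in> cls x + cls y"
    then obtain a b where ab: "z = a + b" "a - x \<in> vec.span {u}" "b - y \<in> vec.span {u}"
      by (auto simp: set_plus_def cls_mem)
    have e: "z - (x + y) = (a - x) + (b - y)" using ab(1) by simp
    show "z \<in> cls (x + y)" unfolding cls_mem e by (rule vec.span_add[OF ab(2,3)])
  next
    fix z assume "z \<in> cls (x + y)"
    then have "z - y \<in> cls x" by (simp add: cls_mem algebra_simps)
    moreover have "z = (z - y) + y" by simp
    ultimately show "z \<in> cls x + cls y" using cls_self unfolding set_plus_def by blast
  qed
  then show ?thesis by (simp add: quot_space_def)
qed

lemma smul_cls: "smul Q k (cls x) = cls (k *s x)"
proof -
  have "(*s) k ` cls x + vec.span {u} = cls (k *s x)"
  proof (intro equalityI subsetI)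
    fix z assume "z \<in> (*s) k ` cls x + vec.span {u}"
    then obtain a b where ab: "z = k *s a + b" "a - x \<in> vec.span {u}" "b \<in> vec.span {u}"
      by (auto simp: set_plus_def cls_mem)
    have e: "z - k *s x = k *s (a - x) + b" using ab(1) by (simp add: vec.scale_right_diff_distrib)
    show "z \<in> cls (k *s x)" unfolding cls_mem e by (rule vec.span_add[OF vec.span_scale[OF ab(2)] ab(3)])
  next
    fix z assume "z \<in> cls (k *s x)"
    then have "z - k *s x \<in> vec.span {u}" by (simp add: cls_mem)
    moreover have "z = k *s x + (z - k *s x)" by simp
    ultimately show "z \<in> (*s) k ` cls x + vec.span {u}" using cls_self[of x] unfolding set_plus_def by blast
  qed
  then show ?thesis by (simp add: quot_space_def)
qed

lemma qform_cls:
  assumes "lform G x u = 0" "lform G y u = 0"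
  shows "qform Q (cls x) (cls y) = lform G x y"
proof -
  have "lform G a b = lform G x y" if "a \<in> cls x" "b \<in> cls y" for a b
  proof -
    have s: "a - x \<in> vec.span {u}" "b - y \<in> vec.span {u}" using that by (auto simp: cls_mem)
    obtain k where k: "a - x = k *s u" using s(1) by (auto simp: vec.span_singleton)
    have "lform G (a - x) u = 0" by (simp only: k lform_scale_left uu mult_zero_right)
    then have "lform G a u = 0" using assms(1) by (simp add: lform_diff_left)
    then have "lform G a (b - y) = 0" using uu_span(1)[OF s(2)] by simp
    moreover have "lform G (a - x) y = 0" using uu_span(2)[OF s(1) assms(2)] .
    ultimately show ?thesis by (simp add: lform_simps)
  qed
  then have "(THE z. \<forall>a\<in>cls x. \<forall>b\<in>cls y. lform G a b = z) = lform G x y"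
    using cls_self by (intro the_equality) metis+
  then show ?thesis by (simp add: quot_space_def)
qed

lemma qco_cls: "lform G x u = 0 \<Longrightarrow> a < n \<Longrightarrow> qco (cls x) a = lform G x (v (n - 1 - a))"
  unfolding qco_def qbas_def by (rule qform_cls) (simp_all add: vu)

lemma coset_expand:
  assumes x: "lform G x u = 0"
  shows "x - (\<Sum>a<n. lform G x (v (n - 1 - a)) *s v a) \<in> vec.span {u}"
proof (rule complete)
  let ?s = "\<Sum>a<n. lform G x (v (n - 1 - a)) *s v a"
  show "lform G (x - ?s) u = 0" using x by (simp add: lform_diff_left lform_sum_left lform_scale_left vu)
  fix y assume y: "y < n"
  have "lform G ?s (v y) = (\<Sum>a<n. if a = n - 1 - y then lform G x (v y) else 0)"
    unfolding lform_sum_left lform_scale_left using y by (intro sum.cong refl) (auto simp: vv)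
  then have "lform G ?s (v y) = lform G x (v y)" using y by simp
  then show "lform G (x - ?s) (v y) = 0" by (simp add: lform_diff_left)
qed

lemma witt: "witt_space Q n qco qbas"
proof
  show "qbas x \<in> carr Q" if "x < n" for x using vu[OF that] by (auto simp: qbas_def carr_Q)
  show "vadd Q A B \<in> carr Q" if "A \<in> carr Q" "B \<in> carr Q" for A B
    using that by (auto simp: carr_Q vadd_cls lform_simps)
  show "smul Q k A \<in> carr Q" if "A \<in> carr Q" for k A
    using that by (auto simp: carr_Q smul_cls lform_simps)
  show "qco (vadd Q A B) x = qco A x + qco B x" if "A \<in> carr Q" "B \<in> carr Q" "x < n" for A B x
    using that by (auto simp: carr_Q vadd_cls qco_cls lform_simps)
  show "qco (smul Q k A) x = k * qco A x" if "A \<in> carr Q" "x < n" for k A x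
    using that by (auto simp: carr_Q smul_cls qco_cls lform_simps)
  show "qco (qbas x) y = of_bool (x = y)" if "x < n" "y < n" for x y
  proof -
    have "(x + (n - 1 - y) = n - 1) = (x = y)" using that by auto
    then show ?thesis using that vv[of x "n - 1 - y"] by (simp add: qbas_def qco_cls vu)
  qed
  show "A = B" if A: "A \<in> carr Q" and B: "B \<in> carr Q" and eq: "\<And>x. x < n \<Longrightarrow> qco A x = qco B x" for A B
  proof -
    obtain a where a: "A = cls a" "lform G a u = 0" using A by (auto simp: carr_Q)
    obtain b where b: "B = cls b" "lform G b u = 0" using B by (auto simp: carr_Q)
    have "a - b \<in> vec.span {u}"
    proof (rule complete)
      show "lform G (a - b) u = 0" using a b by (simp add: lform_simps)
      fix x assume x: "x < n"
      then show "lform G (a - b) (v x) = 0"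
        using eq[of "n - 1 - x"] a b by (simp add: qco_cls lform_diff_left)
    qed
    then show ?thesis using a b by (simp add: cls_eq)
  qed
  show "qform Q A B = (\<Sum>x<n. qco A x * qco B (n - 1 - x))" if A: "A \<in> carr Q" and B: "B \<in> carr Q" for A B
  proof -
    obtain a where a: "A = cls a" "lform G a u = 0" using A by (auto simp: carr_Q)
    obtain b where b: "B = cls b" "lform G b u = 0" using B by (auto simp: carr_Q)
    let ?s = "\<Sum>x<n. lform G a (v (n - 1 - x)) *s v x"
    have "lform G (a - ?s) b = 0" using uu_span(2)[OF coset_expand[OF a(2)] b(2)] .
    then have "qform Q A B = lform G ?s b" using a b by (simp add: qform_cls lform_diff_left)
    also have "\<dots> = (\<Sum>x<n. qco A x * qco B (n - 1 - x))"
      unfolding lform_sum_left lform_scale_left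
      using a b by (intro sum.cong refl) (simp add: qco_cls lform_sym[OF lat, of b])
    finally show ?thesis .
  qed
qed (rule n3)

lemma line0_cls: "witt_space.line0 Q n qco = (\<lambda>k. cls (k *s v 0)) ` UNIV"
proof -
  interpret W: witt_space Q n qco qbas by (rule witt)
  have v0: "lform G (k *s v 0) u = 0" for k using vu[of 0] n3 by (simp add: lform_simps)
  have co0: "qco (cls (k *s v 0)) x = k * of_bool (0 = x)" if "x < n" for k x
    using that n3 v0 vv[of 0 "n - 1 - x"] by (auto simp: qco_cls lform_simps)
  have cc: "cls (k *s v 0) \<in> carr Q" for k using v0 by (auto simp: carr_Q)
  show ?thesis
  proof (intro equalityI subsetI)
    fix A assume A: "A \<in> W.line0"
    have "A = cls (qco A 0 *s v 0)"
    proof (rule W.co_inj)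
      show "A \<in> carr Q" using A by (simp add: W.line0_def)
      show "cls (qco A 0 *s v 0) \<in> carr Q" by (rule cc)
      fix x assume x: "x < n"
      show "qco A x = qco (cls (qco A 0 *s v 0)) x"
        using A x co0[OF x, of "qco A 0"] by (cases "x = 0") (auto simp: W.line0_def)
    qed
    then show "A \<in> (\<lambda>k. cls (k *s v 0)) ` UNIV" by blast
  next
    fix A assume "A \<in> (\<lambda>k. cls (k *s v 0)) ` UNIV"
    then obtain k where "A = cls (k *s v 0)" by blast
    then show "A \<in> W.line0" using cc co0 by (simp add: W.line0_def)
  qed
qed

end

section \<open>A common basis for the fibre and the cusp\<close>

lemma isotropic_quotient_of_pair:
  fixes G :: "int ^ 'm ^ 'm"
  assumes lat: "lattice_form G" and p: "lform G p p = 0" and pq: "lform G p q \<noteq> 0"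
    and v: "\<And>x. x < n \<Longrightarrow> lform G (v x) p = 0"
    and vv: "\<And>x y. x < n \<Longrightarrow> y < n \<Longrightarrow> lform G (v x) (v y) = of_bool (x + y = n - 1)"
    and complete: "\<And>t. lform G t p = 0 \<Longrightarrow> lform G t q = 0 \<Longrightarrow> (\<And>x. x < n \<Longrightarrow> lform G t (v x) = 0) \<Longrightarrow> t = 0"
    and n: "n \<ge> 3"
  shows "isotropic_quotient G p v n"
proof
  fix t assume t: "lform G t p = 0" "\<And>x. x < n \<Longrightarrow> lform G t (v x) = 0"
  define k where "k = lform G t q / lform G p q"
  have pv: "lform G p (v x) = 0" if "x < n" for x using v[OF that] lform_sym[OF lat] by metis
  have "t - k *s p = 0"
  proof (rule complete)
    show "lform G (t - k *s p) p = 0" using t p by (simp add: lform_diff_left lform_scale_left)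
    show "lform G (t - k *s p) q = 0" using pq by (simp add: lform_diff_left lform_scale_left k_def)
    show "lform G (t - k *s p) (v x) = 0" if "x < n" for x
      using t(2)[OF that] pv[OF that] by (simp add: lform_diff_left lform_scale_left)
  qed
  then have "t = k *s p" by simp
  then show "t \<in> vec.span {p}" by (auto simp: vec.span_singleton)
qed (use assms in auto)

definition int_vec :: "int ^ 'm \<Rightarrow> complex ^ 'm" where "int_vec x = (\<chi> i. of_int (x $ i))"

lemma int_vec_cvec: "int_vec x = cvec (\<chi> i. of_int (x $ i))"
  by (simp add: int_vec_def cvec_def vec_eq_iff)

lemma complexification_int_vec: "complexification M = vec.span (int_vec ` M)"
  by (simp add: complexification_def int_vec_def[abs_def])

lemma lform_int_vec: "lform G (int_vec x) (int_vec y) = of_int (lform G x y)"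
  by (simp add: lform_def int_vec_def)

lemma complexification_isotropic:
  assumes "isotropic G M" "x \<in> complexification M" "y \<in> complexification M"
  shows "lform G x y = 0"
proof -
  have a: "lform G (int_vec z) y = 0" if z: "z \<in> M" for z
    using assms(3) unfolding complexification_int_vec
  proof (induction rule: vec.span_induct)
    case base
    then show ?case by (auto simp: vec.subspace_def lform_simps)
  next
    case (step t)
    then show ?case using assms(1) z by (auto simp: lform_int_vec isotropic_def)
  qed
  show ?thesis using assms(2) unfolding complexification_int_vec
  proof (induction rule: vec.span_induct)
    case base
    then show ?case by (auto simp: vec.subspace_def lform_simps)
  next
    case (step t)
    then show ?case using a by auto
  qed
qed

text \<open>
  With \<open>p\<close> the image of \<open>z\<close>, the complement \<open>S\<close> of the hyperbolic plane of \<open>p\<close> and \<open>w\<close> is nondegenerate of dimension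
  \<open>n\<close>.  The plane \<open>J\<^sub>\<complex>\<close> is isotropic and not orthogonal to \<open>w\<close>, so it meets \<open>w\<^sup>\<bottom>\<close> in a line of \<open>S\<close>, from which a
  Witt basis can be started.
\<close>

lemma fibre_frame:
  fixes G :: "int ^ 'm ^ 'm"
  assumes lat: "lattice_form G" and sig: "has_signature G 2 n" and n: "n \<ge> 3"
    and iso: "isotropic G J" and rank: "sublattice_rank J = 2"
    and w: "lform G w w = 0" "Re (lform G w (\<chi> i. cnj (w $ i))) > 0"
    and z: "z \<in> J" "z \<noteq> 0"
  shows "\<exists>v. isotropic_quotient G w v n \<and> isotropic_quotient G (int_vec z) v n \<and>
     (\<forall>x<n. lform G (v x) w = 0 \<and> lform G (v x) (int_vec z) = 0) \<and> lform G (int_vec z) w \<noteq> 0 \<and>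
     complexification J = {a *s int_vec z + b *s v 0 | a b. True}"
proof -
  define p where "p = int_vec z"
  have pJ: "p \<in> complexification J" using z(1) by (simp add: p_def complexification_int_vec vec.span_base)
  have pp: "lform G p p = 0" using complexification_isotropic[OF iso pJ pJ] .
  have pw: "lform G p w \<noteq> 0"
  proof -
    let ?z = "\<chi> i. real_of_int (z $ i)"
    have "of_real (lform G ?z ?z) = (0::complex)"
      using pp by (simp only: p_def int_vec_cvec lform_cvec)
    moreover have "?z \<noteq> 0" using z(2) by (simp add: vec_eq_iff)
    ultimately show ?thesis
      using period_not_perp[OF lat sig w, of ?z] by (simp add: p_def int_vec_cvec)
  qed
  have wp: "lform G w p \<noteq> 0" using pw lform_sym[OF lat] by metis
  have p0: "p \<noteq> 0" using pw by (auto simp: lform_0_left)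
  have nU: "nondeg_on G UNIV"
    unfolding nondeg_on_def using lform_nondegenerate[OF sig] by (auto simp: vec.subspace_UNIV)
  define S where "S = {s \<in> UNIV. lform G s p = 0 \<and> lform G s w = 0}"
  note split = hyperbolic_split[OF lat nU UNIV_I UNIV_I pp pw, folded S_def]
  have "CARD('m) = 2 + n" using sig by (auto simp: has_signature_def)
  then have dimS: "vec.dim S = n" using split(2) unfolding vec_dim_card by linarith
  have dimJ: "vec.dim (complexification J) = 2" using rank by (simp add: sublattice_rank_def)
  have "\<not> complexification J \<subseteq> vec.span {p}"
  proof
    assume "complexification J \<subseteq> vec.span {p}"
    then have "vec.dim (complexification J) \<le> card {p}" by (intro vec.dim_le_card) auto
    then show False using dimJ by simp
  qed
  then obtain j where j: "j \<in> complexification J" "j \<notin> vec.span {p}" by blast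
  \<comment> \<open>The point of the line \<open>J\<^sub>\<complex> \<inter> w\<^sup>\<bottom>\<close>.\<close>
  define x where "x = j - (lform G j w / lform G p w) *s p"
  have sJ: "vec.subspace (complexification J)" by (simp add: complexification_int_vec vec.subspace_span)
  have xJ: "x \<in> complexification J" using j pJ sJ by (simp add: x_def vec.subspace_diff vec.subspace_scale)
  have xw: "lform G x w = 0" using pw by (simp add: x_def lform_diff_left lform_scale_left)
  have xp: "lform G x p = 0" "lform G x x = 0" using complexification_isotropic[OF iso] xJ pJ by blast+
  have xnp: "x \<notin> vec.span {p}"
  proof
    assume "x \<in> vec.span {p}"
    then have "x + (lform G j w / lform G p w) *s p \<in> vec.span {p}"
      by (rule vec.span_add[OF _ vec.span_scale[OF vec.span_base]]) simp
    then show False using j(2) by (simp add: x_def)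
  qed
  then have x0: "x \<noteq> 0" using vec.span_zero by metis
  have xS: "x \<in> S" using xw xp by (simp add: S_def)
  obtain v where v: "witt_basis G S n v" "v 0 = x"
    using witt_basis_starting[OF lat split(1) xS x0 xp(2)] dimS by auto
  have vS: "lform G (v y) p = 0" "lform G (v y) w = 0" if "y < n" for y
    using v(1) that by (auto simp: witt_basis_def S_def)
  have vv: "lform G (v a) (v b) = of_bool (a + b = n - 1)" if "a < n" "b < n" for a b
    using v(1) that by (auto simp: witt_basis_def)
  have comp: "t = 0" if "lform G t p = 0" "lform G t w = 0" "\<And>y. y < n \<Longrightarrow> lform G t (v y) = 0" for t
    using v(1) that by (auto simp: witt_basis_def S_def)
  have "isotropic_quotient G w v n"
    by (rule isotropic_quotient_of_pair[OF lat w(1) wp vS(2) vv comp n])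
  moreover have "isotropic_quotient G p v n"
    by (rule isotropic_quotient_of_pair[OF lat pp pw vS(1) vv comp n])
  moreover have "complexification J = {a *s p + b *s v 0 | a b. True}"
  proof
    have ne: "x \<noteq> p" using xnp vec.span_base by blast
    have ip: "vec.independent {p}" using p0 by simp
    have ind: "vec.independent {x, p}" by (rule vec.independent_insertI[OF _ ip]) (rule xnp)
    have "complexification J \<subseteq> vec.span {x, p}"
      by (rule vec.card_ge_dim_independent[OF _ ind]) (use xJ pJ dimJ ne in auto)
    also have "\<dots> \<subseteq> {a *s p + b *s v 0 | a b. True}"
    proof
      fix t assume "t \<in> vec.span {x, p}"
      then obtain b where "t - b *s x \<in> vec.span {p}" unfolding vec.span_breakdown_eq by blast
      then obtain a where "t - b *s x = a *s p" by (auto simp: vec.span_singleton)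
      then have "t = a *s p + b *s v 0" unfolding v(2) by (simp add: algebra_simps)
      then show "t \<in> {a *s p + b *s v 0 | a b. True}" by blast
    qed
    finally show "complexification J \<subseteq> {a *s p + b *s v 0 | a b. True}" .
    show "{a *s p + b *s v 0 | a b. True} \<subseteq> complexification J"
      using pJ xJ sJ v(2) by (auto simp: vec.subspace_add vec.subspace_scale)
  qed
  ultimately show ?thesis using vS pw unfolding p_def by blast
qed

section \<open>The fibres of the filtration\<close>

lemma (in witt_space) filt_schur_rep:
  assumes d: "d = sum_list lam" and T: "tableau d l1 n rw cl ht"
    and R: "row_subgroup lam = tableau.rows d rw" and C: "column_subgroup lam = tableau.cols d cl"
    and r: "- int d \<le> r"
  shows "filt_schur V line0 lam r = rep d ` tableau.level d n rw cl r"
proof -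
  interpret T: tableau d l1 n rw cl ht by (rule T)
  let ?A = "{c \<in> supported d. \<forall>w. c w \<noteq> 0 \<longrightarrow> r \<le> weight n w}"
  have sup: "T.schur_words \<subseteq> supported d" using T.schur_words_support by (auto simp: supported_def)
  have "filt_schur V line0 lam r = rep d ` T.schur_words \<inter> rep d ` ?A"
    unfolding filt_schur_def schur_orth_rep[OF d T R C] filt_tensor_rep[OF r, unfolded d] d ..
  also have "\<dots> = rep d ` (T.schur_words \<inter> ?A)"
    by (rule inj_on_image_Int[OF rep_inj[of d] sup, symmetric]) auto
  also have "T.schur_words \<inter> ?A = T.level r" using sup by (auto simp: T.level_def)
  finally show ?thesis .
qed

lemma (in witt_space) dim_rep:
  assumes "cfun.subspace S" "S \<subseteq> supported d"
  shows "cfun.dim (rep d ` S) = cfun.dim S"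
  by (rule cfun_dim_image[OF rep_add rep_scale inj_on_subset[OF rep_inj assms(2)] assms(1)])

lemma mat_act_identity:
  assumes "\<And>w. w \<notin> words n d \<Longrightarrow> c w = 0"
  shows "mat_act n d (\<lambda>a b. of_bool (b = a)) c = c"
proof (rule ext)
  fix w show "mat_act n d (\<lambda>a b. of_bool (b = a)) c w = c w"
  proof (cases "w \<in> words n d")
    case True
    have "(\<Sum>u\<in>words n d. (\<Prod>i<d. of_bool (u ! i = w ! i)) * c u) = (\<Sum>u\<in>words n d. if u = w then c w else 0)"
    proof (intro sum.cong refl)
      fix u assume u: "u \<in> words n d"
      show "(\<Prod>i<d. of_bool (u ! i = w ! i)) * c u = (if u = w then c w else 0)"
      proof (cases "u = w")
        case False
        then obtain i where "i < d" "u ! i \<noteq> w ! i"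
          using u True nth_equalityI[of u w] by (auto simp: words_length)
        then have "(\<Prod>i<d. of_bool (u ! i = w ! i)) = (0::complex)" by (intro prod_zero) auto
        then show ?thesis using False by simp
      qed simp
    qed
    then show ?thesis using True finite_words by (simp add: mat_act_def)
  qed (simp add: mat_act_def assms)
qed

lemma coset_collapse:
  assumes "cfun.subspace F" "t \<in> F" shows "t +o F = F"
proof (intro equalityI subsetI)
  fix x assume "x \<in> t +o F"
  then obtain y where "y \<in> F" "x = t + y" by (auto simp: elt_set_plus_def)
  then show "x \<in> F" using assms cfun.subspace_add by blast
next
  fix x assume "x \<in> F"
  then have "x - t \<in> F" using assms cfun.subspace_diff by blast
  moreover have "x = t + (x - t)" by simp
  ultimately show "x \<in> t +o F" unfolding elt_set_plus_def by blast
qed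

lemma Gr_nonzero_strict:
  assumes "cfun.subspace (F_lam G J lam (r + 1) l)" "t \<in> F_lam G J lam r l" "t \<notin> F_lam G J lam (r + 1) l"
  shows "Gr_nonzero G J lam r l"
proof -
  have "t + 0 \<in> t +o F_lam G J lam (r + 1) l"
    using cfun.subspace_0[OF assms(1)] unfolding elt_set_plus_def by blast
  then have "t +o F_lam G J lam (r + 1) l \<noteq> F_lam G J lam (r + 1) l" using assms(3) by auto
  then show ?thesis using assms(2) unfolding Gr_nonzero_def Gr_lam_def by blast
qed

lemma Gr_nonzero_const:
  assumes "cfun.subspace (F_lam G J lam r l)" "F_lam G J lam (r + 1) l = F_lam G J lam r l"
  shows "\<not> Gr_nonzero G J lam r l"
proof -
  have "(\<lambda>t. t +o F_lam G J lam r l) ` F_lam G J lam r l = {F_lam G J lam r l}"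
    using coset_collapse[OF assms(1)] cfun.subspace_0[OF assms(1)] by auto
  then show ?thesis by (simp add: Gr_nonzero_def Gr_lam_def assms(2))
qed

lemma nonzero_lattice_vector:
  assumes "sublattice_rank M \<noteq> 0"
  shows "\<exists>z\<in>M. z \<noteq> 0"
proof (rule ccontr)
  assume no: "\<not> (\<exists>z\<in>M. z \<noteq> 0)"
  have "int_vec z = 0" if "z \<in> M" for z using no that by (auto simp: int_vec_def vec_eq_iff)
  then have "int_vec ` M \<subseteq> {0}" by blast
  then have "complexification M \<subseteq> vec.span {0}" unfolding complexification_int_vec by (rule vec.span_mono)
  then have "vec.dim (complexification M) \<le> vec.dim {0 :: complex ^ 'a}" by (rule vec.dim_mono)
  then show False using assms by (simp add: sublattice_rank_def)
qed

lemma complexification_rank1: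
  assumes rank: "sublattice_rank M = 1" and z: "z \<in> M" "z \<noteq> 0"
  shows "complexification M = vec.span {int_vec z}"
proof -
  have zM: "int_vec z \<in> complexification M" using z(1) by (simp add: complexification_int_vec vec.span_base)
  have z0: "int_vec z \<noteq> 0" using z(2) by (simp add: int_vec_def vec_eq_iff)
  have ind: "vec.independent {int_vec z}" using z0 by simp
  have "complexification M \<subseteq> vec.span {int_vec z}"
    by (rule vec.card_ge_dim_independent[OF _ ind]) (use zM rank in \<open>auto simp: sublattice_rank_def\<close>)
  moreover have "vec.span {int_vec z} \<subseteq> complexification M"
    using zM by (intro vec.span_minimal) (auto simp: complexification_int_vec vec.subspace_span)
  ultimately show ?thesis by blast
qed

lemma E_J_line0:
  assumes A: "isotropic_quotient G w v n" and c: "lform G c w \<noteq> 0"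
    and J: "complexification J = {a *s c + b *s v 0 | a b. True}"
  shows "E_J G J (vec.span {w}) =
    witt_space.line0 (E_fib G (vec.span {w})) n (isotropic_quotient.qco G w v n)"
proof -
  interpret A: isotropic_quotient G w v n by (rule A)
  have v0: "lform G (v 0) w = 0" using A.vu[of 0] A.n3 by simp
  have "perp G (vec.span {w}) \<inter> complexification J = (\<lambda>k. k *s v 0) ` UNIV"
  proof (intro equalityI subsetI)
    fix x assume x: "x \<in> perp G (vec.span {w}) \<inter> complexification J"
    then obtain a b where ab: "x = a *s c + b *s v 0" unfolding J by blast
    have "lform G x w = 0" using x by (simp add: A.perp_iff)
    then have "a = 0" using c v0 by (simp add: ab lform_simps)
    then have "x = b *s v 0" using ab by simp
    then show "x \<in> (\<lambda>k. k *s v 0) ` UNIV" by (rule image_eqI) simp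
  next
    fix x assume "x \<in> (\<lambda>k. k *s v 0) ` UNIV"
    then obtain b where b: "x = b *s v 0" by blast
    have "x = 0 *s c + b *s v 0" using b by simp
    then have "x \<in> complexification J" unfolding J by blast
    then show "x \<in> perp G (vec.span {w}) \<inter> complexification J" using v0 by (simp add: A.perp_iff b lform_simps)
  qed
  then show ?thesis
    unfolding E_J_def E_fib_def A.line0_cls A.cls_def by (simp add: image_image)
qed

lemma J_mod_I_line0:
  assumes A: "isotropic_quotient G c v n"
    and J: "complexification J = {a *s c + b *s v 0 | a b. True}"
  shows "(\<lambda>x. x +o vec.span {c}) ` complexification J =
    witt_space.line0 (quot_space G (perp G (vec.span {c})) (vec.span {c})) n (isotropic_quotient.qco G c v n)"
proof -
  interpret A: isotropic_quotient G c v n by (rule A)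
  have e: "A.cls (a *s c + b *s v 0) = A.cls (b *s v 0)" for a b
    by (auto simp: A.cls_eq vec.span_singleton)
  have "A.cls ` complexification J = (\<lambda>k. A.cls (k *s v 0)) ` UNIV"
  proof (intro equalityI subsetI)
    fix X assume "X \<in> A.cls ` complexification J"
    then show "X \<in> (\<lambda>k. A.cls (k *s v 0)) ` UNIV" unfolding J using e by auto
  next
    fix X assume "X \<in> (\<lambda>k. A.cls (k *s v 0)) ` UNIV"
    then obtain k where k: "X = A.cls (0 *s c + k *s v 0)" using e by auto
    have "0 *s c + k *s v 0 \<in> complexification J" unfolding J by blast
    then show "X \<in> A.cls ` complexification J" unfolding k by (rule imageI)
  qed
  then show ?thesis unfolding A.line0_cls by (simp add: A.cls_def[abs_def])
qed

text \<open>
  The coset of \<open>x\<close> modulo \<open>\<complex>c\<close> meets \<open>w\<^sup>\<bottom>\<close> in exactly one point, as \<open>(c, w) \<noteq> 0\<close>.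
\<close>

lemma I_triv_coset:
  assumes lat: "lattice_form G" and cw: "lform G c w \<noteq> 0"
  shows "I_triv G (vec.span {w}) (x +o vec.span {c}) = (x - (lform G x w / lform G c w) *s c) +o vec.span {w}"
proof -
  let ?y = "x - (lform G x w / lform G c w) *s c"
  have perp: "t \<in> perp G (vec.span {w}) \<longleftrightarrow> lform G t w = 0" for t
  proof
    assume "t \<in> perp G (vec.span {w})"
    then show "lform G t w = 0" using vec.span_base[of w "{w}"] by (simp add: perp_def)
  next
    assume "lform G t w = 0"
    then show "t \<in> perp G (vec.span {w})" by (auto simp: perp_def vec.span_singleton lform_scale_right)
  qed
  have mem: "t \<in> (x +o vec.span {c}) \<inter> perp G (vec.span {w}) \<longleftrightarrow> t = ?y" for t
  proof
    assume t: "t \<in> (x +o vec.span {c}) \<inter> perp G (vec.span {w})"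
    then obtain k where k: "t = x + k *s c" by (auto simp: elt_set_plus_def vec.span_singleton)
    have "lform G x w + k * lform G c w = 0" using t perp k by (simp add: lform_simps)
    then have "k = - (lform G x w / lform G c w)" using cw by (simp add: field_simps add_eq_0_iff)
    then show "t = ?y" using k by simp
  next
    assume t: "t = ?y"
    have "t = x + (- (lform G x w / lform G c w)) *s c" using t by simp
    then have "t \<in> x +o vec.span {c}" unfolding elt_set_plus_def vec.span_singleton by blast
    moreover have "lform G t w = 0" using t cw by (simp add: lform_diff_left lform_scale_left)
    ultimately show "t \<in> (x +o vec.span {c}) \<inter> perp G (vec.span {w})" using perp by simp
  qed
  show ?thesis unfolding I_triv_def Bex_def mem by simp
qed

text \<open>
  The vectors \<open>v x\<close> are orthogonal to both \<open>c\<close> and \<open>w\<close>, so the trivialization takes the basis of one quotient to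
  the basis of the other.
\<close>

lemma map_tensor_I_triv:
  assumes lat: "lattice_form G" and E: "isotropic_quotient G w v n" and C: "isotropic_quotient G c v n" and cw: "lform G c w \<noteq> 0"
    and sup: "\<And>u. u \<notin> words n d \<Longrightarrow> t u = 0"
  shows "map_tensor (E_fib G (vec.span {w})) d (I_triv G (vec.span {w}))
      (witt_space.rep (quot_space G (perp G (vec.span {c})) (vec.span {c})) n (isotropic_quotient.qbas c v) d t) =
    witt_space.rep (E_fib G (vec.span {w})) n (isotropic_quotient.qbas w v) d t"
proof -
  interpret E: isotropic_quotient G w v n by (rule E)
  interpret C: isotropic_quotient G c v n by (rule C)
  define k where "k x = lform G x w / lform G c w" for x
  have tr: "I_triv G (vec.span {w}) (C.cls x) = E.cls (x - k x *s c)" for x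
    unfolding C.cls_def E.cls_def k_def by (rule I_triv_coset[OF lat cw])
  have perp: "lform G (x - k x *s c) w = 0" for x
    using cw by (simp add: k_def lform_diff_left lform_scale_left)
  have kadd: "k (x + y) = k x + k y" and ksc: "k (a *s x) = a * k x" for x y a
    by (simp_all add: k_def lform_simps add_divide_distrib)
  interpret CW: witt_space C.Q n C.qco C.qbas by (rule C.witt)
  interpret EW: witt_space E.Q n E.qco E.qbas by (rule E.witt)
  have "map_tensor E.Q d (I_triv G (vec.span {w})) (CW.rep d t) =
      EW.rep d (mat_act n d (\<lambda>a b. E.qco (I_triv G (vec.span {w}) (C.qbas b)) a) t)"
  proof (rule map_tensor_rep[OF C.witt E.witt])
    fix A B a assume "A \<in> carr C.Q"
    then obtain x where x: "A = C.cls x" "lform G x c = 0" by (auto simp: C.carr_Q)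
    show "I_triv G (vec.span {w}) A \<in> carr E.Q" unfolding x tr using perp by (auto simp: E.carr_Q)
    show "I_triv G (vec.span {w}) (smul C.Q a A) = smul E.Q a (I_triv G (vec.span {w}) A)"
      unfolding x C.smul_cls tr E.smul_cls ksc by (simp add: vec.scale_right_diff_distrib)
    assume "B \<in> carr C.Q"
    then obtain y where y: "B = C.cls y" "lform G y c = 0" by (auto simp: C.carr_Q)
    show "I_triv G (vec.span {w}) (vadd C.Q A B) = vadd E.Q (I_triv G (vec.span {w}) A) (I_triv G (vec.span {w}) B)"
      unfolding x y C.vadd_cls tr E.vadd_cls kadd by (simp add: vec.scale_left_distrib algebra_simps)
  qed
  also have "mat_act n d (\<lambda>a b. E.qco (I_triv G (vec.span {w}) (C.qbas b)) a) t = mat_act n d (\<lambda>a b. of_bool (b = a)) t"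
  proof (rule EW.mat_act_cong)
    fix a b assume ab: "a < n" "b < n"
    have "I_triv G (vec.span {w}) (C.qbas b) = E.qbas b"
      unfolding C.qbas_def tr E.qbas_def using E.vu[OF ab(2)] by (simp add: k_def)
    then show "E.qco (I_triv G (vec.span {w}) (C.qbas b)) a = of_bool (b = a)"
      using EW.co_bas[OF ab(2,1)] by simp
  qed
  also have "\<dots> = t" using sup by (rule mat_act_identity)
  finally show ?thesis by (simp add: E_fib_def)
qed

lemma period_domain_point:
  assumes "period_domain G D" "l \<in> D"
  obtains w where "l = vec.span {w}" "lform G w w = 0" "Re (lform G w (\<chi> i. cnj (w $ i))) > 0"
proof -
  have "D \<subseteq> topspace (subtopology proj_topology (period_locus G))"
    using connected_components_of_subset[OF assms(1)[unfolded period_domain_def]] .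
  then have "l \<in> period_locus G" using assms(2) by auto
  then show ?thesis using that by (auto simp: period_locus_def)
qed

theorem proposition8p13:
  fixes G :: "int ^ 'm ^ 'm" and n :: nat
    and D :: "(complex ^ 'm) set set" and J :: "(int ^ 'm) set" and lam :: "nat list" and d lam1 :: int
  assumes "lattice_form G" and "has_signature G 2 n" and "n \<ge> 3"
    and "period_domain G D"
    and "primitive_sublattice J" and "isotropic G J" and "sublattice_rank J = 2"
    and "length lam = n" and "sorted_wrt (\<ge>) lam"
    and "conj_part lam 1 + conj_part lam 2 \<le> n" and "lam \<noteq> replicate n 1"
    and "d = int (sum_list lam)" and "lam1 = int (lam ! 0)"
  shows "(\<forall>l\<in>D. F_lam G J lam (lam1 + 1) l = {0})
    \<and> (\<forall>l\<in>D. F_lam G J lam (- lam1) l = E_lam G lam l)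
    \<and> (\<forall>l\<in>D. bij_betw (\<lambda>t. t +o F_lam G J lam (lam1 + 1) l) (F_lam G J lam lam1 l)
         (Gr_lam G J lam lam1 l))
    \<and> (\<forall>l\<in>D. F_lam G J lam lam1 l \<noteq> {0} \<and> Gr_nonzero G J lam lam1 l)
    \<and> (\<forall>l\<in>D. Gr_nonzero G J lam (- lam1) l)
    \<and> (\<forall>l\<in>D. {r \<in> {- d..d}. Gr_nonzero G J lam r l} \<subseteq> {- lam1..lam1} \<and>
         int (card {r \<in> {- d..d}. Gr_nonzero G J lam r l}) \<le> 2 * lam1 + 1)
    \<and> (\<forall>r \<in> {- d..d}. \<exists>k. \<forall>l\<in>D. Gr_dim G J lam r l = k \<and> Gr_dim G J lam (- r) l = k)
    \<and> (\<forall>I. primitive_sublattice I \<and> sublattice_rank I = 1 \<and> I \<subseteq> J \<longrightarrow>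
         (\<forall>l\<in>D. F_lam G J lam lam1 l = E_lam_J G I J lam l))"
proof -
  note lat = assms(1) and sig = assms(2) and n3 = assms(3) and isoJ = assms(6) and rankJ = assms(7)
    and len = assms(8) and sorted = assms(9)
  let ?d = "sum_list lam" and ?rw = "\<lambda>p. fst (cell lam p)" and ?cl = "\<lambda>p. snd (cell lam p)"
  have npos: "0 < n" using n3 by simp
  have T: "tableau ?d (lam ! 0) n ?rw ?cl (col_height lam)"
    by (rule tableau_of_partition[OF len sorted npos assms(10,11) n3])
  note RC = row_subgroup_eq[OF len sorted npos T]
  interpret T: tableau ?d "lam ! 0" n ?rw ?cl "col_height lam" by (rule T)
  have lam1_le: "lam1 \<le> d" unfolding assms(12,13) using elem_le_sum_list[of 0 lam] len npos by simp
  have lam1_nonneg: "0 \<le> lam1" unfolding assms(13) by simp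
  have sup: "T.level r \<subseteq> {c. \<forall>w. w \<notin> words n ?d \<longrightarrow> c w = 0}" for r
    using T.level_subset T.schur_words_support by blast

  have model: "\<exists>bas co. witt_space (E_fib G l) n co bas \<and>
      E_lam G lam l = witt_space.rep (E_fib G l) n bas ?d ` T.schur_words \<and>
      (\<forall>r. - d \<le> r \<longrightarrow> F_lam G J lam r l = witt_space.rep (E_fib G l) n bas ?d ` T.level r)"
    and invariants: "F_lam G J lam lam1 l = E_lam_J G I J lam l"
    if l: "l \<in> D" and z: "z \<in> J" "z \<noteq> 0" and I: "complexification I = vec.span {int_vec z}" for l z I
  proof -
    obtain w where w: "l = vec.span {w}" "lform G w w = 0" "Re (lform G w (\<chi> i. cnj (w $ i))) > 0"
      using period_domain_point[OF assms(4) l] .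
    let ?c = "int_vec z"
    obtain v where E: "isotropic_quotient G w v n" and C: "isotropic_quotient G ?c v n"
      and cw: "lform G ?c w \<noteq> 0" and cJ: "complexification J = {a *s ?c + b *s v 0 | a b. True}"
      using fibre_frame[OF lat sig n3 isoJ rankJ w(2,3) z] by blast
    interpret E: isotropic_quotient G w v n by (rule E)
    interpret C: isotropic_quotient G ?c v n by (rule C)
    have Ef: "E_fib G l = E.Q" by (simp add: E_fib_def w(1))
    have Vc: "V_cusp G I = C.Q" by (simp add: V_cusp_def I)
    interpret EW: witt_space "E_fib G l" n E.qco E.qbas unfolding Ef by (rule E.witt)
    interpret CW: witt_space "V_cusp G I" n C.qco C.qbas unfolding Vc by (rule C.witt)
    have EJ: "E_J G J l = EW.line0" unfolding w(1) by (rule E_J_line0[OF E cw cJ])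
    have F: "F_lam G J lam r l = EW.rep ?d ` T.level r" if "- d \<le> r" for r
      unfolding F_lam_def EJ using that
      by (intro EW.filt_schur_rep[OF refl T RC]) (simp add: assms(12))
    have "E_lam G lam l = EW.rep ?d ` T.schur_words"
      unfolding E_lam_def by (rule EW.schur_orth_rep[OF refl T RC])
    then show "\<exists>bas co. witt_space (E_fib G l) n co bas \<and>
      E_lam G lam l = witt_space.rep (E_fib G l) n bas ?d ` T.schur_words \<and>
      (\<forall>r. - d \<le> r \<longrightarrow> F_lam G J lam r l = witt_space.rep (E_fib G l) n bas ?d ` T.level r)"
      using EW.witt_space_axioms F by blast
    have N: "(\<lambda>x. x +o complexification I) ` complexification J = CW.line0"
      unfolding I Vc by (rule J_mod_I_line0[OF C cJ])
    have "V_lam_inv G I J lam = CW.rep ?d ` T.level (int (lam ! 0))"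
      unfolding V_lam_inv_def U_cusp_def N CW.schur_orth_rep[OF refl T RC]
      by (rule CW.unip_radical_invariants[OF T])
    then have "E_lam_J G I J lam l = (\<lambda>t. map_tensor (E_fib G l) ?d (I_triv G l) (CW.rep ?d t)) ` T.level (int (lam ! 0))"
      unfolding E_lam_J_def by (simp add: image_image)
    also have "\<dots> = EW.rep ?d ` T.level (int (lam ! 0))"
    proof (rule image_cong[OF refl])
      fix t assume "t \<in> T.level (int (lam ! 0))"
      then have s: "t u = 0" if "u \<notin> words n ?d" for u using sup that by blast
      show "map_tensor (E_fib G l) ?d (I_triv G l) (CW.rep ?d t) = EW.rep ?d t"
        unfolding w(1) Vc by (rule map_tensor_I_triv[OF lat E C cw s])
    qed
    finally show "F_lam G J lam lam1 l = E_lam_J G I J lam l"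
      using F[of lam1] lam1_nonneg lam1_le by (simp add: assms(13))
  qed

  \<comment> \<open>For the assertions that do not involve \<open>I\<close>, the line of any \<open>z \<in> J\<close> serves as the isotropic line that trivializes the bundle.\<close>
  obtain z where z: "z \<in> J" "z \<noteq> 0" using nonzero_lattice_vector[of J] rankJ by auto
  have "complexification {z} = vec.span {int_vec z}" by (simp add: complexification_int_vec)
  note fibre = model[OF _ z this]

  have main: "F_lam G J lam (lam1 + 1) l = {0}" "F_lam G J lam (- lam1) l = E_lam G lam l"
    "F_lam G J lam lam1 l \<noteq> {0}" "F_lam G J lam (- lam1 + 1) l \<subset> F_lam G J lam (- lam1) l"
    "\<And>r. - d \<le> r \<Longrightarrow> cfun.subspace (F_lam G J lam r l)"
    "\<And>r. - d \<le> r \<Longrightarrow> lam1 < r \<Longrightarrow> F_lam G J lam (r + 1) l = F_lam G J lam r l"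
    "\<And>r. - d \<le> r \<Longrightarrow> r < - lam1 \<Longrightarrow> F_lam G J lam (r + 1) l = F_lam G J lam r l"
    "\<And>r. - d \<le> r \<Longrightarrow> Gr_dim G J lam r l = int (cfun.dim (T.weight_space r))"
    if l: "l \<in> D" for l
  proof -
    obtain bas co where W: "witt_space (E_fib G l) n co bas"
      and El: "E_lam G lam l = witt_space.rep (E_fib G l) n bas ?d ` T.schur_words"
      and F': "\<forall>r. - d \<le> r \<longrightarrow> F_lam G J lam r l = witt_space.rep (E_fib G l) n bas ?d ` T.level r"
      using fibre[OF l] by blast
    interpret W: witt_space "E_fib G l" n co bas by (rule W)
    have F: "F_lam G J lam r l = W.rep ?d ` T.level r" if "- d \<le> r" for r using F' that by blast
    have sup': "T.level r \<subseteq> W.supported ?d" for r using sup by (simp add: W.supported_def)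
    have inj: "W.rep ?d ` T.level r = W.rep ?d ` T.level s \<longleftrightarrow> T.level r = T.level s" for r s
      using inj_on_image_eq_iff[OF W.rep_inj sup' sup'] .
    have r0: "W.rep ?d ` {0} = {0}" by (simp add: W.rep_zero)
    have top: "T.level r = {0}" if "lam1 < r" for r using T.level_zero that by (simp add: assms(13))
    have bot: "T.level r = T.schur_words" if "r \<le> - lam1" for r using T.level_full that by (simp add: assms(13))
    show "F_lam G J lam (lam1 + 1) l = {0}"
      using F[of "lam1 + 1"] top[of "lam1 + 1"] r0 lam1_nonneg lam1_le by simp
    show "F_lam G J lam (- lam1) l = E_lam G lam l"
      using F[of "- lam1"] bot[of "- lam1"] El lam1_le by simp
    show "F_lam G J lam lam1 l \<noteq> {0}"
    proof
      assume "F_lam G J lam lam1 l = {0}"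
      then have "W.rep ?d ` T.level lam1 = W.rep ?d ` T.level (lam1 + 1)"
        using F[of lam1] top[of "lam1 + 1"] r0 lam1_nonneg lam1_le by simp
      then have "T.level lam1 = T.level (lam1 + 1)" by (simp only: inj)
      then have "T.level lam1 = {0}" using top[of "lam1 + 1"] by simp
      then show False using T.level_top_nonzero by (simp add: assms(13))
    qed
    show "F_lam G J lam (- lam1 + 1) l \<subset> F_lam G J lam (- lam1) l"
    proof (rule psubsetI)
      show "F_lam G J lam (- lam1 + 1) l \<subseteq> F_lam G J lam (- lam1) l"
        using F[of "- lam1 + 1"] F[of "- lam1"] T.level_anti[of "- lam1" "- lam1 + 1"] lam1_le by auto
      show "F_lam G J lam (- lam1 + 1) l \<noteq> F_lam G J lam (- lam1) l"
        using F[of "- lam1 + 1"] F[of "- lam1"] inj T.level_bottom_strict lam1_le by (simp add: assms(13))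
    qed
    show "cfun.subspace (F_lam G J lam r l)" if "- d \<le> r" for r
      unfolding F[OF that] by (rule W.subspace_rep_image[OF T.level_subspace])
    show "F_lam G J lam (r + 1) l = F_lam G J lam r l" if "- d \<le> r" "lam1 < r" for r
      using F[of r] F[of "r + 1"] top[of r] top[of "r + 1"] that by simp
    show "F_lam G J lam (r + 1) l = F_lam G J lam r l" if "- d \<le> r" "r < - lam1" for r
      using F[of r] F[of "r + 1"] bot[of r] bot[of "r + 1"] that by simp
    show "Gr_dim G J lam r l = int (cfun.dim (T.weight_space r))" if "- d \<le> r" for r
      using F[of r] F[of "r + 1"] that T.dim_level[of r]
        W.dim_rep[OF T.level_subspace sup', of r] W.dim_rep[OF T.level_subspace sup', of "r + 1"]
      by (simp add: Gr_dim_def)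
  qed

  have lo: "- d \<le> lam1 + 1" "- d \<le> - lam1 + 1" "- d \<le> lam1" "- d \<le> - lam1" using lam1_le lam1_nonneg by simp_all
  have zero_mem: "0 \<in> F_lam G J lam r l" if "l \<in> D" "- d \<le> r" for l r
    using cfun.subspace_0[OF main(5)[OF that]] .
  have bij: "bij_betw (\<lambda>t. t +o F_lam G J lam (lam1 + 1) l) (F_lam G J lam lam1 l) (Gr_lam G J lam lam1 l)"
    if l: "l \<in> D" for l
  proof -
    have "t +o {0} = {t}" for t :: "(complex ^ 'm) set tensor" by (simp add: elt_set_plus_def)
    then show ?thesis
      unfolding bij_betw_def Gr_lam_def main(1)[OF l] by (auto simp: inj_on_def)
  qed
  have nz_top: "Gr_nonzero G J lam lam1 l" if l: "l \<in> D" for l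
  proof -
    obtain t where "t \<in> F_lam G J lam lam1 l" "t \<noteq> 0" using main(3)[OF l] zero_mem[OF l lo(3)] by blast
    then show ?thesis
      using main(1)[OF l] by (intro Gr_nonzero_strict[OF main(5)[OF l lo(1)], of t]) auto
  qed
  have nz_bot: "Gr_nonzero G J lam (- lam1) l" if l: "l \<in> D" for l
  proof -
    obtain t where "t \<in> F_lam G J lam (- lam1) l" "t \<notin> F_lam G J lam (- lam1 + 1) l" using main(4)[OF l] by blast
    then show ?thesis by (intro Gr_nonzero_strict[OF main(5)[OF l lo(2)], of t])
  qed
  have range: "{r \<in> {- d..d}. Gr_nonzero G J lam r l} \<subseteq> {- lam1..lam1}" if l: "l \<in> D" for l
  proof
    fix r assume r: "r \<in> {r \<in> {- d..d}. Gr_nonzero G J lam r l}"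
    then have "- d \<le> r" "Gr_nonzero G J lam r l" by auto
    then have "\<not> lam1 < r" "\<not> r < - lam1"
      using Gr_nonzero_const[OF main(5)[OF l]] main(6,7)[OF l] by blast+
    then show "r \<in> {- lam1..lam1}" by simp
  qed
  have card: "int (card {r \<in> {- d..d}. Gr_nonzero G J lam r l}) \<le> 2 * lam1 + 1" if l: "l \<in> D" for l
  proof -
    have "card {r \<in> {- d..d}. Gr_nonzero G J lam r l} \<le> card {- lam1..lam1}"
      using range[OF l] by (intro card_mono) auto
    then show ?thesis using lam1_nonneg by simp
  qed
  have dims: "\<exists>k. \<forall>l\<in>D. Gr_dim G J lam r l = k \<and> Gr_dim G J lam (- r) l = k" if r: "r \<in> {- d..d}" for r
  proof (intro exI[of _ "int (cfun.dim (T.weight_space r))"] ballI conjI)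
    fix l assume l: "l \<in> D"
    show "Gr_dim G J lam r l = int (cfun.dim (T.weight_space r))" using main(8)[OF l, of r] r by simp
    show "Gr_dim G J lam (- r) l = int (cfun.dim (T.weight_space r))"
      using main(8)[OF l, of "- r"] r T.dim_weight_space_neg[of r] by simp
  qed
  have inv: "F_lam G J lam lam1 l = E_lam_J G I J lam l"
    if I: "sublattice_rank I = 1" "I \<subseteq> J" and l: "l \<in> D" for I l
  proof -
    obtain y where y: "y \<in> I" "y \<noteq> 0" using nonzero_lattice_vector[of I] I(1) by auto
    show ?thesis by (rule invariants[OF l _ y(2) complexification_rank1[OF I(1) y]]) (use y I in auto)
  qed
  show ?thesis
  proof (intro conjI ballI allI impI)
    fix l assume l: "l \<in> D"
    show "F_lam G J lam (lam1 + 1) l = {0}" by (rule main(1)[OF l])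
    show "F_lam G J lam (- lam1) l = E_lam G lam l" by (rule main(2)[OF l])
    show "bij_betw (\<lambda>t. t +o F_lam G J lam (lam1 + 1) l) (F_lam G J lam lam1 l) (Gr_lam G J lam lam1 l)"
      by (rule bij[OF l])
    show "F_lam G J lam lam1 l \<noteq> {0}" by (rule main(3)[OF l])
    show "Gr_nonzero G J lam lam1 l" by (rule nz_top[OF l])
    show "Gr_nonzero G J lam (- lam1) l" by (rule nz_bot[OF l])
    show "{r \<in> {- d..d}. Gr_nonzero G J lam r l} \<subseteq> {- lam1..lam1}" by (rule range[OF l])
    show "int (card {r \<in> {- d..d}. Gr_nonzero G J lam r l}) \<le> 2 * lam1 + 1" by (rule card[OF l])
  next
    fix r assume "r \<in> {- d..d}"
    then show "\<exists>k. \<forall>l\<in>D. Gr_dim G J lam r l = k \<and> Gr_dim G J lam (- r) l = k" by (rule dims)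
  next
    fix I l assume "primitive_sublattice I \<and> sublattice_rank I = 1 \<and> I \<subseteq> J" and l: "l \<in> D"
    then show "F_lam G J lam lam1 l = E_lam_J G I J lam l" by (intro inv) auto
  qed
qed

end
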